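(* Let $(a_1,a_2,a_3,a_4,a_5)\in\mathbb{R}^5$ with $0<a_1<a_2<a_3<a_4<a_5$, and let $$b_1=-\frac{a_1a_3a_5}{a_2a_4},\qquad w=\sqrt{z-a_1}\sqrt{z-a_2}\sqrt{z-a_3}\sqrt{z-a_4}\sqrt{z-a_5}\sqrt{z-b_1},$$ $$g(z)=\frac{\sqrt{z-a_1}\sqrt{z-a_3}\sqrt{z-a_5}}{\sqrt{z-a_2}\sqrt{z-a_4}\sqrt{z-b_1}},\qquad \omega_3=\frac1z\,dz.$$ Then there exist $\lambda_1,\lambda_2,\lambda_3,\lambda_4\in\mathbb{C}$ such that $$\omega_1=\frac12\left(\frac1{g(z)}-g(z)\right)\omega_3+\frac{(\lambda_1+\lambda_2z)\,dz}{w},$$ $$\omega_2=\frac i2\left(\frac1{g(z)}+g(z)\right)\omega_3+\frac{(\lambda_3+\lambda_4z)\,dz}{w},$$ $$\omega_3=\frac1z\,dz$$ is the Weierstrass representation for a genus two doubly periodic harmonic surface with orthogonal top and bottom Scherk ends. The handles lie between every other pair of consecutive ends (in the sense made precise by the period equations in the context).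
   Context: Domain: $g$ and $w$ are regarded as meromorphic functions on the compact genus two hyperelliptic Riemann surface $X$ given by $w^2=(z-b_1)\prod_{k=1}^5(z-a_k)$, with $g=(z-a_1)(z-a_3)(z-a_5)/w$. The ends are the four points of $X$ over $z=0$ and $z=\infty$; $X'$ is $X$ with these points removed. Harmonic surface, doubly periodic: given meromorphic one-forms $\omega_1,\omega_2,\omega_3$ on a compact Riemann surface $X$, holomorphic on $X'=X\setminus\{p_1,\dots,p_m\}$, the triple is the Weierstrass representation of a doubly periodic harmonic surface if the real periods $\operatorname{Re}\int_\gamma(\omega_1,\omega_2,\omega_3)$, over closed curves $\gamma$ in $X'$, lie in a rank-two lattice $L\subset\mathbb{R}^3$ of translations (generated by two linearly independent vectors), so that $f(z)=\operatorname{Re}\int^z(\omega_1,\omega_2,\omega_3)$ is a well-defined harmonic map $X'\to\mathbb{R}^3/L$; the doubly periodic surface is the preimage in $\mathbb{R}^3$ of the image. "Genus two" refers to the genus of $X$, i.e. of the quotient surface. Scherk ends: an end is a Scherk end if it is asymptotic to a vertical half-plane modulo a horizontal translation period (so $\omega_3$ has a simple pole with real residue and $\omega_1,\omega_2$ have at most simple poles, with a nonzero horizontal real period around the end, to which the half-plane is parallel). The bottom ends lie over $z=0$ (third coordinate tends to $-\infty$) and the top ends over $z=\infty$ (third coordinate tends to $+\infty$). Top and bottom ends are orthogonal if the asymptotic half-planes of the top ends are orthogonal to those of the bottom ends. Handles: one handle is between (the images of) $a_1$ and $a_2$, the other between $a_3$ and $a_4$. Integrals between consecutive $a_k$ are taken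 along the real axis using a branch of $w$ (and correspondingly of $g$) continued from the upper half-plane. The period problem, and the statement that the handles lie between every other pair of consecutive ends, is expressed by the equations $$\operatorname{Re}\int_{a_1}^{a_2}\omega_j=\operatorname{Re}\int_{a_2}^{a_3}\omega_j=\operatorname{Re}\int_{a_3}^{a_4}\omega_j=\operatorname{Re}\int_{a_4}^{a_5}\omega_j=0,\qquad j=1,2.$$ *)

theory Defs
  imports "HOL-Complex_Analysis.Complex_Analysis"
begin

section \<open>Riemann surfaces given by an atlas\<close>

text \<open>A chart is a domain together with a complex coordinate on it; the points of the surface are
  those covered by the atlas.\<close>

type_synonym 'a chart = "'a set \<times> ('a \<Rightarrow> complex)"

definition surface_topology :: "'a chart set \<Rightarrow> 'a topology" where
  "surface_topology A =
     topology_generated_by {U \<inter> \<phi> -` V | U \<phi> V. (U, \<phi>) \<in> A \<and> open V}"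

definition transition :: "'a chart \<Rightarrow> 'a chart \<Rightarrow> complex \<Rightarrow> complex" where
  "transition c d = snd d \<circ> inv_into (fst c) (snd c)"

definition riemann_surface :: "'a chart set \<Rightarrow> bool" where
  "riemann_surface A \<longleftrightarrow>
     (\<forall>(U, \<phi>) \<in> A. inj_on \<phi> U \<and> open (\<phi> ` U)) \<and>
     (\<forall>c \<in> A. \<forall>d \<in> A. open (snd c ` (fst c \<inter> fst d)) \<and>
        transition c d holomorphic_on snd c ` (fst c \<inter> fst d)) \<and>
     topspace (surface_topology A) \<noteq> {} \<and>
     Hausdorff_space (surface_topology A) \<and>
     connected_space (surface_topology A)"

definition compact_riemann_surface :: "'a chart set \<Rightarrow> bool" where
  "compact_riemann_surface A \<longleftrightarrow> riemann_surface A \<and> compact_space (surface_topology A)"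


section \<open>One-forms\<close>

text \<open>A one-form \<open>\<omega>\<close> is given by its coefficient functions: on the domain of a chart \<open>c = (U, \<phi>)\<close> it
  is \<open>\<omega> c (\<phi>) d\<phi>\<close>, so \<open>\<omega> c\<close> is a function of the coordinate \<open>t \<in> \<phi> ` U\<close>. The coefficients are
  normalised to be \<open>0\<close> at poles (nicely meromorphic), so that the transformation rule can be
  required at every point.\<close>

type_synonym 'a form = "'a chart \<Rightarrow> complex \<Rightarrow> complex"

definition compatible_form :: "'a chart set \<Rightarrow> 'a form \<Rightarrow> bool" where
  "compatible_form A \<omega> \<longleftrightarrow>
     (\<forall>c \<in> A. \<forall>d \<in> A. \<forall>t \<in> snd c ` (fst c \<inter> fst d).
        \<omega> c t = \<omega> d (transition c d t) * deriv (transition c d) t)"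

definition meromorphic_form :: "'a chart set \<Rightarrow> 'a form \<Rightarrow> bool" where
  "meromorphic_form A \<omega> \<longleftrightarrow>
     compatible_form A \<omega> \<and> (\<forall>(U, \<phi>) \<in> A. \<omega> (U, \<phi>) nicely_meromorphic_on \<phi> ` U)"

definition holomorphic_form_on :: "'a chart set \<Rightarrow> 'a form \<Rightarrow> 'a set \<Rightarrow> bool" where
  "holomorphic_form_on A \<omega> S \<longleftrightarrow> (\<forall>(U, \<phi>) \<in> A. \<omega> (U, \<phi>) holomorphic_on \<phi> ` (U \<inter> S))"

definition holomorphic_form :: "'a chart set \<Rightarrow> 'a form \<Rightarrow> bool" where
  "holomorphic_form A \<omega> \<longleftrightarrow>
     compatible_form A \<omega> \<and> holomorphic_form_on A \<omega> (topspace (surface_topology A))"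

text \<open>The one-form \<open>f dh\<close> for meromorphic functions \<open>f\<close>, \<open>h\<close> on the surface. The values of \<open>f\<close> and
  \<open>h\<close> at isolated points (in particular at their poles) are irrelevant: removable singularities of
  the coefficient are removed.\<close>

definition form_of :: "('a \<Rightarrow> complex) \<Rightarrow> ('a \<Rightarrow> complex) \<Rightarrow> 'a form" where
  "form_of f h c =
     remove_sings (\<lambda>t. f (inv_into (fst c) (snd c) t) * deriv (h \<circ> inv_into (fst c) (snd c)) t)"

text \<open>The genus of a compact Riemann surface is the dimension of its space of holomorphic one-forms.
  Two forms are identified if their coefficients agree on the images of the charts.\<close>

definition has_genus :: "'a chart set \<Rightarrow> nat \<Rightarrow> bool" where
  "has_genus A n \<longleftrightarrow>
     (\<exists>\<theta> :: nat \<Rightarrow> 'a form. (\<forall>i<n. holomorphic_form A (\<theta> i)) \<and>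
        (\<forall>\<eta>. holomorphic_form A \<eta> \<longrightarrow>
           (\<exists>!k :: nat \<Rightarrow> complex. k \<in> {..<n} \<rightarrow>\<^sub>E UNIV \<and>
              (\<forall>(U, \<phi>) \<in> A. \<forall>t \<in> \<phi> ` U. \<eta> (U, \<phi>) t = (\<Sum>i<n. k i * \<theta> i (U, \<phi>) t)))))"

text \<open>Integration along a piecewise continuously differentiable curve \<open>\<gamma>\<close>, parametrised by
  \<open>{0..1}\<close>: the curve is subdivided into pieces lying in single charts. The existence of such a
  subdivision also expresses that \<open>\<gamma>\<close> is piecewise continuously differentiable.\<close>

definition has_form_integral ::
    "'a chart set \<Rightarrow> 'a form \<Rightarrow> (real \<Rightarrow> 'a) \<Rightarrow> complex \<Rightarrow> bool" where
  "has_form_integral A \<omega> \<gamma> I \<longleftrightarrow>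
     (\<exists>(n :: nat) (s :: nat \<Rightarrow> real) (c :: nat \<Rightarrow> 'a chart) (J :: nat \<Rightarrow> complex).
        s 0 = 0 \<and> s n = 1 \<and>
        (\<forall>i<n. s i \<le> s (Suc i) \<and> c i \<in> A \<and> \<gamma> ` {s i..s (Suc i)} \<subseteq> fst (c i) \<and>
           valid_path (subpath (s i) (s (Suc i)) (snd (c i) \<circ> \<gamma>)) \<and>
           (\<omega> (c i) has_contour_integral J i) (subpath (s i) (s (Suc i)) (snd (c i) \<circ> \<gamma>))) \<and>
        I = (\<Sum>i<n. J i))"


section \<open>Weierstrass representation and Scherk ends\<close>

text \<open>Triples of one-forms are indexed by the type \<open>3\<close>, whose elements are \<open>1\<close>, \<open>2\<close> and \<open>3\<close>.\<close>

definition triple :: "'b \<Rightarrow> 'b \<Rightarrow> 'b \<Rightarrow> 3 \<Rightarrow> 'b" where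
  "triple x y z j = (if j = 1 then x else if j = 2 then y else z)"

definition has_real_integral ::
    "'a chart set \<Rightarrow> (3 \<Rightarrow> 'a form) \<Rightarrow> (real \<Rightarrow> 'a) \<Rightarrow> real^3 \<Rightarrow> bool" where
  "has_real_integral A \<omega> \<gamma> x \<longleftrightarrow>
     (\<exists>I. (\<forall>j. has_form_integral A (\<omega> j) \<gamma> (I j)) \<and> x = (\<chi> j. Re (I j)))"

definition rank_two_lattice :: "(real^3) set \<Rightarrow> bool" where
  "rank_two_lattice L \<longleftrightarrow>
     (\<exists>u v. u \<noteq> v \<and> independent {u, v} \<and>
        L = {of_int m *\<^sub>R u + of_int n *\<^sub>R v | m n :: int. True})"

definition weierstrass_doubly_periodic ::
    "'a chart set \<Rightarrow> 'a set \<Rightarrow> (3 \<Rightarrow> 'a form) \<Rightarrow> bool" where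
  "weierstrass_doubly_periodic A E \<omega> \<longleftrightarrow>
     compact_riemann_surface A \<and>
     finite E \<and> E \<subseteq> topspace (surface_topology A) \<and>
     (\<forall>j. meromorphic_form A (\<omega> j) \<and>
          holomorphic_form_on A (\<omega> j) (topspace (surface_topology A) - E)) \<and>
     (\<exists>L. rank_two_lattice L \<and>
        (\<forall>\<gamma> x. \<gamma> ` {0..1} \<subseteq> topspace (surface_topology A) - E \<longrightarrow> \<gamma> 0 = \<gamma> 1 \<longrightarrow>
           has_real_integral A \<omega> \<gamma> x \<longrightarrow> x \<in> L))"

text \<open>The vertical half-plane parallel to \<open>T\<close> (a nonzero horizontal vector), with a point \<open>q\<close> on its
  edge, unbounded upwards for \<open>\<sigma> = 1\<close> and downwards for \<open>\<sigma> = - 1\<close>.\<close>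

definition vertical_half_plane :: "real \<Rightarrow> real^3 \<Rightarrow> real^3 \<Rightarrow> (real^3) set" where
  "vertical_half_plane \<sigma> q T = {q + s *\<^sub>R T + (\<sigma> * t) *\<^sub>R axis 3 1 | s t :: real. 0 \<le> t}"

text \<open>Near the end \<open>p\<close> the surface is parametrised, up to a translation, by the integrals
  \<open>Re \<integral>\<omega>\<close> along curves from a fixed point \<open>p\<^sub>0\<close> that stay in a connected punctured neighbourhood
  \<open>N - {p}\<close>; its sheets differ by the period \<open>T\<close> around the end, under which the half-plane is
  invariant. As the point tends to \<open>p\<close>, the distance to the half-plane
  tends to \<open>0\<close> and the third coordinate tends to \<open>\<infinity>\<close> (for \<open>\<sigma> = 1\<close>) or \<open>- \<infinity>\<close> (for \<open>\<sigma> = - 1\<close>).\<close>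

definition asymptotic_to_half_plane ::
    "'a chart set \<Rightarrow> (3 \<Rightarrow> 'a form) \<Rightarrow> real \<Rightarrow> real^3 \<Rightarrow> 'a \<Rightarrow> bool" where
  "asymptotic_to_half_plane A \<omega> \<sigma> T p \<longleftrightarrow>
     (\<exists>q N p\<^sub>0. openin (surface_topology A) N \<and> p \<in> N \<and>
        connectedin (surface_topology A) (N - {p}) \<and> p\<^sub>0 \<in> N - {p} \<and>
        holomorphic_form_on A (\<omega> 1) (N - {p}) \<and>
        holomorphic_form_on A (\<omega> 2) (N - {p}) \<and>
        holomorphic_form_on A (\<omega> 3) (N - {p}) \<and>
        (\<forall>\<epsilon>>0. \<exists>M. openin (surface_topology A) M \<and> p \<in> M \<and> M \<subseteq> N \<and>
           (\<forall>\<gamma> x. \<gamma> ` {0..1} \<subseteq> N - {p} \<longrightarrow> \<gamma> 0 = p\<^sub>0 \<longrightarrow> \<gamma> 1 \<in> M - {p} \<longrightarrow>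
              has_real_integral A \<omega> \<gamma> x \<longrightarrow>
                infdist x (vertical_half_plane \<sigma> q T) < \<epsilon> \<and> \<sigma> * x $ 3 > 1 / \<epsilon>)))"

text \<open>A top (\<open>\<sigma> = 1\<close>) or bottom (\<open>\<sigma> = - 1\<close>) Scherk end \<open>p\<close> with real period \<open>T\<close> around it. Pole
  orders and residues do not depend on the chart used.\<close>

definition scherk_end ::
    "'a chart set \<Rightarrow> (3 \<Rightarrow> 'a form) \<Rightarrow> real \<Rightarrow> real^3 \<Rightarrow> 'a \<Rightarrow> bool" where
  "scherk_end A \<omega> \<sigma> T p \<longleftrightarrow>
     (\<exists>(U, \<phi>) \<in> A. p \<in> U \<and>
        (\<forall>j. is_pole (\<omega> j (U, \<phi>)) (\<phi> p) \<longrightarrow> zorder (\<omega> j (U, \<phi>)) (\<phi> p) = - 1) \<and>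
        is_pole (\<omega> 3 (U, \<phi>)) (\<phi> p) \<and> residue (\<omega> 3 (U, \<phi>)) (\<phi> p) \<in> \<real> \<and>
        T = (\<chi> j. Re (2 * of_real pi * \<i> * residue (\<omega> j (U, \<phi>)) (\<phi> p)))) \<and>
     T \<noteq> 0 \<and> T $ 3 = 0 \<and>
     asymptotic_to_half_plane A \<omega> \<sigma> T p"


section \<open>Hyperelliptic curves\<close>

text \<open>The compact curve \<open>w\<^sup>2 = P(z)\<close> for \<open>P\<close> of even degree \<open>2 d\<close>. Near \<open>z = \<infinity>\<close> one uses
  \<open>u = 1 / z\<close> and \<open>v = w / z ^ d\<close>, which satisfy \<open>v\<^sup>2 = u ^ (2 d) P(1 / u)\<close>; the points over
  \<open>z = \<infinity>\<close> are those with \<open>u = 0\<close>, where \<open>v\<^sup>2\<close> is the leading coefficient, and \<open>At_infinity v\<close> is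
  the one with the given \<open>v\<close>.\<close>

datatype hpoint = Affine complex complex | At_infinity complex

definition affine_points :: "complex poly \<Rightarrow> hpoint set" where
  "affine_points P = {Affine z w | z w. w\<^sup>2 = poly P z}"

definition points_over_zero :: "complex poly \<Rightarrow> hpoint set" where
  "points_over_zero P = {Affine 0 w | w. w\<^sup>2 = poly P 0}"

definition points_over_infinity :: "complex poly \<Rightarrow> hpoint set" where
  "points_over_infinity P = {At_infinity v | v. v\<^sup>2 = lead_coeff P}"

text \<open>The meromorphic functions \<open>z\<close> and \<open>w\<close> get the value \<open>0\<close> at their poles, the points at infinity;
  \<open>u\<close> and \<open>v\<close> are only used where \<open>z \<noteq> 0\<close>.\<close>

fun zc :: "hpoint \<Rightarrow> complex" where
  "zc (Affine z w) = z" | "zc (At_infinity v) = 0"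

fun wc :: "hpoint \<Rightarrow> complex" where
  "wc (Affine z w) = w" | "wc (At_infinity v) = 0"

fun uc :: "hpoint \<Rightarrow> complex" where
  "uc (Affine z w) = 1 / z" | "uc (At_infinity v) = 0"

fun vc :: "nat \<Rightarrow> hpoint \<Rightarrow> complex" where
  "vc d (Affine z w) = w / z ^ d" | "vc d (At_infinity v) = v"

definition affine_open :: "complex poly \<Rightarrow> hpoint set \<Rightarrow> bool" where
  "affine_open P U \<longleftrightarrow> (\<exists>G. open G \<and> U = {p \<in> affine_points P. (zc p, wc p) \<in> G})"

definition infinity_open :: "complex poly \<Rightarrow> hpoint set \<Rightarrow> bool" where
  "infinity_open P U \<longleftrightarrow>
     (\<exists>G. open G \<and> U = {p \<in> (affine_points P - points_over_zero P) \<union> points_over_infinity P.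
                          (uc p, vc (degree P div 2) p) \<in> G})"

text \<open>Local coordinates are \<open>z\<close> where \<open>w \<noteq> 0\<close>, \<open>w\<close> where \<open>P'(z) \<noteq> 0\<close>, and \<open>u\<close> where \<open>v \<noteq> 0\<close>.\<close>

definition hyperelliptic :: "complex poly \<Rightarrow> hpoint chart set" where
  "hyperelliptic P =
     {(U, zc) | U. affine_open P U \<and> inj_on zc U \<and> (\<forall>p \<in> U. wc p \<noteq> 0)} \<union>
     {(U, wc) | U. affine_open P U \<and> inj_on wc U \<and> (\<forall>p \<in> U. poly (pderiv P) (zc p) \<noteq> 0)} \<union>
     {(U, uc) | U. infinity_open P U \<and> inj_on uc U \<and> (\<forall>p \<in> U. vc (degree P div 2) p \<noteq> 0)}"


section \<open>The curve and the branches of \<open>w\<close> and \<open>g\<close>\<close>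

definition branch_poly :: "(nat \<Rightarrow> real) \<Rightarrow> real \<Rightarrow> complex poly" where
  "branch_poly a b = [:- of_real b, 1:] * (\<Prod>k = 1..5. [:- of_real (a k), 1:])"

definition g_on_curve :: "(nat \<Rightarrow> real) \<Rightarrow> hpoint \<Rightarrow> complex" where
  "g_on_curve a p =
     (zc p - of_real (a 1)) * (zc p - of_real (a 3)) * (zc p - of_real (a 5)) / wc p"

text \<open>\<open>csqrt\<close> maps negative reals to the positive imaginary axis, so on the real line the following
  are the boundary values of the branches in the upper half-plane.\<close>

definition w_branch :: "(nat \<Rightarrow> real) \<Rightarrow> real \<Rightarrow> complex \<Rightarrow> complex" where
  "w_branch a b z =
     csqrt (z - of_real (a 1)) * csqrt (z - of_real (a 2)) * csqrt (z - of_real (a 3)) *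
     csqrt (z - of_real (a 4)) * csqrt (z - of_real (a 5)) * csqrt (z - of_real b)"

definition g_branch :: "(nat \<Rightarrow> real) \<Rightarrow> real \<Rightarrow> complex \<Rightarrow> complex" where
  "g_branch a b z =
     (csqrt (z - of_real (a 1)) * csqrt (z - of_real (a 3)) * csqrt (z - of_real (a 5))) /
     (csqrt (z - of_real (a 2)) * csqrt (z - of_real (a 4)) * csqrt (z - of_real b))"

lemma poly_branch_poly:
  "poly (branch_poly a b) z = (z - of_real b) * (\<Prod>k = 1..5. (z - of_real (a k)))"
  unfolding branch_poly_def poly_mult poly_prod by simp

lemma w_branch_on_curve: "Affine z (w_branch a b z) \<in> affine_points (branch_poly a b)"
proof -
  have "{1..5::nat} = {1, 2, 3, 4, 5}" by auto
  then have "(w_branch a b z)\<^sup>2 = poly (branch_poly a b) z"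
    unfolding poly_branch_poly w_branch_def power_mult_distrib power2_csqrt
    by (simp add: mult_ac)
  then show ?thesis
    by (simp add: affine_points_def)
qed

lemma g_branch_eq: "g_branch a b z = g_on_curve a (Affine z (w_branch a b z))"
proof -
  define s where "s t = csqrt (z - of_real t)" for t
  have sq: "z - of_real t = s t * s t" for t
    by (metis s_def power2_csqrt power2_eq_square)
  have cancel: "x * y * u / (p * q * r) = (x * x) * (y * y) * (u * u) / (x * p * y * q * u * r)"
    for x y u p q r :: complex
    by (cases "x = 0 \<or> y = 0 \<or> u = 0") (auto simp: divide_simps)
  show ?thesis
    unfolding g_branch_def g_on_curve_def w_branch_def zc.simps wc.simps s_def [symmetric]
    unfolding sq by (rule cancel)
qed

end

theory Submission
  imports Defs
begin

text \<open>
  Write \<open>1 / g = B / w\<close> and \<open>g = A / w\<close> with \<open>A = (z - a\<^sub>1) (z - a\<^sub>3) (z - a\<^sub>5)\<close> and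
  \<open>B = (z - a\<^sub>2) (z - a\<^sub>4) (z - b\<^sub>1)\<close>. Both forms are \<open>Q(z) dz / (z w)\<close> for a cubic \<open>Q\<close>, which is real
  for \<open>\<omega>\<^sub>1\<close> and imaginary for \<open>\<omega>\<^sub>2\<close> if the parameters are chosen accordingly. The choice of \<open>b\<^sub>1\<close> makes
  \<open>A + B\<close> vanish at \<open>0\<close>, so that \<open>\<omega>\<^sub>1\<close> has its poles (with residues \<open>\<plusminus>i\<close>) over \<open>0\<close> and \<open>\<omega>\<^sub>2\<close> over
  \<open>\<infinity>\<close>, which gives orthogonal Scherk ends with periods \<open>\<plusminus>2\<pi>\<close>. On every other interval between the \<open>a\<^sub>k\<close>
  the integrand is imaginary; the remaining two period equations are linear in two real parameters, and
  solvable because a nonzero linear function cannot have vanishing weighted mean over each of two disjoint intervals.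

  No homology is needed for the lattice of periods: \<open>exp (i Re \<integral>\<omega>)\<close> extends from the upper half plane to
  a single-valued function on the punctured surface. The four half planes that make up the surface are glued
  along the real axis, and the values match because \<open>Re \<integral>\<omega>\<close> is a multiple of \<open>\<pi>\<close> on those intervals where
  the gluing changes its sign: it is \<open>0\<close> at all \<open>a\<^sub>k\<close> by the period equations, constant in between, and it
  jumps by half a residue period, that is by \<open>\<plusminus>\<pi>\<close>, across the pole at \<open>0\<close> or at \<open>\<infinity>\<close>.
\<close>

section \<open>Curves and local primitives on a Riemann surface\<close>

text \<open>Closed curves are arbitrary and may pass through branch points in any chart of a large
  atlas, so no path is ever deformed. A period is read off from a single-valued function that is
  locally a constant times \<open>exp (\<alpha> * Re h)\<close>, with \<open>h\<close> a primitive.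
  Here \<open>\<alpha> = \<i>\<close> forgets multiples of 2 pi and serves the first two
  coordinates; real \<open>\<alpha>\<close> loses nothing and serves dz/z, by means of |z|, and the
  coordinates near an end. One format for densities, \<open>has_density\<close>, covers the three
  forms as well as dz/w and z dz/w, so that poles, regularity and changes of chart are computed
  once. The branch points on the real axis are the obstacle for boundary values of primitives, since
  the integrand in z is unbounded there; the chart with coordinate w removes it. The genus is
  obtained from function theory in the plane: a holomorphic form is a function m times dz/w, the
  sums of m and of w m over the two sheets are entire of polynomial growth, and Liouville's theorem
  leaves m = c + d z.\<close>

lemma exp_primitive_along_path:
  fixes \<Psi> :: "real \<Rightarrow> complex" and \<alpha> :: complex
  assumes g: "valid_path g" and J: "(k has_contour_integral J) g"
    and loc: "\<And>t. t \<in> {0..1} \<Longrightarrow> \<exists>V h K. open V \<and> g t \<in> V \<and>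
        (\<forall>s\<in>V. (h has_field_derivative k s) (at s)) \<and>
        (\<forall>s\<in>{0..1}. g s \<in> V \<longrightarrow> \<Psi> s = K * exp (\<alpha> * of_real (Re (h (g s)))))"
  shows "\<Psi> 1 = \<Psi> 0 * exp (\<alpha> * of_real (Re J))"
proof -
  define I where "I t = contour_integral (subpath 0 t g) k" for t
  \<comment> \<open>\<open>\<Psi>\<close> divided by the exponential of the running integral. On a
    short piece both vary by the same factor, because the integral is an increment of the local
    primitive; so \<open>\<Theta>\<close> is locally constant, and the unit interval is
    connected.\<close>
  define \<Theta> where "\<Theta> t = \<Psi> t * exp (- (\<alpha> * of_real (Re (I t))))" for t
  have ki: "k contour_integrable_on g"
    using J by (auto simp: contour_integrable_on_def)
  have "\<Theta> 0 = \<Theta> 1"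
  proof (rule connected_local_const[of "{0..1::real}"])
    show "\<forall>t\<in>{0..1}. eventually (\<lambda>s. \<Theta> t = \<Theta> s) (at t within {0..1})"
    proof
      fix t :: real assume t: "t \<in> {0..1}"
      obtain V h K where V: "open V" "g t \<in> V" "\<forall>s\<in>V. (h has_field_derivative k s) (at s)"
        and K: "\<forall>s\<in>{0..1}. g s \<in> V \<longrightarrow> \<Psi> s = K * exp (\<alpha> * of_real (Re (h (g s))))"
        using loc[OF t] by blast
      have "continuous_on {0..1} g"
        using g valid_path_imp_path path_def by blast
      then obtain T where T: "open T" "t \<in> T" "\<And>s. s \<in> {0..1} \<Longrightarrow> s \<in> T \<Longrightarrow> g s \<in> V"
        using V(1,2) t unfolding continuous_on_topological by meson
      obtain e where e: "e > 0" "ball t e \<subseteq> T"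
        using T(1,2) openE by blast
      have "\<Theta> t = \<Theta> s" if s: "s \<in> {0..1}" "dist s t < e" for s
      proof -
        have sub: "closed_segment t s \<subseteq> ball t e \<inter> {0..1}"
          using t s e(1) by (intro closed_segment_subset) (auto simp: dist_commute intro: convex_Int)
        have im: "path_image (subpath t s g) \<subseteq> V"
          unfolding path_image_subpath_gen using sub T(3) e(2) by blast
        have "(k has_contour_integral (h (pathfinish (subpath t s g)) - h (pathstart (subpath t s g))))
                (subpath t s g)"
          by (rule contour_integral_primitive[of V])
            (use V(3) im g t s in \<open>auto simp: has_field_derivative_at_within intro: valid_path_subpath\<close>)
        then have "contour_integral (subpath t s g) k = h (g s) - h (g t)"
          by (simp add: contour_integral_unique)
        moreover have "I t + contour_integral (subpath t s g) k = I s"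
          unfolding I_def by (rule contour_integral_subpath_combine[OF ki g]) (use t s in auto)
        ultimately have Is: "I s = I t + (h (g s) - h (g t))" by simp
        have "s \<in> ball t e" using s(2) by (simp add: dist_commute)
        then have "g s \<in> V" using T(3) s(1) e(2) by blast
        then have "\<Psi> s = K * exp (\<alpha> * of_real (Re (h (g s))))" "\<Psi> t = K * exp (\<alpha> * of_real (Re (h (g t))))"
          using K s t V(2) by blast+
        then show ?thesis
          unfolding \<Theta>_def Is by (simp add: ring_distribs exp_add exp_diff exp_minus divide_inverse)
      qed
      then show "eventually (\<lambda>s. \<Theta> t = \<Theta> s) (at t within {0..1})"
        unfolding eventually_at using e(1) by (intro exI[of _ e]) auto
    qed
  qed auto
  then have "\<Psi> 0 * exp (- (\<alpha> * of_real (Re (I 0)))) = \<Psi> 1 * exp (- (\<alpha> * of_real (Re (I 1))))"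
    by (simp add: \<Theta>_def)
  moreover have "I 0 = 0" "I 1 = J"
    using J by (simp_all add: I_def contour_integral_unique)
  ultimately show ?thesis
    by (simp add: exp_minus field_simps)
qed

text \<open>A substitute for the multivalued real part of an integral: \<open>h\<close> is
  determined only up to a constant, which the factor \<open>K\<close> absorbs. Continuity of
  \<open>\<Phi>\<close> is built into the local formula and never has to be shown
  separately.\<close>

definition exp_primitive_at ::
    "'a form \<Rightarrow> complex \<Rightarrow> ('a \<Rightarrow> complex) \<Rightarrow> 'a chart \<Rightarrow> 'a \<Rightarrow> bool" where
  "exp_primitive_at \<omega> \<alpha> \<Phi> c p \<longleftrightarrow>
     (\<exists>V h K. open V \<and> snd c p \<in> V \<and> V \<subseteq> snd c ` fst c \<and>
        (\<forall>t\<in>V. (h has_field_derivative \<omega> c t) (at t)) \<and>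
        (\<forall>q\<in>fst c. snd c q \<in> V \<longrightarrow> \<Phi> q = K * exp (\<alpha> * of_real (Re (h (snd c q))))))"

lemma openin_chart:
  "(U, \<phi>) \<in> A \<Longrightarrow> open V \<Longrightarrow> openin (surface_topology A) (U \<inter> \<phi> -` V)"
  unfolding surface_topology_def by (rule topology_generated_by_Basis) blast

lemma topspace_surface: "topspace (surface_topology A) = (\<Union>c\<in>A. fst c)"
proof (intro equalityI subsetI)
  fix x assume "x \<in> (\<Union>c\<in>A. fst c)"
  then obtain U \<phi> where "(U, \<phi>) \<in> A" "x \<in> U" by auto
  then show "x \<in> topspace (surface_topology A)"
    using openin_subset[OF openin_chart[of U \<phi> A UNIV]] by auto
qed (force simp: surface_topology_def topology_generated_by_topspace)

locale riemann =
  fixes A :: "'a chart set"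
  assumes surface: "riemann_surface A"
begin

lemma chart_inj: "c \<in> A \<Longrightarrow> inj_on (snd c) (fst c)"
  and chart_open: "c \<in> A \<Longrightarrow> open (snd c ` fst c)"
  and overlap_open: "c \<in> A \<Longrightarrow> d \<in> A \<Longrightarrow> open (snd c ` (fst c \<inter> fst d))"
  and transition_holomorphic:
    "c \<in> A \<Longrightarrow> d \<in> A \<Longrightarrow> transition c d holomorphic_on snd c ` (fst c \<inter> fst d)"
  using surface unfolding riemann_surface_def by fastforce+

lemma transition_eq: "c \<in> A \<Longrightarrow> p \<in> fst c \<Longrightarrow> transition c d (snd c p) = snd d p"
  by (simp add: transition_def chart_inj)

lemma transition_has_derivative:
  assumes "c \<in> A" "d \<in> A" "t \<in> snd c ` (fst c \<inter> fst d)"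
  shows "(transition c d has_field_derivative deriv (transition c d) t) (at t)"
  using assms holomorphic_derivI overlap_open transition_holomorphic by blast

lemma deriv_transition_nonzero:
  assumes cd: "c \<in> A" "d \<in> A" and t: "t \<in> snd c ` (fst c \<inter> fst d)"
  shows "deriv (transition c d) t \<noteq> 0"
proof -
  obtain p where p: "p \<in> fst c \<inter> fst d" "t = snd c p" using t by blast
  have e: "transition c d t = snd d p" using p cd by (simp add: transition_eq)
  have D: "(transition d c has_field_derivative deriv (transition d c) (transition c d t)) (at (transition c d t))"
    by (rule transition_has_derivative) (use cd p e in auto)
  have "((transition d c \<circ> transition c d) has_field_derivative
      deriv (transition d c) (transition c d t) * deriv (transition c d) t) (at t)"
    by (rule DERIV_chain[OF D transition_has_derivative[OF cd t]])
  then have "((\<lambda>s. s) has_field_derivative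
      deriv (transition d c) (transition c d t) * deriv (transition c d) t) (at t)"
    by (rule has_field_derivative_transform_within_open[OF _ overlap_open[OF cd] t])
      (use cd in \<open>auto simp: transition_eq\<close>)
  then show ?thesis
    using DERIV_unique[OF _ DERIV_ident] by fastforce
qed

text \<open>The transformation rule of a form is the chain rule, so \<open>h\<close> composed with
  the transition map is a primitive in the new chart. This frees the choice of chart:
  \<open>\<Phi>\<close> is examined in one convenient chart, whereas a curve may run through any
  other.\<close>

lemma exp_primitive_change_chart:
  assumes cd: "c \<in> A" "d \<in> A" and p: "p \<in> fst c \<inter> fst d"
    and \<omega>: "compatible_form A \<omega>" and prim: "exp_primitive_at \<omega> \<alpha> \<Phi> c p"
  shows "exp_primitive_at \<omega> \<alpha> \<Phi> d p"
proof -
  obtain V h K where V: "open V" "snd c p \<in> V" "V \<subseteq> snd c ` fst c"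
      "\<And>t. t\<in>V \<Longrightarrow> (h has_field_derivative \<omega> c t) (at t)"
      and K: "\<And>q. q\<in>fst c \<Longrightarrow> snd c q \<in> V \<Longrightarrow> \<Phi> q = K * exp (\<alpha> * of_real (Re (h (snd c q))))"
    using prim unfolding exp_primitive_at_def by blast
  let ?O = "snd d ` (fst d \<inter> fst c)" and ?\<tau> = "transition d c"
  have oV: "open (?O \<inter> ?\<tau> -` V)"
    by (rule continuous_open_preimage[OF _ overlap_open[OF cd(2,1)] V(1)])
      (rule holomorphic_on_imp_continuous_on[OF transition_holomorphic[OF cd(2,1)]])
  show ?thesis
    unfolding exp_primitive_at_def
  proof (intro exI conjI ballI impI)
    show "open (?O \<inter> ?\<tau> -` V)" by (rule oV)
    show "snd d p \<in> ?O \<inter> ?\<tau> -` V" using p V cd by (auto simp: transition_eq)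
    show "?O \<inter> ?\<tau> -` V \<subseteq> snd d ` fst d" by blast
    show "(h \<circ> ?\<tau> has_field_derivative \<omega> d t) (at t)" if t: "t \<in> ?O \<inter> ?\<tau> -` V" for t
    proof -
      have "(h \<circ> ?\<tau> has_field_derivative \<omega> c (?\<tau> t) * deriv ?\<tau> t) (at t)"
        by (rule DERIV_chain) (use t V transition_has_derivative cd in auto)
      also have "\<omega> c (?\<tau> t) * deriv ?\<tau> t = \<omega> d t"
        using \<omega> cd t unfolding compatible_form_def by auto
      finally show ?thesis .
    qed
    show "\<Phi> q = K * exp (\<alpha> * of_real (Re ((h \<circ> ?\<tau>) (snd d q))))"
      if q: "q \<in> fst d" "snd d q \<in> ?O \<inter> ?\<tau> -` V" for q
    proof -
      have "q \<in> fst c" using q chart_inj[OF cd(2)] by (auto simp: inj_on_def)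
      then show ?thesis using K[of q] q cd by (auto simp: transition_eq)
    qed
  qed
qed

text \<open>Induction over the subdivision multiplies the factors given by
  \<open>exp_primitive_along_path\<close>. For a closed curve and nonvanishing \<open>\<Phi>\<close>
  the conclusion forces \<open>exp (\<alpha> * Re I)\<close> to be 1; all statements on periods come
  from here.\<close>

lemma exp_primitive_along_curve:
  assumes \<omega>: "compatible_form A \<omega>"
    and loc: "\<And>p. p \<in> S \<Longrightarrow> \<exists>c\<in>A. p \<in> fst c \<and> exp_primitive_at \<omega> \<alpha> \<Phi> c p"
    and \<gamma>: "\<gamma> ` {0..1} \<subseteq> S" and I: "has_form_integral A \<omega> \<gamma> I"
  shows "\<Phi> (\<gamma> 1) = \<Phi> (\<gamma> 0) * exp (\<alpha> * of_real (Re I))"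
proof -
  obtain n s c J where s: "s 0 = 0" "s n = (1::real)"
    and step: "\<And>i. i < n \<Longrightarrow> s i \<le> s (Suc i) \<and> c i \<in> A \<and> \<gamma> ` {s i..s (Suc i)} \<subseteq> fst (c i) \<and>
           valid_path (subpath (s i) (s (Suc i)) (snd (c i) \<circ> \<gamma>)) \<and>
           (\<omega> (c i) has_contour_integral J i) (subpath (s i) (s (Suc i)) (snd (c i) \<circ> \<gamma>))"
    and I: "I = (\<Sum>i<n. J i)"
    using I unfolding has_form_integral_def by auto
  \<comment> \<open>\<open>has_form_integral\<close> does not say that the subdivision points lie in
    [0,1]; monotonicity gives it, and only there is \<open>\<gamma>\<close> known to stay in
    \<open>S\<close>.\<close>
  have up: "s 0 \<le> s i" if "i \<le> n" for i
    using that by (induction i) (use step in \<open>auto intro: order_trans\<close>)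
  have down: "s i \<le> s n" if "i \<le> n" for i
    using that by (induction rule: inc_induct) (use step in \<open>auto intro: order_trans\<close>)
  have "\<Phi> (\<gamma> (s m)) = \<Phi> (\<gamma> 0) * exp (\<alpha> * of_real (Re (\<Sum>i<m. J i)))" if "m \<le> n" for m
    using that
  proof (induction m)
    case 0 then show ?case using s by simp
  next
    case (Suc m)
    then have m: "m < n" by simp
    note st = step[OF m]
    define G where "G = subpath (s m) (s (Suc m)) (snd (c m) \<circ> \<gamma>)"
    define \<Psi> where "\<Psi> t = \<Phi> (\<gamma> ((s (Suc m) - s m) * t + s m))" for t
    have Gt: "G t = snd (c m) (\<gamma> ((s (Suc m) - s m) * t + s m))" for t
      by (simp add: G_def subpath_def)
    have "\<Psi> 1 = \<Psi> 0 * exp (\<alpha> * of_real (Re (J m)))"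
    proof (rule exp_primitive_along_path[of G "\<omega> (c m)"])
      fix t :: real assume t: "t \<in> {0..1}"
      have in_seg: "(s (Suc m) - s m) * r + s m \<in> {s m..s (Suc m)}" if "r \<in> {0..1}" for r
        using st that mult_left_le[of r "s (Suc m) - s m"] by auto
      let ?p = "\<gamma> ((s (Suc m) - s m) * t + s m)"
      have inU: "\<gamma> ((s (Suc m) - s m) * r + s m) \<in> fst (c m)" if "r \<in> {0..1}" for r
        using in_seg[OF that] st by blast
      have "{s m..s (Suc m)} \<subseteq> {0..1}"
        using up[of m] down[of "Suc m"] m s by auto
      then have "?p \<in> S" using in_seg[OF t] \<gamma> by blast
      then have "exp_primitive_at \<omega> \<alpha> \<Phi> (c m) ?p"
        using loc[of ?p] exp_primitive_change_chart[OF _ _ _ \<omega>, of _ "c m" ?p \<alpha> \<Phi>] st inU[OF t] by auto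
      then obtain V h K where "open V" "G t \<in> V" "\<forall>s\<in>V. (h has_field_derivative \<omega> (c m) s) (at s)"
        "\<forall>q\<in>fst (c m). snd (c m) q \<in> V \<longrightarrow> \<Phi> q = K * exp (\<alpha> * of_real (Re (h (snd (c m) q))))"
        unfolding exp_primitive_at_def Gt by blast
      then show "\<exists>V h K. open V \<and> G t \<in> V \<and> (\<forall>s\<in>V. (h has_field_derivative \<omega> (c m) s) (at s)) \<and>
        (\<forall>s\<in>{0..1}. G s \<in> V \<longrightarrow> \<Psi> s = K * exp (\<alpha> * of_real (Re (h (G s)))))"
        using inU by (intro exI[of _ V] exI[of _ h] exI[of _ K]) (auto simp: Gt \<Psi>_def)
    qed (use st in \<open>auto simp: G_def\<close>)
    then have "\<Phi> (\<gamma> (s (Suc m))) = \<Phi> (\<gamma> (s m)) * exp (\<alpha> * of_real (Re (J m)))"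
      by (simp add: \<Psi>_def)
    with Suc show ?case by (simp add: exp_add algebra_simps)
  qed
  from this[of n] show ?thesis using s I by simp
qed

text \<open>Preimages of the generating sets of the topology suffice, and these are preimages under
  holomorphic transition maps. The purpose is to see that punctured coordinate discs are
  connected.\<close>

lemma continuous_map_inverse_chart:
  assumes c: "c \<in> A"
  shows "continuous_map (top_of_set (snd c ` fst c)) (surface_topology A) (inv_into (fst c) (snd c))"
    (is "continuous_map ?T _ ?\<psi>")
  unfolding surface_topology_def
proof (rule continuous_on_generated_topo)
  fix W assume "W \<in> {U \<inter> \<phi> -` V |U \<phi> V. (U, \<phi>) \<in> A \<and> open V}"
  then obtain U \<phi> V where W: "W = U \<inter> \<phi> -` V" "(U, \<phi>) \<in> A" "open V" by blast
  let ?d = "(U, \<phi>)" and ?O = "snd c ` (fst c \<inter> U)"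
  have "open (?O \<inter> transition c ?d -` V)"
    by (rule continuous_open_preimage[OF _ _ W(3)])
      (use overlap_open[OF c W(2)] transition_holomorphic[OF c W(2)] in
        \<open>auto intro: holomorphic_on_imp_continuous_on\<close>)
  moreover have "?O \<inter> transition c ?d -` V = ?\<psi> -` W \<inter> topspace ?T"
    using chart_inj[OF c] by (auto simp: W transition_eq[OF c])
  ultimately show "openin ?T (?\<psi> -` W \<inter> topspace ?T)"
    by (metis inf_le2 open_subset topspace_euclidean_subtopology)
next
  show "?\<psi> ` topspace ?T \<subseteq> \<Union> {U \<inter> \<phi> -` V |U \<phi> V. (U, \<phi>) \<in> A \<and> open V}"
  proof
    fix x assume "x \<in> ?\<psi> ` topspace ?T"
    then have "x \<in> fst c" by (auto intro: inv_into_into)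
    then have "x \<in> fst c \<inter> snd c -` UNIV" by simp
    then show "x \<in> \<Union> {U \<inter> \<phi> -` V |U \<phi> V. (U, \<phi>) \<in> A \<and> open V}"
      using c open_UNIV by (metis (mono_tags, lifting) UnionI mem_Collect_eq prod.collapse)
  qed
qed

end

section \<open>The charts of a sextic hyperelliptic curve\<close>

text \<open>Once \<open>f z / f z0\<close> has distance less than 1 from 1, it lies in the right
  half plane, where \<open>csqrt\<close> is holomorphic with positive real part. The last clause
  identifies the branch: divided by \<open>w0\<close>, the other root has negative real part, but
  every point of the ball about \<open>w0\<close> has positive real part.\<close>

lemma local_sqrt:
  fixes f :: "complex \<Rightarrow> complex"
  assumes f: "f holomorphic_on S" "open S" "z0 \<in> S" and w0: "w0\<^sup>2 = f z0" "w0 \<noteq> 0"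
  obtains \<delta> s where "\<delta> > 0" "ball z0 \<delta> \<subseteq> S" "s holomorphic_on ball z0 \<delta>" "s z0 = w0"
    "\<And>z. z \<in> ball z0 \<delta> \<Longrightarrow> (s z)\<^sup>2 = f z \<and> s z \<noteq> 0"
    "\<And>z w. z \<in> ball z0 \<delta> \<Longrightarrow> w\<^sup>2 = f z \<Longrightarrow> w \<in> ball w0 (norm w0) \<Longrightarrow> w = s z"
proof -
  have f0: "f z0 \<noteq> 0" using w0 by auto
  have "continuous (at z0) (\<lambda>z. f z / f z0)"
    using f f0 by (intro continuous_intros) (meson continuous_on_eq_continuous_at holomorphic_on_imp_continuous_on)
  then have "(\<lambda>z. f z / f z0) \<midarrow>z0\<rightarrow> 1"
    using f0 by (simp add: continuous_at)
  then have "eventually (\<lambda>z. dist (f z / f z0) 1 < 1) (at z0)"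
    by (rule tendstoD) simp
  then have "eventually (\<lambda>z. dist (f z / f z0) 1 < 1) (nhds z0)"
    using f0 by (simp add: eventually_nhds_conv_at)
  moreover have "eventually (\<lambda>z. z \<in> S) (nhds z0)"
    using f by (rule_tac eventually_nhds_in_open)
  ultimately have "eventually (\<lambda>z. dist (f z / f z0) 1 < 1 \<and> z \<in> S) (nhds z0)"
    by (rule eventually_conj)
  then obtain \<delta> where \<delta>: "\<delta> > 0" "\<And>z. dist z z0 < \<delta> \<Longrightarrow> dist (f z / f z0) 1 < 1 \<and> z \<in> S"
    unfolding eventually_nhds_metric by blast
  have re: "Re u > 0" if "dist u 1 < 1" for u
    using that abs_Re_le_cmod[of "1 - u"] by (simp add: dist_norm norm_minus_commute)
  define s where "s z = w0 * csqrt (f z / f z0)" for z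
  have B: "z \<in> S" "Re (f z / f z0) > 0" if "z \<in> ball z0 \<delta>" for z
    using \<delta>(2)[of z] re that by (auto simp: dist_commute)
  have Rs: "Re (csqrt (f z / f z0)) > 0" if "z \<in> ball z0 \<delta>" for z
  proof -
    have "Re (f z / f z0) = (Re (csqrt (f z / f z0)))\<^sup>2 - (Im (csqrt (f z / f z0)))\<^sup>2"
      by (metis Re_power2 power2_csqrt)
    moreover have "0 < Re (csqrt u) \<or> Re u \<le> 0" if "Re u = (Re (csqrt u))\<^sup>2 - (Im (csqrt u))\<^sup>2" for u
      using csqrt_principal[of u] that by (metis diff_0 neg_le_0_iff_le zero_le_power2 zero_power2)
    ultimately show ?thesis using B(2)[OF that] by force
  qed
  show thesis
  proof
    show "\<delta> > 0" by fact
    show "ball z0 \<delta> \<subseteq> S" using B by blast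
    then show "s holomorphic_on ball z0 \<delta>"
      unfolding s_def using f f0
      by (intro holomorphic_intros) (use B(2) in \<open>auto simp: complex_nonpos_Reals_iff not_le intro: holomorphic_on_subset\<close>)
    show "s z0 = w0" using f0 by (simp add: s_def)
    show sq: "(s z)\<^sup>2 = f z \<and> s z \<noteq> 0" if "z \<in> ball z0 \<delta>" for z
      using B[OF that] f0 w0 by (auto simp: s_def power_mult_distrib)
    show "w = s z" if z: "z \<in> ball z0 \<delta>" and w: "w\<^sup>2 = f z" "w \<in> ball w0 (norm w0)" for z w
    proof (rule ccontr)
      assume "w \<noteq> s z"
      then have "w = - s z" using w(1) sq[OF z] by (metis power2_eq_iff)
      then have e: "w / w0 = - csqrt (f z / f z0)" using w0 by (simp add: s_def)
      have "dist (w / w0) 1 = norm (w0 - w) / norm w0"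
        using w0 by (simp add: dist_norm norm_minus_commute diff_divide_distrib flip: norm_divide)
      also have "\<dots> < 1" using w(2) w0 by (simp add: dist_norm)
      finally have "Re (w / w0) > 0" by (rule re)
      with e Rs[OF z] show False by simp
    qed
  qed
qed

lemma holomorphic_injective_near:
  assumes f: "f holomorphic_on S" "open S" "z0 \<in> S" "deriv f z0 \<noteq> 0"
  obtains r g where "r > 0" "ball z0 r \<subseteq> S" "inj_on f (ball z0 r)" "open (f ` ball z0 r)"
    "g holomorphic_on f ` ball z0 r" "\<And>z. z \<in> ball z0 r \<Longrightarrow> g (f z) = z"
proof -
  obtain r where r: "r > 0" "ball z0 r \<subseteq> S" "inj_on f (ball z0 r)"
    using has_complex_derivative_locally_injective[OF f(1,3,2,4)] by blast
  have h: "f holomorphic_on ball z0 r" using f(1) r(2) by (rule holomorphic_on_subset)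
  obtain g where "g holomorphic_on f ` ball z0 r" "\<And>z. z \<in> ball z0 r \<Longrightarrow> deriv f z * deriv g (f z) = 1 \<and> g (f z) = z"
    using holomorphic_has_inverse[OF h open_ball r(3)] by metis
  moreover have "open (f ` ball z0 r)"
    by (rule open_mapping_thm3[OF h open_ball r(3)])
  ultimately show thesis using r that by blast
qed

text \<open>The inverse of the coordinates u = 1/z, v = w/z^3; the exponent is half the degree 6. At
  u = 0 the point is named by v alone.\<close>

definition upoint :: "complex \<Rightarrow> complex \<Rightarrow> hpoint" where
  "upoint u v = (if u = 0 then At_infinity v else Affine (1 / u) (v / u ^ 3))"

lemma uc_upoint [simp]: "uc (upoint u v) = u" and vc_upoint [simp]: "vc 3 (upoint u v) = v"
  by (auto simp: upoint_def field_simps)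

text \<open>Both coordinate pairs \<open>(z, w)\<close> and \<open>(u, v)\<close> describe the curve as \<open>y\<^sup>2 = f(x)\<close>; \<open>mk\<close> is
  the point with the given coordinates.\<close>

locale square_curve =
  fixes mk :: "complex \<Rightarrow> complex \<Rightarrow> hpoint" and x y :: "hpoint \<Rightarrow> complex"
    and S :: "hpoint set" and f :: "complex poly"
  assumes x_mk: "\<And>a b. x (mk a b) = a" and y_mk: "\<And>a b. y (mk a b) = b"
    and mk_in: "\<And>a b. mk a b \<in> S \<longleftrightarrow> b\<^sup>2 = poly f a"
    and mk_xy: "\<And>p. p \<in> S \<Longrightarrow> mk (x p) (y p) = p"
begin

text \<open>\<open>affine_open\<close> and \<open>infinity_open\<close> both describe sets of this
  form, so that relatively open sets are handled through open sets of coordinate pairs.\<close>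

definition cut :: "(complex \<times> complex) set \<Rightarrow> hpoint set" where
  "cut G = {p \<in> S. (x p, y p) \<in> G}"

lemma mk_in_cut: "mk a b \<in> cut G \<longleftrightarrow> b\<^sup>2 = poly f a \<and> (a, b) \<in> G"
  by (simp add: cut_def mk_in x_mk y_mk)

lemma y_square: "p \<in> S \<Longrightarrow> (y p)\<^sup>2 = poly f (x p)"
  using mk_in mk_xy by metis

text \<open>The radius from \<open>local_sqrt\<close> is shrunk once more, so that the graph of the
  branch stays in the open set \<open>G\<close>. All nearby points on the same sheet lie on that
  graph, which is what makes \<open>x\<close> a coordinate.\<close>

lemma section_in_cut:
  assumes G: "open G" and p: "p \<in> cut G" and y0: "y p \<noteq> 0"
  obtains \<delta> s where "\<delta> > 0" "s holomorphic_on ball (x p) \<delta>" "s (x p) = y p"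
    "\<And>a. a \<in> ball (x p) \<delta> \<Longrightarrow> mk a (s a) \<in> cut G \<and> s a \<noteq> 0"
    "\<And>q. q \<in> S \<Longrightarrow> x q \<in> ball (x p) \<delta> \<Longrightarrow> y q \<in> ball (y p) (norm (y p)) \<Longrightarrow> y q = s (x q)"
proof -
  have pS: "p \<in> S" using p by (simp add: cut_def)
  obtain \<delta> s where s: "\<delta> > 0" "s holomorphic_on ball (x p) \<delta>" "s (x p) = y p"
    "\<And>z. z \<in> ball (x p) \<delta> \<Longrightarrow> (s z)\<^sup>2 = poly f z \<and> s z \<noteq> 0"
    "\<And>z w. z \<in> ball (x p) \<delta> \<Longrightarrow> w\<^sup>2 = poly f z \<Longrightarrow> w \<in> ball (y p) (norm (y p)) \<Longrightarrow> w = s z"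
    by (rule local_sqrt[of "poly f" UNIV "x p" "y p"])
      (use y_square[OF pS] y0 in \<open>auto intro!: holomorphic_intros\<close>)
  have "open (ball (x p) \<delta> \<inter> (\<lambda>a. (a, s a)) -` G)"
    by (rule continuous_open_preimage[OF _ open_ball G])
      (intro continuous_intros holomorphic_on_imp_continuous_on s)
  moreover have "x p \<in> ball (x p) \<delta> \<inter> (\<lambda>a. (a, s a)) -` G"
    using s(1,3) p by (simp add: cut_def)
  ultimately obtain e where e: "e > 0" "ball (x p) e \<subseteq> ball (x p) \<delta> \<inter> (\<lambda>a. (a, s a)) -` G"
    using openE by blast
  show thesis
  proof
    show "s holomorphic_on ball (x p) e" using s(2) e(2) by (auto intro: holomorphic_on_subset)
  qed (use e s y_square in \<open>auto simp: mk_in_cut subset_iff\<close>)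
qed

text \<open>A holomorphic right inverse with values in \<open>U\<close> must coincide with
  \<open>inv_into U \<phi>\<close>, because \<open>\<phi>\<close> is injective. This is the part
  that the two kinds of coordinates have in common.\<close>

lemma chart_image:
  assumes inj: "inj_on \<phi> U"
    and loc: "\<And>p. p \<in> U \<Longrightarrow> \<exists>\<delta> Z W. \<delta> > 0 \<and> Z holomorphic_on ball (\<phi> p) \<delta> \<and> W holomorphic_on ball (\<phi> p) \<delta> \<and>
       (\<forall>t\<in>ball (\<phi> p) \<delta>. mk (Z t) (W t) \<in> U \<and> \<phi> (mk (Z t) (W t)) = t)"
  shows "open (\<phi> ` U)"
    and "(\<lambda>t. x (inv_into U \<phi> t)) holomorphic_on \<phi> ` U"
    and "(\<lambda>t. y (inv_into U \<phi> t)) holomorphic_on \<phi> ` U"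
proof -
  have *: "\<exists>\<delta>>0. ball t0 \<delta> \<subseteq> \<phi> ` U \<and> (\<lambda>t. x (inv_into U \<phi> t)) holomorphic_on ball t0 \<delta> \<and>
      (\<lambda>t. y (inv_into U \<phi> t)) holomorphic_on ball t0 \<delta>" if t0: "t0 \<in> \<phi> ` U" for t0
  proof -
    obtain p where p: "p \<in> U" "t0 = \<phi> p" using t0 by blast
    obtain \<delta> Z W where \<delta>: "\<delta> > 0" "Z holomorphic_on ball t0 \<delta>" "W holomorphic_on ball t0 \<delta>"
      and mk: "\<And>t. t \<in> ball t0 \<delta> \<Longrightarrow> mk (Z t) (W t) \<in> U \<and> \<phi> (mk (Z t) (W t)) = t"
      using loc[OF p(1)] unfolding p(2) by metis
    have inv: "inv_into U \<phi> t = mk (Z t) (W t)" if "t \<in> ball t0 \<delta>" for t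
      using mk[OF that] inv_into_f_eq[OF inj] by blast
    show ?thesis
    proof (intro exI conjI)
      show "ball t0 \<delta> \<subseteq> \<phi> ` U" using mk by (metis imageI subsetI)
      show "(\<lambda>t. x (inv_into U \<phi> t)) holomorphic_on ball t0 \<delta>"
        by (rule holomorphic_transform[OF \<delta>(2)]) (simp add: inv x_mk)
      show "(\<lambda>t. y (inv_into U \<phi> t)) holomorphic_on ball t0 \<delta>"
        by (rule holomorphic_transform[OF \<delta>(3)]) (simp add: inv y_mk)
    qed (rule \<delta>(1))
  qed
  show op: "open (\<phi> ` U)" unfolding open_contains_ball using * by blast
  show "(\<lambda>t. x (inv_into U \<phi> t)) holomorphic_on \<phi> ` U"
    and "(\<lambda>t. y (inv_into U \<phi> t)) holomorphic_on \<phi> ` U"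
    using * by (meson analytic_imp_holomorphic analytic_on_def)+
qed

lemma x_chart:
  assumes U: "U = cut G" "open G" and inj: "inj_on x U" and ne: "\<And>p. p \<in> U \<Longrightarrow> y p \<noteq> 0"
  shows "open (x ` U)" "(\<lambda>t. y (inv_into U x t)) holomorphic_on x ` U"
proof -
  have "\<exists>\<delta> Z W. \<delta> > 0 \<and> Z holomorphic_on ball (x p) \<delta> \<and> W holomorphic_on ball (x p) \<delta> \<and>
       (\<forall>t\<in>ball (x p) \<delta>. mk (Z t) (W t) \<in> U \<and> x (mk (Z t) (W t)) = t)" if p: "p \<in> U" for p
  proof -
    obtain \<delta> s where "\<delta> > 0" "s holomorphic_on ball (x p) \<delta>"
      "\<And>a. a \<in> ball (x p) \<delta> \<Longrightarrow> mk a (s a) \<in> cut G \<and> s a \<noteq> 0"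
      using section_in_cut[OF U(2), of p] p ne[OF p] U(1) by metis
    then show ?thesis
      by (intro exI[of _ \<delta>] exI[of _ "\<lambda>z. z"] exI[of _ s]) (auto simp: U(1) x_mk)
  qed
  note loc = this
  show "open (x ` U)" "(\<lambda>t. y (inv_into U x t)) holomorphic_on x ` U"
    using chart_image(1)[OF inj loc] chart_image(3)[OF inj loc] by blast+
qed

text \<open>Where f' does not vanish, f has a local inverse g, and the curve y^2 = f(x) reads x =
  g(y^2).\<close>

lemma y_chart:
  assumes U: "U = cut G" "open G" and inj: "inj_on y U" and ne: "\<And>p. p \<in> U \<Longrightarrow> poly (pderiv f) (x p) \<noteq> 0"
  shows "open (y ` U)" "(\<lambda>t. x (inv_into U y t)) holomorphic_on y ` U"
proof -
  have "\<exists>\<delta> Z W. \<delta> > 0 \<and> Z holomorphic_on ball (y p) \<delta> \<and> W holomorphic_on ball (y p) \<delta> \<and>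
       (\<forall>t\<in>ball (y p) \<delta>. mk (Z t) (W t) \<in> U \<and> y (mk (Z t) (W t)) = t)" if p: "p \<in> U" for p
  proof -
    have pS: "p \<in> S" and pG: "(x p, y p) \<in> G" using p U(1) by (auto simp: cut_def)
    have "deriv (poly f) (x p) \<noteq> 0"
      using ne[OF p] by (simp add: DERIV_imp_deriv[OF poly_DERIV])
    then obtain r g where r: "r > 0" "inj_on (poly f) (ball (x p) r)" "open (poly f ` ball (x p) r)"
      "g holomorphic_on poly f ` ball (x p) r" "\<And>z. z \<in> ball (x p) r \<Longrightarrow> g (poly f z) = z"
      by (rule_tac holomorphic_injective_near[of "poly f" UNIV "x p"]) (auto intro!: holomorphic_intros)
    define O1 where "O1 = (\<lambda>t. t\<^sup>2) -` (poly f ` ball (x p) r)"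
    have O1: "open O1" unfolding O1_def
      by (rule open_vimage[OF r(3)]) (intro continuous_intros)
    have hg: "(\<lambda>t. g (t\<^sup>2)) holomorphic_on O1"
      by (rule holomorphic_on_compose_gen[OF _ r(4), unfolded o_def])
        (auto simp: O1_def intro!: holomorphic_intros)
    have "open (O1 \<inter> (\<lambda>t. (g (t\<^sup>2), t)) -` G)"
      by (rule continuous_open_preimage[OF _ O1 U(2)])
        (intro continuous_intros holomorphic_on_imp_continuous_on[OF hg])
    moreover have "y p \<in> O1 \<inter> (\<lambda>t. (g (t\<^sup>2), t)) -` G"
      using r(1,5) pG y_square[OF pS] by (auto simp: O1_def)
    ultimately obtain \<delta> where \<delta>: "\<delta> > 0" "ball (y p) \<delta> \<subseteq> O1 \<inter> (\<lambda>t. (g (t\<^sup>2), t)) -` G"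
      using openE by blast
    have "mk (g (t\<^sup>2)) t \<in> U" if "t \<in> ball (y p) \<delta>" for t
    proof -
      have "t \<in> O1 \<inter> (\<lambda>t. (g (t\<^sup>2), t)) -` G" using \<delta>(2) that by blast
      then have "t\<^sup>2 \<in> poly f ` ball (x p) r" "(g (t\<^sup>2), t) \<in> G" by (auto simp: O1_def)
      then show ?thesis using r(5) unfolding U(1) mk_in_cut by force
    qed
    moreover have "(\<lambda>t. g (t\<^sup>2)) holomorphic_on ball (y p) \<delta>"
      using hg \<delta>(2) by (auto intro: holomorphic_on_subset)
    ultimately show ?thesis
      using \<delta>(1) by (intro exI[of _ \<delta>] exI[of _ "\<lambda>t. g (t\<^sup>2)"] exI[of _ "\<lambda>t. t"]) (auto simp: y_mk)
  qed
  note loc = this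
  show "open (y ` U)" "(\<lambda>t. x (inv_into U y t)) holomorphic_on y ` U"
    using chart_image(1)[OF inj loc] chart_image(2)[OF inj loc] by blast+
qed

text \<open>Confining \<open>y\<close> to the ball about \<open>y p\<close> of radius
  \<open>norm (y p)\<close> removes the second sheet, so \<open>x\<close> determines
  \<open>y\<close>; the ball also avoids 0.\<close>

lemma x_chart_exists:
  assumes G: "open G" "p \<in> cut G" and y0: "y p \<noteq> 0"
  obtains G' where "open G'" "p \<in> cut G'" "cut G' \<subseteq> cut G" "inj_on x (cut G')" "\<And>q. q \<in> cut G' \<Longrightarrow> y q \<noteq> 0"
proof -
  obtain \<delta> s where s: "\<delta> > 0" 
    "\<And>q. q \<in> S \<Longrightarrow> x q \<in> ball (x p) \<delta> \<Longrightarrow> y q \<in> ball (y p) (norm (y p)) \<Longrightarrow> y q = s (x q)"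
    by (rule section_in_cut[OF G y0]) blast
  let ?G = "G \<inter> (ball (x p) \<delta> \<times> ball (y p) (norm (y p)))"
  have "inj_on x (cut ?G)"
  proof (rule inj_onI)
    fix q q' assume q: "q \<in> cut ?G" "q' \<in> cut ?G" "x q = x q'"
    then have "y q = y q'" using s(2)[of q] s(2)[of q'] by (auto simp: cut_def)
    then show "q = q'" using q mk_xy unfolding cut_def by (metis (no_types, lifting) mem_Collect_eq)
  qed
  moreover have "open ?G" using G by (intro open_Int open_Times) auto
  moreover have "p \<in> cut ?G" "cut ?G \<subseteq> cut G" using G(2) s(1) y0 by (auto simp: cut_def)
  moreover have "y q \<noteq> 0" if "q \<in> cut ?G" for q using that by (auto simp: cut_def)
  ultimately show thesis by (rule_tac that)
qed

text \<open>On a disc where f is injective, \<open>y\<close> determines f(x) = y^2 and hence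
  \<open>x\<close>. Injectivity also yields a nonvanishing derivative on the whole disc, as the
  chart condition demands.\<close>

lemma y_chart_exists:
  assumes G: "open G" "p \<in> cut G" and d0: "poly (pderiv f) (x p) \<noteq> 0"
  obtains G' where "open G'" "p \<in> cut G'" "cut G' \<subseteq> cut G" "inj_on y (cut G')"
    "\<And>q. q \<in> cut G' \<Longrightarrow> poly (pderiv f) (x q) \<noteq> 0"
proof -
  have "deriv (poly f) (x p) \<noteq> 0"
    using d0 by (simp add: DERIV_imp_deriv[OF poly_DERIV])
  then obtain r g where r: "r > 0" "\<And>z. z \<in> ball (x p) r \<Longrightarrow> g (poly f z) = (z :: complex)"
    and injp: "inj_on (poly f) (ball (x p) r)"
    by (rule_tac holomorphic_injective_near[of "poly f" UNIV "x p"]) (auto intro!: holomorphic_intros)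
  have "deriv (poly f) z \<noteq> 0" if "z \<in> ball (x p) r" for z
    by (rule holomorphic_injective_imp_regular[OF _ open_ball injp that]) (intro holomorphic_intros)
  then have reg: "poly (pderiv f) z \<noteq> 0" if "z \<in> ball (x p) r" for z
    using that by (simp add: DERIV_imp_deriv[OF poly_DERIV])
  let ?G = "G \<inter> (ball (x p) r \<times> UNIV)"
  have "inj_on y (cut ?G)"
  proof (rule inj_onI)
    fix q q' assume q: "q \<in> cut ?G" "q' \<in> cut ?G" "y q = y q'"
    then have "x q = x q'"
      using r(2)[of "x q"] r(2)[of "x q'"] y_square[of q] y_square[of q'] by (auto simp: cut_def)
    then show "q = q'" using q mk_xy unfolding cut_def by (metis (no_types, lifting) mem_Collect_eq)
  qed
  moreover have "open ?G" using G by (intro open_Int open_Times) auto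
  moreover have "p \<in> cut ?G" "cut ?G \<subseteq> cut G" using G(2) r(1) by (auto simp: cut_def)
  moreover have "poly (pderiv f) (x q) \<noteq> 0" if "q \<in> cut ?G" for q
    using that reg by (auto simp: cut_def)
  ultimately show thesis by (rule_tac that)
qed

end

text \<open>The surface is covered by two such pieces, one in the coordinates (z, w) and one in (u,
  v).\<close>

lemma compact_square_curve:
  fixes f :: "complex poly"
  shows "compact {q :: complex \<times> complex. norm (fst q) \<le> 1 \<and> (snd q)\<^sup>2 = poly f (fst q)}" (is "compact ?K")
proof -
  have "compact (poly f ` cball 0 1)"
    by (intro compact_continuous_image continuous_intros compact_cball)
  then have "bounded (poly f ` cball 0 1)" by (rule compact_imp_bounded)
  then obtain M where M: "\<And>z. norm z \<le> 1 \<Longrightarrow> norm (poly f z) \<le> M"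
    unfolding bounded_iff by (metis image_eqI mem_cball_0)
  have "norm (snd q) \<le> M + 1" if "q \<in> ?K" for q
  proof -
    have "(norm (snd q))\<^sup>2 \<le> M" using M[of "fst q"] that by (simp flip: norm_power)
    moreover have "norm (snd q) \<le> (norm (snd q))\<^sup>2 + 1"
      using zero_le_power2[of "norm (snd q) - 1"] norm_ge_zero[of "snd q"]
      unfolding power2_diff by (simp; linarith)
    ultimately show ?thesis by linarith
  qed
  then have "?K \<subseteq> cball 0 1 \<times> cball 0 (M + 1)" by (intro subsetI) (simp add: mem_Times_iff)
  then have "bounded ?K" by (rule bounded_subset[OF bounded_Times[OF bounded_cball bounded_cball]])
  moreover have "closed ?K"
    by (intro closed_Collect_conj closed_Collect_le closed_Collect_eq continuous_intros)
  ultimately show ?thesis by (simp add: compact_eq_bounded_closed)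
qed

section \<open>Topology of the compact curve of degree six\<close>

locale sextic =
  fixes P :: "complex poly"
  assumes deg: "degree P = 6" and simple_roots: "\<And>z. poly P z = 0 \<Longrightarrow> poly (pderiv P) z \<noteq> 0"
    and P0: "poly P 0 \<noteq> 0"
begin

abbreviation "X \<equiv> hyperelliptic P"
abbreviation "T \<equiv> surface_topology (hyperelliptic P)"
text \<open>The polynomial u^6 P(1/u), so that the curve at infinity is v^2 = R(u). Since R(0) is
  the leading coefficient of P, two distinct points lie over infinity.\<close>

abbreviation "R \<equiv> reflect_poly P"

definition infpts :: "hpoint set" where
  "infpts = (affine_points P - points_over_zero P) \<union> points_over_infinity P"

lemma poly_R: "u \<noteq> 0 \<Longrightarrow> poly R u = u ^ 6 * poly P (1 / u)"
  by (simp add: poly_reflect_poly_nz deg divide_inverse)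

lemma poly_R0: "poly R 0 = lead_coeff P" and R0: "poly R 0 \<noteq> 0"
  using deg by auto (metis leading_coeff_0_iff degree_0 zero_neq_numeral)+

lemma in_affine_points [simp]:
  "Affine z w \<in> affine_points P \<longleftrightarrow> w\<^sup>2 = poly P z" "At_infinity v \<notin> affine_points P"
  by (auto simp: affine_points_def)

lemma in_infpts [simp]:
  "Affine z w \<in> infpts \<longleftrightarrow> w\<^sup>2 = poly P z \<and> z \<noteq> 0" "At_infinity v \<in> infpts \<longleftrightarrow> v\<^sup>2 = lead_coeff P"
  by (auto simp: infpts_def affine_points_def points_over_zero_def points_over_infinity_def)

lemma upoint_in: "upoint u v \<in> infpts \<longleftrightarrow> v\<^sup>2 = poly R u"
proof (cases "u = 0")
  case False
  then show ?thesis
    by (simp add: upoint_def poly_R power_divide divide_simps mult.commute)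
qed (simp add: upoint_def)

lemma upoint_xy: "p \<in> infpts \<Longrightarrow> upoint (uc p) (vc 3 p) = p"
  by (cases p) (auto simp: upoint_def power_divide)

sublocale aff: square_curve Affine zc wc "affine_points P" P
  by unfold_locales (auto simp: affine_points_def)

sublocale inf: square_curve upoint uc "vc 3" infpts R
  by unfold_locales (auto simp: upoint_in upoint_xy)

lemma affine_open_iff: "affine_open P U \<longleftrightarrow> (\<exists>G. open G \<and> U = aff.cut G)"
  by (simp add: affine_open_def aff.cut_def)

lemma infinity_open_iff: "infinity_open P U \<longleftrightarrow> (\<exists>G. open G \<and> U = inf.cut G)"
  by (simp add: infinity_open_def inf.cut_def deg flip: infpts_def)

lemma X_cases:
  assumes "(U, \<phi>) \<in> X"
  obtains (z) G where "open G" "U = aff.cut G" "\<phi> = zc" "inj_on zc U" "\<forall>p\<in>U. wc p \<noteq> 0"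
    | (w) G where "open G" "U = aff.cut G" "\<phi> = wc" "inj_on wc U" "\<forall>p\<in>U. poly (pderiv P) (zc p) \<noteq> 0"
    | (u) G where "open G" "U = inf.cut G" "\<phi> = uc" "inj_on uc U" "\<forall>p\<in>U. vc 3 p \<noteq> 0"
  using assms unfolding hyperelliptic_def affine_open_iff infinity_open_iff by (auto simp: deg)

lemma z_chartI: "open G \<Longrightarrow> inj_on zc (aff.cut G) \<Longrightarrow> (\<And>p. p \<in> aff.cut G \<Longrightarrow> wc p \<noteq> 0) \<Longrightarrow> (aff.cut G, zc) \<in> X"
  and w_chartI: "open G \<Longrightarrow> inj_on wc (aff.cut G) \<Longrightarrow> (\<And>p. p \<in> aff.cut G \<Longrightarrow> poly (pderiv P) (zc p) \<noteq> 0) \<Longrightarrow> (aff.cut G, wc) \<in> X"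
  and u_chartI: "open G \<Longrightarrow> inj_on uc (inf.cut G) \<Longrightarrow> (\<And>p. p \<in> inf.cut G \<Longrightarrow> vc 3 p \<noteq> 0) \<Longrightarrow> (inf.cut G, uc) \<in> X"
  unfolding hyperelliptic_def affine_open_iff infinity_open_iff by (auto simp: deg)

lemma aff_cut_Int: "aff.cut G \<inter> aff.cut G' = aff.cut (G \<inter> G')"
  and inf_cut_Int: "inf.cut G \<inter> inf.cut G' = inf.cut (G \<inter> G')"
  by (auto simp: aff.cut_def inf.cut_def)

text \<open>The coordinate change (z, w) to (1/z, w/z^3) is its own inverse, so the same map
  \<open>?h\<close> serves here and in \<open>inf_cut_Int_aff\<close>.\<close>

lemma aff_cut_Int_infpts:
  assumes "open G"
  obtains G' where "open G'" "aff.cut G \<inter> infpts = inf.cut G'"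
proof
  let ?h = "\<lambda>q :: complex \<times> complex. (1 / fst q, snd q / fst q ^ 3)"
  let ?S = "{q :: complex \<times> complex. fst q \<noteq> 0}"
  have S: "open ?S" by (intro open_Collect_neq continuous_intros)
  show "open (?S \<inter> ?h -` G)"
    by (rule continuous_open_preimage[OF _ S assms]) (auto intro!: continuous_intros)
  show "aff.cut G \<inter> infpts = inf.cut (?S \<inter> ?h -` G)"
  proof (rule set_eqI)
    show "p \<in> aff.cut G \<inter> infpts \<longleftrightarrow> p \<in> inf.cut (?S \<inter> ?h -` G)" for p
      by (cases p) (auto simp: aff.cut_def inf.cut_def power_divide)
  qed
qed

lemma inf_cut_Int_aff:
  assumes "open G"
  obtains G' where "open G'" "inf.cut G \<inter> affine_points P = aff.cut G'"
proof
  let ?h = "\<lambda>q :: complex \<times> complex. (1 / fst q, snd q / fst q ^ 3)"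
  let ?S = "{q :: complex \<times> complex. fst q \<noteq> 0}"
  have S: "open ?S" by (intro open_Collect_neq continuous_intros)
  show "open (?S \<inter> ?h -` G)"
    by (rule continuous_open_preimage[OF _ S assms]) (auto intro!: continuous_intros)
  show "inf.cut G \<inter> affine_points P = aff.cut (?S \<inter> ?h -` G)"
  proof (rule set_eqI)
    show "p \<in> inf.cut G \<inter> affine_points P \<longleftrightarrow> p \<in> aff.cut (?S \<inter> ?h -` G)" for p
      by (cases p) (auto simp: aff.cut_def inf.cut_def)
  qed
qed

lemma infpts_Int_aff: "p \<in> infpts \<Longrightarrow> p \<in> affine_points P \<Longrightarrow> zc p \<noteq> 0 \<and> uc p = 1 / zc p \<and> vc 3 p = wc p / zc p ^ 3"
  by (cases p) auto

lemma aff_cut_subset: "aff.cut G \<subseteq> affine_points P" and inf_cut_subset: "inf.cut G \<subseteq> infpts"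
  by (auto simp: aff.cut_def inf.cut_def)

text \<open>An open condition on one coordinate is an open condition on the coordinate pair, and the
  change to the other patch is continuous. So the topology generated by charts can be compared with
  that of two curves in the complex plane squared.\<close>

lemma basis_good:
  assumes "(U, \<phi>) \<in> X" "open V"
  obtains G G' where "open G" "open G'" "(U \<inter> \<phi> -` V) \<inter> affine_points P = aff.cut G"
    "(U \<inter> \<phi> -` V) \<inter> infpts = inf.cut G'"
proof -
  have "(\<exists>G. open G \<and> U \<inter> \<phi> -` V = aff.cut G) \<or> (\<exists>G. open G \<and> U \<inter> \<phi> -` V = inf.cut G)"
    using assms(1)
  proof (cases rule: X_cases)
    case (z G)
    then have "U \<inter> \<phi> -` V = aff.cut (G \<inter> (V \<times> UNIV))" by (auto simp: aff.cut_def)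
    moreover have "open (G \<inter> (V \<times> UNIV))" using z assms by (intro open_Int open_Times) auto
    ultimately show ?thesis by blast
  next
    case (w G)
    then have "U \<inter> \<phi> -` V = aff.cut (G \<inter> (UNIV \<times> V))" by (auto simp: aff.cut_def)
    moreover have "open (G \<inter> (UNIV \<times> V))" using w assms by (intro open_Int open_Times) auto
    ultimately show ?thesis by blast
  next
    case (u G)
    then have "U \<inter> \<phi> -` V = inf.cut (G \<inter> (V \<times> UNIV))" by (auto simp: inf.cut_def)
    moreover have "open (G \<inter> (V \<times> UNIV))" using u assms by (intro open_Int open_Times) auto
    ultimately show ?thesis by blast
  qed
  then show thesis
  proof (elim disjE exE conjE)
    fix G assume G: "open G" "U \<inter> \<phi> -` V = aff.cut G"
    then have "(U \<inter> \<phi> -` V) \<inter> affine_points P = aff.cut G" using aff_cut_subset by blast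
    with G aff_cut_Int_infpts[OF G(1)] that show thesis by metis
  next
    fix G assume G: "open G" "U \<inter> \<phi> -` V = inf.cut G"
    then have "(U \<inter> \<phi> -` V) \<inter> infpts = inf.cut G" using inf_cut_subset by blast
    with G inf_cut_Int_aff[OF G(1)] that show thesis by metis
  qed
qed

lemma topspace_sub: "(U, \<phi>) \<in> X \<Longrightarrow> U \<subseteq> affine_points P \<union> infpts"
  by (erule X_cases) (use aff_cut_subset inf_cut_subset in blast)+

lemma affine_chart_exists:
  assumes "open G" "p \<in> aff.cut G"
  obtains U \<phi> where "(U, \<phi>) \<in> X" "p \<in> U" "U \<subseteq> aff.cut G" "\<phi> = zc \<or> \<phi> = wc"
proof (cases "wc p = 0")
  case False
  with aff.x_chart_exists[OF assms] z_chartI that show thesis by metis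
next
  case True
  have "p \<in> affine_points P" using assms by (simp add: aff.cut_def)
  then have "poly (pderiv P) (zc p) \<noteq> 0"
    using simple_roots True by (auto simp: affine_points_def)
  with aff.y_chart_exists[OF assms] w_chartI that show thesis by metis
qed

text \<open>If v = 0, then u is a root of R and hence nonzero; the point is then an affine branch
  point, which has a w-chart.\<close>

lemma infinity_chart_exists:
  assumes "open G" "p \<in> inf.cut G"
  obtains U \<phi> where "(U, \<phi>) \<in> X" "p \<in> U" "U \<subseteq> inf.cut G"
proof (cases "vc 3 p = 0")
  case False
  with inf.x_chart_exists[OF assms] u_chartI that show thesis by metis
next
  case True
  have p: "p \<in> infpts" using assms inf_cut_subset by blast
  then have "poly R (uc p) = 0" using inf.y_square[of p] True by simp
  then have "uc p \<noteq> 0" using R0 by metis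
  then have "p \<in> affine_points P"
    using p by (auto simp: infpts_def points_over_infinity_def)
  moreover obtain G' where "open G'" "inf.cut G \<inter> affine_points P = aff.cut G'"
    using inf_cut_Int_aff assms(1) by blast
  ultimately show thesis using affine_chart_exists assms(2) that by (metis Int_iff Int_lower1 order_trans)
qed

lemma openin_aff_cut: assumes "open G" shows "openin T (aff.cut G)"
proof (subst openin_subopen, intro ballI)
  fix p assume "p \<in> aff.cut G"
  then obtain U \<phi> where U: "(U, \<phi>) \<in> X" "p \<in> U" "U \<subseteq> aff.cut G"
    using affine_chart_exists[OF assms] by metis
  have "openin T U" using openin_chart[OF U(1) open_UNIV] by simp
  with U show "\<exists>W. openin T W \<and> p \<in> W \<and> W \<subseteq> aff.cut G" by blast
qed

lemma openin_inf_cut: assumes "open G" shows "openin T (inf.cut G)"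
proof (subst openin_subopen, intro ballI)
  fix p assume "p \<in> inf.cut G"
  then obtain U \<phi> where U: "(U, \<phi>) \<in> X" "p \<in> U" "U \<subseteq> inf.cut G"
    using infinity_chart_exists[OF assms] by metis
  have "openin T U" using openin_chart[OF U(1) open_UNIV] by simp
  with U show "\<exists>W. openin T W \<and> p \<in> W \<and> W \<subseteq> inf.cut G" by blast
qed

lemma topspace_X: "topspace T = affine_points P \<union> infpts"
proof
  show "topspace T \<subseteq> affine_points P \<union> infpts"
    unfolding topspace_surface using topspace_sub by fastforce
  have "aff.cut UNIV = affine_points P" "inf.cut UNIV = infpts" by (auto simp: aff.cut_def inf.cut_def)
  then show "affine_points P \<union> infpts \<subseteq> topspace T"
    using openin_aff_cut[OF open_UNIV] openin_inf_cut[OF open_UNIV] by (auto dest: openin_subset)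
qed

abbreviation "C0 \<equiv> {q :: complex \<times> complex. (snd q)\<^sup>2 = poly P (fst q)}"
abbreviation "C1 \<equiv> {q :: complex \<times> complex. (snd q)\<^sup>2 = poly R (fst q)}"

text \<open>Carries connectedness and compactness from sets of coordinate pairs over to the abstract
  surface.\<close>

lemma continuous_map_Affine: "continuous_map (top_of_set C0) T (\<lambda>q. Affine (fst q) (snd q))"
  unfolding surface_topology_def
proof (rule continuous_on_generated_topo)
  fix W assume "W \<in> {U \<inter> \<phi> -` V |U \<phi> V. (U, \<phi>) \<in> X \<and> open V}"
  then obtain G where "open G" "W \<inter> affine_points P = aff.cut G"
    using basis_good by (smt (verit, best) mem_Collect_eq)
  then have "(\<lambda>q. Affine (fst q) (snd q)) -` W \<inter> C0 = C0 \<inter> G"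
  proof (intro set_eqI)
    fix q
    have "Affine (fst q) (snd q) \<in> aff.cut G \<longleftrightarrow> q \<in> C0 \<inter> G" by (simp add: aff.mk_in_cut)
    then show "q \<in> (\<lambda>q. Affine (fst q) (snd q)) -` W \<inter> C0 \<longleftrightarrow> q \<in> C0 \<inter> G"
      using \<open>W \<inter> affine_points P = aff.cut G\<close> by (simp add: set_eq_iff) (metis (no_types, lifting) in_affine_points(1))
  qed
  then show "openin (top_of_set C0) ((\<lambda>q. Affine (fst q) (snd q)) -` W \<inter> topspace (top_of_set C0))"
    using \<open>open G\<close> by (simp add: openin_open_Int)
next
  have "(\<lambda>q. Affine (fst q) (snd q)) ` C0 \<subseteq> topspace T" by (auto simp: topspace_X affine_points_def)
  then show "(\<lambda>q. Affine (fst q) (snd q)) ` topspace (top_of_set C0) \<subseteq> \<Union> {U \<inter> \<phi> -` V |U \<phi> V. (U, \<phi>) \<in> X \<and> open V}"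
    by (simp add: surface_topology_def topology_generated_by_topspace)
qed

lemma continuous_map_upoint: "continuous_map (top_of_set C1) T (\<lambda>q. upoint (fst q) (snd q))"
  unfolding surface_topology_def
proof (rule continuous_on_generated_topo)
  fix W assume "W \<in> {U \<inter> \<phi> -` V |U \<phi> V. (U, \<phi>) \<in> X \<and> open V}"
  then obtain G where G: "open G" "W \<inter> infpts = inf.cut G"
    using basis_good by (smt (verit, best) mem_Collect_eq)
  have "upoint (fst q) (snd q) \<in> W \<longleftrightarrow> q \<in> G" if "q \<in> C1" for q
  proof -
    have "upoint (fst q) (snd q) \<in> infpts" using that by (simp add: upoint_in)
    moreover have "upoint (fst q) (snd q) \<in> inf.cut G \<longleftrightarrow> q \<in> G" using that by (simp add: inf.mk_in_cut)
    ultimately show ?thesis using G(2) by blast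
  qed
  then have "(\<lambda>q. upoint (fst q) (snd q)) -` W \<inter> C1 = C1 \<inter> G" by blast
  then show "openin (top_of_set C1) ((\<lambda>q. upoint (fst q) (snd q)) -` W \<inter> topspace (top_of_set C1))"
    using \<open>open G\<close> by (simp add: openin_open_Int)
next
  have "(\<lambda>q. upoint (fst q) (snd q)) ` C1 \<subseteq> topspace T" by (auto simp: topspace_X upoint_in)
  then show "(\<lambda>q. upoint (fst q) (snd q)) ` topspace (top_of_set C1) \<subseteq> \<Union> {U \<inter> \<phi> -` V |U \<phi> V. (U, \<phi>) \<in> X \<and> open V}"
    by (simp add: surface_topology_def topology_generated_by_topspace)
qed

lemma Hausdorff_X: "Hausdorff_space T"
  unfolding Hausdorff_space_def
proof (intro allI impI)
  fix p q assume pq: "p \<in> topspace T \<and> q \<in> topspace T \<and> p \<noteq> q"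
  \<comment> \<open>Such points have z = 0 and u = 0 respectively. The sets |z| < 1 and |u| < 1
    separate them, since u = 1/z on the overlap.\<close>
  have mixed: "\<exists>U V. openin T U \<and> openin T V \<and> p \<in> U \<and> q \<in> V \<and> disjnt U V"
    if p: "p \<in> affine_points P" "p \<notin> infpts" and q: "q \<in> infpts" "q \<notin> affine_points P" for p q
  proof (intro exI conjI)
    show "openin T (aff.cut (ball 0 1 \<times> UNIV))" by (intro openin_aff_cut open_Times) auto
    show "openin T (inf.cut (ball 0 1 \<times> UNIV))" by (intro openin_inf_cut open_Times) auto
    show "p \<in> aff.cut (ball 0 1 \<times> UNIV)"
      using p by (cases p) (auto simp: aff.cut_def)
    show "q \<in> inf.cut (ball 0 1 \<times> UNIV)"
      using q by (cases q) (auto simp: inf.cut_def)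
    show "disjnt (aff.cut (ball 0 1 \<times> UNIV)) (inf.cut (ball 0 1 \<times> UNIV))"
      unfolding disjnt_iff
    proof (intro allI notI)
      fix r assume r: "r \<in> aff.cut (ball 0 1 \<times> UNIV) \<and> r \<in> inf.cut (ball 0 1 \<times> UNIV)"
      then have "zc r \<noteq> 0" "uc r = 1 / zc r" "norm (zc r) < 1" "norm (uc r) < 1"
        using infpts_Int_aff[of r] by (auto simp: aff.cut_def inf.cut_def)
      then show False by (simp add: norm_divide)
    qed
  qed
  consider "p \<in> affine_points P" "q \<in> affine_points P" | "p \<in> infpts" "q \<in> infpts"
    | "p \<in> affine_points P" "p \<notin> infpts" "q \<in> infpts" "q \<notin> affine_points P"
    | "q \<in> affine_points P" "q \<notin> infpts" "p \<in> infpts" "p \<notin> affine_points P"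
    using pq by (auto simp: topspace_X)
  then show "\<exists>U V. openin T U \<and> openin T V \<and> p \<in> U \<and> q \<in> V \<and> disjnt U V"
  proof cases
    case 1
    then have "(zc p, wc p) \<noteq> (zc q, wc q)" using aff.mk_xy pq by (metis Pair_inject)
    then obtain G G' where "open G" "open G'" "(zc p, wc p) \<in> G" "(zc q, wc q) \<in> G'" "G \<inter> G' = {}"
      using hausdorff by meson
    with 1 have "openin T (aff.cut G)" "openin T (aff.cut G')" "p \<in> aff.cut G" "q \<in> aff.cut G'" "disjnt (aff.cut G) (aff.cut G')"
      by (simp_all add: openin_aff_cut) (auto simp: aff.cut_def disjnt_iff)
    then show ?thesis by blast
  next
    case 2
    then have "(uc p, vc 3 p) \<noteq> (uc q, vc 3 q)" using inf.mk_xy pq by (metis Pair_inject)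
    then obtain G G' where "open G" "open G'" "(uc p, vc 3 p) \<in> G" "(uc q, vc 3 q) \<in> G'" "G \<inter> G' = {}"
      using hausdorff by meson
    with 2 have "openin T (inf.cut G)" "openin T (inf.cut G')" "p \<in> inf.cut G" "q \<in> inf.cut G'" "disjnt (inf.cut G) (inf.cut G')"
      by (simp_all add: openin_inf_cut) (auto simp: inf.cut_def disjnt_iff)
    then show ?thesis by blast
  next
    case 3
    then show ?thesis using mixed by blast
  next
    case 4
    then show ?thesis using mixed[of q p] by (metis disjnt_sym)
  qed
qed

text \<open>Every point satisfies |z| \<le> 1 or |u| \<le> 1, and over either disc the curve is
  compact.\<close>

lemma compact_X: "compact_space T"
proof -
  let ?K = "\<lambda>f. {q :: complex \<times> complex. norm (fst q) \<le> 1 \<and> (snd q)\<^sup>2 = poly f (fst q)}"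
  let ?A = "(\<lambda>q. Affine (fst q) (snd q)) ` ?K P" and ?B = "(\<lambda>q. upoint (fst q) (snd q)) ` ?K R"
  have "compactin T ?A"
    by (rule image_compactin[OF _ continuous_map_Affine])
      (use compact_square_curve[of P] in \<open>auto simp: compactin_subtopology\<close>)
  moreover have "compactin T ?B"
    by (rule image_compactin[OF _ continuous_map_upoint])
      (use compact_square_curve[of R] in \<open>auto simp: compactin_subtopology\<close>)
  ultimately have c: "compactin T (?A \<union> ?B)" by (rule compactin_Un)
  have "p \<in> ?A \<union> ?B" if p: "p \<in> topspace T" for p
  proof (cases "p \<in> affine_points P \<and> norm (zc p) \<le> 1")
    case True
    then have "p \<in> ?A" by (intro image_eqI[of _ _ "(zc p, wc p)"]) (auto simp: aff.mk_xy aff.y_square)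
    then show ?thesis ..
  next
    case False
    then have pi: "p \<in> infpts"
      using p by (auto simp: topspace_X infpts_def points_over_zero_def affine_points_def)
    have "norm (uc p) \<le> 1"
      using False pi by (cases p) (auto simp: norm_divide)
    then have "p \<in> ?B"
      using pi by (intro image_eqI[of _ _ "(uc p, vc 3 p)"]) (auto simp: upoint_xy inf.y_square)
    then show ?thesis ..
  qed
  then have "?A \<union> ?B = topspace T" using compactin_subset_topspace[OF c] by blast
  with c show ?thesis by (simp add: compact_space_def)
qed

lemma connected_X:
  assumes C0: "connected C0"
  shows "connected_space T"
proof -
  let ?i = "\<lambda>q. Affine (fst q) (snd q)"
  have "connectedin (top_of_set C0) C0" using C0 by (simp add: connectedin_subtopology)
  then have "connectedin T (?i ` C0)"
    by (rule connectedin_continuous_map_image[OF continuous_map_Affine])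
  moreover have "?i ` C0 = affine_points P" by (auto simp: affine_points_def image_iff)
  ultimately have c: "connectedin T (affine_points P)" by simp
  \<comment> \<open>Near a point at infinity v is a function of u, and a small nonzero u gives an
    affine point in the neighbourhood. The surface is therefore the closure of its connected affine
    part.\<close>
  have "p \<in> T closure_of affine_points P" if p: "p \<in> points_over_infinity P" for p
    unfolding in_closure_of
  proof (intro conjI allI impI)
    have pi: "p \<in> infpts" using p by (simp add: infpts_def)
    then show "p \<in> topspace T" by (simp add: topspace_X)
    fix W assume W: "p \<in> W \<and> openin T W"
    have u0: "uc p = 0" using p by (auto simp: points_over_infinity_def)
    have v0: "vc 3 p \<noteq> 0" using inf.y_square[OF pi] R0 u0 by auto
    have "openin (top_of_set C1) {q \<in> topspace (top_of_set C1). upoint (fst q) (snd q) \<in> W}"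
      using continuous_map_upoint W by (rule_tac openin_continuous_map_preimage) auto
    then obtain G where G: "open G" "{q \<in> C1. upoint (fst q) (snd q) \<in> W} = C1 \<inter> G"
      by (auto simp: openin_open)
    have "(uc p, vc 3 p) \<in> {q \<in> C1. upoint (fst q) (snd q) \<in> W}"
      using W inf.y_square[OF pi] upoint_xy[OF pi] by simp
    then have "(uc p, vc 3 p) \<in> C1 \<inter> G" by (simp only: G(2))
    then have "p \<in> inf.cut G" using pi by (simp add: inf.cut_def)
    then obtain \<delta> s where s: "\<delta> > 0" "\<And>a. a \<in> ball (uc p) \<delta> \<Longrightarrow> upoint a (s a) \<in> inf.cut G \<and> s a \<noteq> 0"
      using inf.section_in_cut[OF G(1) _ v0] by metis
    define a :: complex where "a = of_real (\<delta> / 2)"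
    have a: "a \<in> ball (uc p) \<delta>" "a \<noteq> 0" using s(1) by (auto simp: a_def u0)
    from s(2)[OF a(1)] have sa: "(s a)\<^sup>2 = poly R a" "(a, s a) \<in> G" by (auto simp: inf.mk_in_cut)
    then have "(a, s a) \<in> {q \<in> C1. upoint (fst q) (snd q) \<in> W}" unfolding G(2) by simp
    then have "upoint a (s a) \<in> W" by simp
    moreover have "upoint a (s a) \<in> affine_points P"
      using sa(1) a(2) upoint_in[of a "s a"] by (auto simp: upoint_def infpts_def points_over_infinity_def)
    ultimately show "\<exists>y. y \<in> affine_points P \<and> y \<in> W" by blast
  qed
  moreover have "affine_points P \<subseteq> T closure_of affine_points P"
    by (intro closure_of_subset) (simp add: topspace_X)
  ultimately have "topspace T \<subseteq> T closure_of affine_points P"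
    by (auto simp: topspace_X infpts_def)
  then have "T closure_of affine_points P = topspace T"
    using closure_of_subset_topspace[of T] by blast
  with connectedin_closure_of[OF c] show ?thesis by (simp add: connectedin_topspace)
qed

end

section \<open>Change of coordinates for the forms f dh\<close>

context riemann
begin

text \<open>The chain rule gives the transformation rule off isolated points, where \<open>f\<close>
  and \<open>h\<close> may have meaningless values. Removing singularities commutes with the
  coordinate change: a finite limit is multiplied by the derivative, and at a pole both sides are 0,
  the derivative being nonzero.\<close>

lemma compatible_form_of:
  assumes h: "\<And>c t. c \<in> A \<Longrightarrow> t \<in> snd c ` fst c \<Longrightarrow>
        eventually (\<lambda>s. (h \<circ> inv_into (fst c) (snd c)) field_differentiable at s) (at t)"
    and raw: "\<And>c t. c \<in> A \<Longrightarrow> t \<in> snd c ` fst c \<Longrightarrow>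
        not_essential (\<lambda>t. f (inv_into (fst c) (snd c) t) * deriv (h \<circ> inv_into (fst c) (snd c)) t) t"
  shows "compatible_form A (form_of f h)"
  unfolding compatible_form_def
proof (intro ballI)
  fix c d t assume cd: "c \<in> A" "d \<in> A" and t: "t \<in> snd c ` (fst c \<inter> fst d)"
  let ?O = "snd c ` (fst c \<inter> fst d)" and ?\<tau> = "transition c d"
  let ?i = "\<lambda>c. inv_into (fst c) (snd c)"
  define F where "F c t = f (?i c t) * deriv (h \<circ> ?i c) t" for c t
  have O: "open ?O" by (rule overlap_open[OF cd])
  have inv: "?i d (?\<tau> s) = ?i c s" if "s \<in> ?O" for s
    using that cd chart_inj by (auto simp: transition_eq)
  have \<tau>t: "?\<tau> t \<in> snd d ` fst d" using t cd by (auto simp: transition_eq)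
  have evO: "eventually (\<lambda>s. s \<in> ?O) (at t)"
    using O t by (rule eventually_at_in_open')
  \<comment> \<open>Transition maps are injective, so punctured neighbourhoods go to punctured
    neighbourhoods; limits and poles of \<open>F d\<close> can thus be pulled back.\<close>
  have lim: "filterlim ?\<tau> (at (?\<tau> t)) (at t)"
    unfolding filterlim_at
  proof
    have "?\<tau> s \<noteq> ?\<tau> t" if s: "s \<in> ?O" "s \<noteq> t" for s
      using inv[OF s(1)] inv[OF t] f_inv_into_f[of _ "snd c" "fst c"] s t by (metis Int_lower1 image_mono subsetD)
    note \<tau>_ne = this
    show "\<forall>\<^sub>F s in at t. ?\<tau> s \<in> UNIV \<and> ?\<tau> s \<noteq> ?\<tau> t"
      using evO eventually_neq_at_within[of t t UNIV] by eventually_elim (use \<tau>_ne in auto)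
    show "(?\<tau> \<longlongrightarrow> ?\<tau> t) (at t)"
      using transition_has_derivative[OF cd t] DERIV_isCont isContD by blast
  qed
  have "eventually (\<lambda>s. (h \<circ> ?i d) field_differentiable at (?\<tau> s)) (at t)"
    using h[OF cd(2) \<tau>t] lim unfolding filterlim_iff by blast
  with evO have "eventually (\<lambda>s. F c s = F d (?\<tau> s) * deriv ?\<tau> s) (at t)"
  proof eventually_elim
    case (elim s)
    have "(h \<circ> ?i d \<circ> ?\<tau> has_field_derivative deriv (h \<circ> ?i d) (?\<tau> s) * deriv ?\<tau> s) (at s)"
      using elim cd by (intro DERIV_chain transition_has_derivative) (auto simp: DERIV_deriv_iff_field_differentiable)
    then have "(h \<circ> ?i c has_field_derivative deriv (h \<circ> ?i d) (?\<tau> s) * deriv ?\<tau> s) (at s)"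
      by (rule has_field_derivative_transform_within_open[OF _ O elim(1)]) (simp add: inv)
    then show ?case
      by (simp add: F_def inv[OF elim(1)] DERIV_imp_deriv)
  qed
  then have 1: "remove_sings (F c) t = remove_sings (\<lambda>s. F d (?\<tau> s) * deriv ?\<tau> s) t"
    by (rule remove_sings_cong) simp
  have an: "deriv ?\<tau> analytic_on {t}"
    using holomorphic_deriv[OF transition_holomorphic[OF cd] O] O t by (simp add: analytic_at) blast
  then have d\<tau>: "(deriv ?\<tau> \<longlongrightarrow> deriv ?\<tau> t) (at t)"
    using analytic_at_imp_isCont isContD by blast
  have "not_essential (F d) (?\<tau> t)" unfolding F_def by (rule raw[OF cd(2) \<tau>t])
  then have 2: "remove_sings (\<lambda>s. F d (?\<tau> s) * deriv ?\<tau> s) t = remove_sings (F d) (?\<tau> t) * deriv ?\<tau> t"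
    unfolding not_essential_def
  proof (elim disjE exE)
    fix L assume L: "F d \<midarrow>?\<tau> t\<rightarrow> L"
    then have "(\<lambda>s. F d (?\<tau> s) * deriv ?\<tau> s) \<midarrow>t\<rightarrow> L * deriv ?\<tau> t"
      by (intro tendsto_mult d\<tau> filterlim_compose[OF L lim])
    with L show ?thesis by (metis remove_sings_eqI)
  next
    assume p: "is_pole (F d) (?\<tau> t)"
    then have "is_pole (\<lambda>s. F d (?\<tau> s)) t"
      using lim unfolding is_pole_def by (rule filterlim_compose)
    then have "is_pole (\<lambda>s. F d (?\<tau> s) * deriv ?\<tau> s) t"
      by (rule is_pole_mult_analytic_nonzero2[OF _ an deriv_transition_nonzero[OF cd t]])
    with p show ?thesis by simp
  qed
  from 1 2 show "form_of f h c t = form_of f h d (?\<tau> t) * deriv ?\<tau> t"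
    by (simp add: form_of_def F_def [abs_def])
qed

end

section \<open>Holomorphic coordinate changes on the curve\<close>

context sextic
begin

lemma z_chart_facts:
  assumes "open G" "U = aff.cut G" "inj_on zc U" "\<forall>p\<in>U. wc p \<noteq> 0"
  shows "open (zc ` U)" "(\<lambda>t. wc (inv_into U zc t)) holomorphic_on zc ` U"
    "\<And>t. t \<in> zc ` U \<Longrightarrow> zc (inv_into U zc t) = t"
    "(\<lambda>t. zc (inv_into U zc t)) holomorphic_on zc ` U"
proof -
  show z: "zc (inv_into U zc t) = t" if "t \<in> zc ` U" for t using that by (simp add: f_inv_into_f)
  show "(\<lambda>t. zc (inv_into U zc t)) holomorphic_on zc ` U"
    by (rule holomorphic_transform[OF holomorphic_on_ident]) (simp add: z)
qed (use aff.x_chart[OF assms(2,1,3)] assms(4) in auto)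

lemma w_chart_facts:
  assumes "open G" "U = aff.cut G" "inj_on wc U" "\<forall>p\<in>U. poly (pderiv P) (zc p) \<noteq> 0"
  shows "open (wc ` U)" "(\<lambda>t. zc (inv_into U wc t)) holomorphic_on wc ` U"
    "\<And>t. t \<in> wc ` U \<Longrightarrow> wc (inv_into U wc t) = t"
    "(\<lambda>t. wc (inv_into U wc t)) holomorphic_on wc ` U"
proof -
  show w: "wc (inv_into U wc t) = t" if "t \<in> wc ` U" for t using that by (simp add: f_inv_into_f)
  show "(\<lambda>t. wc (inv_into U wc t)) holomorphic_on wc ` U"
    by (rule holomorphic_transform[OF holomorphic_on_ident]) (simp add: w)
qed (use aff.y_chart[OF assms(2,1,3)] assms(4) in auto)

lemma u_chart_facts:
  assumes "open G" "U = inf.cut G" "inj_on uc U" "\<forall>p\<in>U. vc 3 p \<noteq> 0"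
  shows "open (uc ` U)" "(\<lambda>t. vc 3 (inv_into U uc t)) holomorphic_on uc ` U"
    "\<And>t. t \<in> uc ` U \<Longrightarrow> uc (inv_into U uc t) = t"
  using inf.x_chart[OF assms(2,1,3)] assms(4) by (auto simp: f_inv_into_f)

lemma chart_inj_on: "(U, \<phi>) \<in> X \<Longrightarrow> inj_on \<phi> U"
  by (erule X_cases) auto

lemma chart_open_image: "(U, \<phi>) \<in> X \<Longrightarrow> open (\<phi> ` U)"
  by (erule X_cases) (auto dest: z_chart_facts w_chart_facts u_chart_facts)

text \<open>Overlaps of chart domains are again chart domains; this makes their images open.\<close>

lemma chart_restrict:
  assumes c: "(U, \<phi>) \<in> X" and d: "(U', \<phi>') \<in> X"
  shows "(U \<inter> U', \<phi>) \<in> X"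
proof -
  obtain H H' where H: "open H" "open H'" "U' \<inter> affine_points P = aff.cut H" "U' \<inter> infpts = inf.cut H'"
    using basis_good[OF d open_UNIV] by auto
  from c show ?thesis
  proof (cases rule: X_cases)
    case (z G)
    then have "U \<inter> U' = aff.cut (G \<inter> H)" using H(3) aff_cut_subset[of G] by (auto simp flip: aff_cut_Int)
    then show ?thesis using z H z_chartI[of "G \<inter> H"] inj_on_subset[OF z(4)] by (metis Int_iff Int_lower1 open_Int)
  next
    case (w G)
    then have "U \<inter> U' = aff.cut (G \<inter> H)" using H(3) aff_cut_subset[of G] by (auto simp flip: aff_cut_Int)
    then show ?thesis using w H w_chartI[of "G \<inter> H"] inj_on_subset[OF w(4)] by (metis Int_iff Int_lower1 open_Int)
  next
    case (u G)
    then have "U \<inter> U' = inf.cut (G \<inter> H')" using H(4) inf_cut_subset[of G] by (auto simp flip: inf_cut_Int)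
    then show ?thesis using u H u_chartI[of "G \<inter> H'"] inj_on_subset[OF u(4)] by (metis Int_iff Int_lower1 open_Int)
  qed
qed

lemma affine_chart_holomorphic:
  assumes c: "(U, \<phi>) \<in> X" and u: "\<phi> \<noteq> uc"
  shows "(\<lambda>t. zc (inv_into U \<phi> t)) holomorphic_on \<phi> ` U" "(\<lambda>t. wc (inv_into U \<phi> t)) holomorphic_on \<phi> ` U"
    "U \<subseteq> affine_points P"
proof -
  have "(\<lambda>t. zc (inv_into U \<phi> t)) holomorphic_on \<phi> ` U \<and> (\<lambda>t. wc (inv_into U \<phi> t)) holomorphic_on \<phi> ` U \<and>
    U \<subseteq> affine_points P"
    using c
  proof (cases rule: X_cases)
    case (z G)
    from z_chart_facts[OF z(1,2,4,5)] z(2,3) aff_cut_subset[of G] show ?thesis by simp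
  next
    case (w G)
    from w_chart_facts[OF w(1,2,4,5)] w(2,3) aff_cut_subset[of G] show ?thesis by simp
  qed (use u in simp)
  then show "(\<lambda>t. zc (inv_into U \<phi> t)) holomorphic_on \<phi> ` U" "(\<lambda>t. wc (inv_into U \<phi> t)) holomorphic_on \<phi> ` U"
    "U \<subseteq> affine_points P" by blast+
qed

text \<open>In a z- or w-chart both z and w are holomorphic in the local coordinate. In a u-chart v
  is, and off u = 0 so are z = 1/u and w = v/u^3. A transition map is always one of these functions,
  or u = 1/z.\<close>

lemma transition_X_holomorphic:
  assumes c: "c \<in> X" and d: "d \<in> X"
  shows "transition c d holomorphic_on snd c ` (fst c \<inter> fst d)"
proof -
  obtain U \<phi> U' \<phi>' where e: "c = (U, \<phi>)" "d = (U', \<phi>')" by fastforce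
  let ?O = "\<phi> ` (U \<inter> U')" and ?i = "inv_into U \<phi>"
  have sub: "?O \<subseteq> \<phi> ` U" by blast
  have iO: "?i t \<in> U \<inter> U'" "\<phi> (?i t) = t" if "t \<in> ?O" for t
    using that chart_inj_on[of U \<phi>] c e by auto
  have dc: "\<phi>' = zc \<or> \<phi>' = wc \<or> \<phi>' = uc \<and> U' \<subseteq> infpts"
    using d unfolding e by (cases rule: X_cases) (auto simp: inf.cut_def)
  have "(\<lambda>t. \<phi>' (?i t)) holomorphic_on ?O"
  proof (cases "\<phi> = uc")
    case False
    have hol: "(\<lambda>t. zc (?i t)) holomorphic_on ?O" "(\<lambda>t. wc (?i t)) holomorphic_on ?O" and Ua: "U \<subseteq> affine_points P"
      using affine_chart_holomorphic[of U \<phi>] c e False sub by (auto intro: holomorphic_on_subset)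
    from dc show ?thesis
    proof (elim disjE conjE)
      assume u: "\<phi>' = uc" "U' \<subseteq> infpts"
      have nz: "zc (?i t) \<noteq> 0 \<and> uc (?i t) = 1 / zc (?i t)" if "t \<in> ?O" for t
        using infpts_Int_aff[of "?i t"] iO[OF that] u Ua by blast
      have "(\<lambda>t. 1 / zc (?i t)) holomorphic_on ?O"
        using hol nz by (intro holomorphic_intros) auto
      then show ?thesis by (rule holomorphic_transform) (simp add: u nz)
    qed (use hol in auto)
  next
    case True
    have "\<exists>G. open G \<and> U = inf.cut G \<and> inj_on uc U \<and> (\<forall>p\<in>U. vc 3 p \<noteq> 0)"
    proof -
      \<comment> \<open>A chart does not record its kind. Its coordinate being \<open>uc\<close>
        decides the kind only because the three coordinate functions differ somewhere.\<close>
      have ne: "zc \<noteq> uc" "wc \<noteq> uc"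
      proof -
        have "zc (Affine 2 0) \<noteq> uc (Affine 2 0)" "wc (Affine 1 0) \<noteq> uc (Affine 1 0)" by simp_all
        then show "zc \<noteq> uc" "wc \<noteq> uc" by metis+
      qed
      show ?thesis using c unfolding e by (cases rule: X_cases) (use True ne in auto)
    qed
    then obtain G where G: "open G" "U = inf.cut G" "inj_on uc U" "\<forall>p\<in>U. vc 3 p \<noteq> 0" by blast
    note uf = u_chart_facts[OF G]
    have v: "(\<lambda>t. vc 3 (?i t)) holomorphic_on ?O" using uf(2) sub True by (auto intro: holomorphic_on_subset)
    have Ui: "U \<subseteq> infpts" using G(2) by (simp add: inf_cut_subset)
    show ?thesis
    proof (cases "\<phi>' = uc")
      case True': True
      show ?thesis
        by (rule holomorphic_transform[OF holomorphic_on_ident]) (use iO True True' in auto)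
    next
      case False
      then have Ua: "U' \<subseteq> affine_points P" using affine_chart_holomorphic(3) d e by blast
      have nz: "zc (?i t) \<noteq> 0 \<and> t = 1 / zc (?i t) \<and> vc 3 (?i t) = wc (?i t) / zc (?i t) ^ 3" if "t \<in> ?O" for t
        using infpts_Int_aff[of "?i t"] iO[OF that] Ui Ua True by auto
      then have z: "zc (?i t) = 1 / t" and w: "wc (?i t) = vc 3 (?i t) / t ^ 3" and t0: "t \<noteq> 0" if "t \<in> ?O" for t
      proof -
        have "z = 1 / t \<and> w = v / t ^ 3 \<and> t \<noteq> 0" if "z \<noteq> 0" "t = 1 / z" "v = w / z ^ 3" for t z w v :: complex
          using that by (simp add: power_divide)
        with nz[OF that] show "zc (?i t) = 1 / t" "wc (?i t) = vc 3 (?i t) / t ^ 3" "t \<noteq> 0" by blast+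
      qed
      have "(\<lambda>t. 1 / t) holomorphic_on ?O" "(\<lambda>t. vc 3 (?i t) / t ^ 3) holomorphic_on ?O"
        using v t0 by (intro holomorphic_intros; force)+
      then have "(\<lambda>t. zc (?i t)) holomorphic_on ?O" "(\<lambda>t. wc (?i t)) holomorphic_on ?O"
        using z w by (auto elim: holomorphic_transform)
      then show ?thesis using dc False by auto
    qed
  qed
  then show ?thesis by (simp add: e transition_def comp_def)
qed

lemma riemann_surface_X:
  assumes "connected C0"
  shows "riemann_surface X"
  unfolding riemann_surface_def
proof (intro conjI)
  show "\<forall>(U, \<phi>)\<in>X. inj_on \<phi> U \<and> open (\<phi> ` U)" using chart_inj_on chart_open_image by auto
  show "\<forall>c\<in>X. \<forall>d\<in>X. open (snd c ` (fst c \<inter> fst d)) \<and> transition c d holomorphic_on snd c ` (fst c \<inter> fst d)"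
    using transition_X_holomorphic chart_restrict chart_open_image by (metis prod.collapse)
  have "\<exists>w. w\<^sup>2 = poly P 0" by (rule exI[of _ "csqrt (poly P 0)"]) simp
  then show "topspace T \<noteq> {}" unfolding topspace_X using in_affine_points(1) by blast
qed (rule Hausdorff_X connected_X[OF assms])+

end

section \<open>One-forms on the curve\<close>

definition cubic :: "(nat \<Rightarrow> complex) \<Rightarrow> complex \<Rightarrow> complex" where
  "cubic q z = (\<Sum>i\<le>3. q i * z ^ i)"

text \<open>The numerator as seen from infinity: u^3 Q(1/u), written as a polynomial so that it has
  a value at u = 0.\<close>

definition cubic_rev :: "(nat \<Rightarrow> complex) \<Rightarrow> complex \<Rightarrow> complex" where
  "cubic_rev q u = (\<Sum>i\<le>3. q i * u ^ (3 - i))"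

lemma cubic_4: "cubic q z = q 0 + q 1 * z + q 2 * z\<^sup>2 + q 3 * z ^ 3"
  and cubic_rev_4: "cubic_rev q z = q 0 * z ^ 3 + q 1 * z\<^sup>2 + q 2 * z + q 3"
proof -
  have "{..3::nat} = {0, 1, 2, 3}" by auto
  then show "cubic q z = q 0 + q 1 * z + q 2 * z\<^sup>2 + q 3 * z ^ 3"
    "cubic_rev q z = q 0 * z ^ 3 + q 1 * z\<^sup>2 + q 2 * z + q 3" by (simp_all add: cubic_def cubic_rev_def)
qed

lemma cubic_inverse: "u \<noteq> 0 \<Longrightarrow> u ^ 3 * cubic q (1 / u) = cubic_rev q u"
  unfolding cubic_def cubic_rev_def sum_distrib_left
  by (intro sum.cong refl) (simp add: power_diff power_one_over field_simps)

lemma cubic_holomorphic [holomorphic_intros]: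
  "h holomorphic_on S \<Longrightarrow> (\<lambda>z. cubic q (h z)) holomorphic_on S"
  unfolding cubic_def by (intro holomorphic_intros)

lemma cubic_rev_holomorphic [holomorphic_intros]:
  "h holomorphic_on S \<Longrightarrow> (\<lambda>z. cubic_rev q (h z)) holomorphic_on S"
  unfolding cubic_rev_def by (intro holomorphic_intros)

lemma square_eq_csqrt: "w\<^sup>2 = c \<longleftrightarrow> w = csqrt c \<or> w = - csqrt c"
  by (metis power2_csqrt power2_eq_iff)

lemma poly_holomorphic [holomorphic_intros]:
  "h holomorphic_on S \<Longrightarrow> (\<lambda>z. poly p (h z :: complex)) holomorphic_on S"
  using holomorphic_on_compose_gen[of h S "poly p" UNIV] by (auto simp: o_def intro: holomorphic_intros)

section \<open>Coefficients of the forms in the three kinds of charts\<close>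

locale connected_sextic = sextic +
  assumes conn: "connected {q :: complex \<times> complex. (snd q)\<^sup>2 = poly P (fst q)}"
    and six_roots: "card {z. poly P z = 0} = 6"
begin

sublocale riemann "hyperelliptic P"
  by unfold_locales (rule riemann_surface_X[OF conn])

abbreviation E :: "hpoint set" where "E \<equiv> points_over_zero P \<union> points_over_infinity P"

lemma E_iff: "p \<in> affine_points P \<Longrightarrow> p \<in> E \<longleftrightarrow> zc p = 0" "p \<in> infpts \<Longrightarrow> p \<in> E \<longleftrightarrow> uc p = 0"
  by (cases p; auto simp: points_over_zero_def points_over_infinity_def)+

lemma finite_E: "finite E"
proof -
  have f: "finite {w. w\<^sup>2 = c}" for c :: complex
  proof (rule finite_subset)
    show "{w. w\<^sup>2 = c} \<subseteq> {csqrt c, - csqrt c}" by (auto simp: square_eq_csqrt)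
  qed simp
  have "points_over_zero P = Affine 0 ` {w. w\<^sup>2 = poly P 0}" "points_over_infinity P = At_infinity ` {w. w\<^sup>2 = lead_coeff P}"
    by (auto simp: points_over_zero_def points_over_infinity_def)
  with f show ?thesis by simp
qed

text \<open>\<open>\<alpha> = 1\<close> with zero cubic is dz/z; \<open>\<alpha> = 0\<close> covers
  the other two forms, and also dz/w and z dz/w with the cubics z and z^2. The formula is asked only
  off z = 0, the branch points and infinity, because \<open>form_of\<close> disregards isolated
  points.\<close>

definition has_density :: "complex \<Rightarrow> (nat \<Rightarrow> complex) \<Rightarrow> (hpoint \<Rightarrow> complex) \<Rightarrow> bool" where
  "has_density \<alpha> q f \<longleftrightarrow>
     (\<forall>z w. z \<noteq> 0 \<longrightarrow> w \<noteq> 0 \<longrightarrow> w\<^sup>2 = poly P z \<longrightarrow> f (Affine z w) = \<alpha> / z + cubic q z / (z * w))"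

definition raw :: "(hpoint \<Rightarrow> complex) \<Rightarrow> hpoint chart \<Rightarrow> complex \<Rightarrow> complex" where
  "raw f c t = f (inv_into (fst c) (snd c) t) * deriv (zc \<circ> inv_into (fst c) (snd c)) t"

lemma form_of_raw: "form_of f zc c = remove_sings (raw f c)"
  by (simp add: form_of_def raw_def [abs_def])

lemma raw_z:
  assumes f: "has_density \<alpha> q f"
    and z: "open G" "U = aff.cut G" "inj_on zc U" "\<forall>p\<in>U. wc p \<noteq> 0" and t: "t \<in> zc ` U" "t \<noteq> 0"
  shows "raw f (U, zc) t = (\<alpha> + cubic q t / wc (inv_into U zc t)) / t"
proof -
  note zf = z_chart_facts[OF z]
  let ?p = "inv_into U zc t"
  have p: "?p \<in> U" using t inv_into_into by metis
  have pa: "?p \<in> affine_points P" using p z(2) aff_cut_subset by blast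
  have "(zc \<circ> inv_into U zc has_field_derivative 1) (at t)"
    by (rule has_field_derivative_transform_within_open[OF DERIV_ident zf(1) t(1)]) (simp add: zf)
  then have "deriv (zc \<circ> inv_into U zc) t = 1" by (rule DERIV_imp_deriv)
  moreover have "?p = Affine t (wc ?p)" using aff.mk_xy[OF pa] zf(3)[OF t(1)] by metis
  moreover have "(wc ?p)\<^sup>2 = poly P t" using aff.y_square[OF pa] zf(3)[OF t(1)] by metis
  then have "f (Affine t (wc ?p)) = \<alpha> / t + cubic q t / (t * wc ?p)"
    using f t(2) bspec[OF z(4) p] unfolding has_density_def by blast
  ultimately have "raw f (U, zc) t = \<alpha> / t + cubic q t / (t * wc ?p)" by (simp add: raw_def)
  also have "\<dots> = (\<alpha> + cubic q t / wc ?p) / t" by (simp add: add_divide_distrib mult.commute)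
  finally show ?thesis .
qed

text \<open>Differentiate w^2 = P(z) with w as the variable.\<close>

lemma w_chart_derivative:
  assumes w: "open G" "U = aff.cut G" "inj_on wc U" "\<forall>p\<in>U. poly (pderiv P) (zc p) \<noteq> 0" and t: "t \<in> wc ` U"
  shows "deriv (zc \<circ> inv_into U wc) t = 2 * t / poly (pderiv P) (zc (inv_into U wc t))"
proof -
  note wf = w_chart_facts[OF w]
  let ?z = "\<lambda>t. zc (inv_into U wc t)"
  have iU: "inv_into U wc s \<in> U" if "s \<in> wc ` U" for s using that inv_into_into by metis
  have d: "(?z has_field_derivative deriv ?z t) (at t)"
    using wf(2,1) t by (rule holomorphic_derivI)
  have "((\<lambda>s. poly P (?z s)) has_field_derivative poly (pderiv P) (?z t) * deriv ?z t) (at t)"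
    by (rule DERIV_chain2[OF poly_DERIV d])
  then have "((\<lambda>s. s\<^sup>2) has_field_derivative poly (pderiv P) (?z t) * deriv ?z t) (at t)"
    by (rule has_field_derivative_transform_within_open[OF _ wf(1) t])
      (metis iU aff.y_square aff_cut_subset w(2) wf(3) subsetD)
  moreover have "((\<lambda>s. s\<^sup>2) has_field_derivative 2 * t) (at t)"
    by (auto intro!: derivative_eq_intros)
  ultimately have "poly (pderiv P) (?z t) * deriv ?z t = 2 * t" by (rule DERIV_unique)
  moreover have "poly (pderiv P) (?z t) \<noteq> 0" using w(4) iU[OF t] by blast
  ultimately show ?thesis by (simp add: o_def field_simps)
qed

text \<open>The factor w in dz = 2 w dw / P'(z) cancels the w of the denominator; therefore the
  coefficient stays regular at a branch point.\<close>

lemma raw_w: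
  assumes f: "has_density \<alpha> q f"
    and w: "open G" "U = aff.cut G" "inj_on wc U" "\<forall>p\<in>U. poly (pderiv P) (zc p) \<noteq> 0"
    and t: "t \<in> wc ` U" "t \<noteq> 0" and nz: "zc (inv_into U wc t) \<noteq> 0"
  shows "raw f (U, wc) t = (2 * \<alpha> * t + 2 * cubic q (zc (inv_into U wc t))) /
     (zc (inv_into U wc t) * poly (pderiv P) (zc (inv_into U wc t)))"
proof -
  note wf = w_chart_facts[OF w]
  let ?p = "inv_into U wc t"
  have p: "?p \<in> U" using t inv_into_into by metis
  have pa: "?p \<in> affine_points P" using p w(2) aff_cut_subset by blast
  have "?p = Affine (zc ?p) t" using aff.mk_xy[OF pa] wf(3)[OF t(1)] by metis
  moreover have "t\<^sup>2 = poly P (zc ?p)" using aff.y_square[OF pa] wf(3)[OF t(1)] by metis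
  then have "f (Affine (zc ?p) t) = \<alpha> / zc ?p + cubic q (zc ?p) / (zc ?p * t)"
    using f t(2) nz unfolding has_density_def by blast
  ultimately have fp: "f ?p = \<alpha> / zc ?p + cubic q (zc ?p) / (zc ?p * t)" by metis
  then have "raw f (U, wc) t = (\<alpha> / zc ?p + cubic q (zc ?p) / (zc ?p * t)) * (2 * t / poly (pderiv P) (zc ?p))"
    unfolding raw_def fst_conv snd_conv w_chart_derivative[OF w t(1)] by simp
  also have "\<dots> = (2 * \<alpha> * t + 2 * cubic q (zc ?p)) / (zc ?p * poly (pderiv P) (zc ?p))"
    using t(2) nz bspec[OF w(4) p] by (simp add: divide_simps)
  finally show ?thesis .
qed

lemma u_chart_inverse:
  assumes u: "open G" "U = inf.cut G" "inj_on uc U" "\<forall>p\<in>U. vc 3 p \<noteq> 0" and t: "t \<in> uc ` U"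
  shows "inv_into U uc t = upoint t (vc 3 (inv_into U uc t))"
    "zc (inv_into U uc t) = 1 / t"
proof -
  let ?p = "inv_into U uc t"
  have p: "?p \<in> U" using t inv_into_into by metis
  show *: "?p = upoint t (vc 3 ?p)"
    using inf.mk_xy[of ?p] p u(2) u_chart_facts(3)[OF u t] inf_cut_subset by (metis subsetD)
  have "zc (upoint t v) = 1 / t" for v by (simp add: upoint_def)
  then show "zc ?p = 1 / t" using * by metis
qed

text \<open>With z = 1/u and w = v/u^3 both dz/z and Q dz/(z w) acquire a minus sign, which later
  distinguishes top ends from bottom ends.\<close>

lemma raw_u:
  assumes f: "has_density \<alpha> q f"
    and u: "open G" "U = inf.cut G" "inj_on uc U" "\<forall>p\<in>U. vc 3 p \<noteq> 0" and t: "t \<in> uc ` U" "t \<noteq> 0"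
  shows "raw f (U, uc) t = - (\<alpha> + cubic_rev q t / vc 3 (inv_into U uc t)) / t"
proof -
  note uf = u_chart_facts[OF u]
  let ?p = "inv_into U uc t"
  have p: "?p \<in> U" using t inv_into_into by metis
  then have pi: "?p \<in> infpts" using u(2) inf_cut_subset by auto
  have "((\<lambda>t. 1 / t) has_field_derivative - 1 / t\<^sup>2) (at t)"
    using t(2) by (auto intro!: derivative_eq_intros simp: power2_eq_square)
  then have "(zc \<circ> inv_into U uc has_field_derivative - 1 / t\<^sup>2) (at t)"
    by (rule has_field_derivative_transform_within_open[OF _ uf(1) t(1)]) (simp add: u_chart_inverse(2)[OF u])
  then have d: "deriv (zc \<circ> inv_into U uc) t = - 1 / t\<^sup>2" by (rule DERIV_imp_deriv)
  let ?w = "vc 3 ?p / t ^ 3"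
  have pe: "?p = Affine (1 / t) ?w"
    using u_chart_inverse(1)[OF u t(1)] t(2) by (simp add: upoint_def)
  have "?w\<^sup>2 = poly P (1 / t)" using pi pe in_infpts(1) by metis
  moreover have "1 / t \<noteq> 0" "?w \<noteq> 0" using t(2) bspec[OF u(4) p] by auto
  ultimately have "f (Affine (1 / t) ?w) = \<alpha> / (1 / t) + cubic q (1 / t) / (1 / t * ?w)"
    using f unfolding has_density_def by blast
  then have "f ?p = \<alpha> / (1 / t) + cubic q (1 / t) / (1 / t * ?w)" using pe by metis
  also have "\<dots> = t * (\<alpha> + t ^ 3 * cubic q (1 / t) / vc 3 ?p)"
    using t(2) by (simp add: field_simps)
  finally have "f ?p = t * (\<alpha> + cubic_rev q t / vc 3 ?p)" using cubic_inverse[OF t(2)] by simp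
  then show ?thesis unfolding raw_def fst_conv snd_conv d using t(2) by (simp add: power2_eq_square diff_divide_distrib add_divide_distrib)
qed

lemma eventually_not_in_finite: "finite S \<Longrightarrow> eventually (\<lambda>s. s \<notin> S) (at (t::complex))"
  using finite_imp_closed[of "S - {t}"] by (auto simp: eventually_at_topological intro!: exI[of _ "- (S - {t})"])

text \<open>A quotient of holomorphic functions whose denominator vanishes only at the ends treats
  all charts at once: it yields meromorphy everywhere and analyticity off \<open>E\<close>. Equality
  is claimed near each point and not at it, since the raw coefficient may be wrong where z, w or u
  is 0.\<close>

lemma raw_repr:
  assumes f: "has_density \<alpha> q f" and c: "c \<in> X"
  obtains N D where "N holomorphic_on snd c ` fst c" "D holomorphic_on snd c ` fst c"
    "\<And>p. p \<in> fst c \<Longrightarrow> D (snd c p) = 0 \<longleftrightarrow> p \<in> E"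
    "\<And>t. t \<in> snd c ` fst c \<Longrightarrow> eventually (\<lambda>s. raw f c s = N s / D s) (at t)"
    "\<And>t. t \<in> snd c ` fst c \<Longrightarrow> eventually (\<lambda>s. (zc \<circ> inv_into (fst c) (snd c)) field_differentiable at s) (at t)"
proof -
  obtain U \<phi> where e: "c = (U, \<phi>)" by fastforce
  have op: "eventually (\<lambda>s. s \<in> \<phi> ` U) (at t)" if "t \<in> \<phi> ` U" for t
    using chart_open[OF c] that by (simp add: e eventually_at_in_open')
  have ne: "eventually (\<lambda>s. s \<noteq> 0) (at t)" for t :: complex
    using eventually_not_in_finite[of "{0}" t] by simp
  from c show thesis unfolding e
  proof (cases rule: X_cases)
    case (z G)
    note zf = z_chart_facts[OF z(1,2,4,5)]
    have nz: "wc (inv_into U zc t) \<noteq> 0" if "t \<in> zc ` U" for t using that z(5) inv_into_into by metis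
    show thesis
    proof (rule that[of "\<lambda>t. \<alpha> + cubic q t / wc (inv_into U zc t)" "\<lambda>t. t"], unfold e z(3) fst_conv snd_conv)
      show "(\<lambda>t. \<alpha> + cubic q t / wc (inv_into U zc t)) holomorphic_on zc ` U"
        using nz zf by (intro holomorphic_intros) auto
      show "zc p = 0 \<longleftrightarrow> p \<in> E" if "p \<in> U" for p using that E_iff aff_cut_subset z(2) by blast
      show "eventually (\<lambda>s. raw f (U, zc) s = (\<alpha> + cubic q s / wc (inv_into U zc s)) / s) (at t)" if "t \<in> zc ` U" for t
        using op[unfolded z(3), OF that] ne by eventually_elim (rule raw_z[OF f z(1,2,4,5)])
      show "eventually (\<lambda>s. (zc \<circ> inv_into U zc) field_differentiable at s) (at t)" if "t \<in> zc ` U" for t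
        using op[unfolded z(3), OF that]
        by eventually_elim (use zf(1,4) in \<open>auto simp: o_def intro: holomorphic_on_imp_differentiable_at\<close>)
    qed (intro holomorphic_intros)
  next
    case (w G)
    note wf = w_chart_facts[OF w(1,2,4,5)]
    let ?z = "\<lambda>t. zc (inv_into U wc t)"
    have iU: "inv_into U wc t \<in> U" if "t \<in> wc ` U" for t using that inv_into_into by metis
    \<comment> \<open>In a w-chart z = 0 only if w is one of the two square roots of P(0), hence
      only at isolated values of the coordinate.\<close>
    have nz: "eventually (\<lambda>s. ?z s \<noteq> 0) (at t)" if "t \<in> wc ` U" for t
    proof -
      have "eventually (\<lambda>s. s \<notin> {csqrt (poly P 0), - csqrt (poly P 0)}) (at t)"
        by (rule eventually_not_in_finite) simp
      with op[unfolded w(3), OF that] show ?thesis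
      proof eventually_elim
        case (elim s)
        have "s\<^sup>2 = poly P (?z s)"
          using aff.y_square iU[OF elim(1)] w(2) aff_cut_subset wf(3)[OF elim(1)] by (metis subsetD)
        with elim(2) show ?case using square_eq_csqrt[of s "poly P 0"] by auto
      qed
    qed
    show thesis
    proof (rule that[of "\<lambda>t. 2 * \<alpha> * t + 2 * cubic q (?z t)" "\<lambda>t. ?z t * poly (pderiv P) (?z t)"], unfold e w(3) fst_conv snd_conv)
      show "?z (wc p) * poly (pderiv P) (?z (wc p)) = 0 \<longleftrightarrow> p \<in> E" if "p \<in> U" for p
        using that E_iff(1)[of p] aff_cut_subset w(2) bspec[OF w(5) that] w(4) by auto
      show "eventually (\<lambda>s. raw f (U, wc) s = (2 * \<alpha> * s + 2 * cubic q (?z s)) / (?z s * poly (pderiv P) (?z s))) (at t)"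
        if "t \<in> wc ` U" for t
        using op[unfolded w(3), OF that] ne nz[OF that] by eventually_elim (rule raw_w[OF f w(1,2,4,5)])
      show "eventually (\<lambda>s. (zc \<circ> inv_into U wc) field_differentiable at s) (at t)" if "t \<in> wc ` U" for t
        using op[unfolded w(3), OF that]
        by eventually_elim (use wf(1,2) in \<open>auto simp: o_def intro: holomorphic_on_imp_differentiable_at\<close>)
    qed (intro holomorphic_intros wf)+
  next
    case (u G)
    note uf = u_chart_facts[OF u(1,2,4,5)]
    have nz: "vc 3 (inv_into U uc t) \<noteq> 0" if "t \<in> uc ` U" for t using that u(5) inv_into_into by metis
    show thesis
    proof (rule that[of "\<lambda>t. - (\<alpha> + cubic_rev q t / vc 3 (inv_into U uc t))" "\<lambda>t. t"], unfold e u(3) fst_conv snd_conv)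
      show "(\<lambda>t. - (\<alpha> + cubic_rev q t / vc 3 (inv_into U uc t))) holomorphic_on uc ` U"
        using nz uf by (intro holomorphic_intros) auto
      show "uc p = 0 \<longleftrightarrow> p \<in> E" if "p \<in> U" for p using that E_iff inf_cut_subset u(2) by blast
      show "eventually (\<lambda>s. raw f (U, uc) s = - (\<alpha> + cubic_rev q s / vc 3 (inv_into U uc s)) / s) (at t)" if "t \<in> uc ` U" for t
        using op[unfolded u(3), OF that] ne by eventually_elim (rule raw_u[OF f u(1,2,4,5)])
      show "eventually (\<lambda>s. (zc \<circ> inv_into U uc) field_differentiable at s) (at t)" if "t \<in> uc ` U" for t
        using op[unfolded u(3), OF that] ne
      proof eventually_elim
        case (elim s)
        have "((\<lambda>t. 1 / t) has_field_derivative - 1 / s\<^sup>2) (at s)"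
          using elim(2) by (auto intro!: derivative_eq_intros simp: power2_eq_square)
        then have "(zc \<circ> inv_into U uc has_field_derivative - 1 / s\<^sup>2) (at s)"
          by (rule has_field_derivative_transform_within_open[OF _ uf(1) elim(1)]) (simp add: u_chart_inverse(2)[OF u(1,2,4,5)])
        then show ?case by (auto simp: field_differentiable_def)
      qed
    qed (intro holomorphic_intros)
  qed
qed

lemma form_value:
  assumes ev: "eventually (\<lambda>s. raw f c s = g s) (at t)" and g: "g analytic_on {t}"
  shows "form_of f zc c t = g t"
  unfolding form_of_raw using remove_sings_cong[OF ev refl] g by simp

lemma form_analytic:
  assumes f: "has_density \<alpha> q f" and c: "c \<in> X" and p: "p \<in> fst c" "p \<notin> E"
  shows "form_of f zc c analytic_on {snd c p}"
proof -
  obtain N D where ND: "N holomorphic_on snd c ` fst c" "D holomorphic_on snd c ` fst c"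
    "\<And>p. p \<in> fst c \<Longrightarrow> D (snd c p) = 0 \<longleftrightarrow> p \<in> E"
    "\<And>t. t \<in> snd c ` fst c \<Longrightarrow> eventually (\<lambda>s. raw f c s = N s / D s) (at t)"
    by (rule raw_repr[OF f c]) blast
  let ?t = "snd c p"
  have t: "?t \<in> snd c ` fst c" using p by blast
  have D0: "D ?t \<noteq> 0" using ND(3) p by blast
  have "N analytic_on {?t}" "D analytic_on {?t}"
    using ND(1,2) chart_open[OF c] t by (auto simp: analytic_at)
  then have an: "(\<lambda>s. N s / D s) analytic_on {?t}" using D0 by (intro analytic_intros) auto
  then have "remove_sings (\<lambda>s. N s / D s) analytic_on {?t}" by (rule remove_sings_analytic_on)
  moreover have "eventually (\<lambda>t. raw f c t = N t / D t) (at s)" if "s \<in> snd c ` fst c" for s using ND(4) that by blast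
  then have "eventually (\<lambda>s. form_of f zc c s = remove_sings (\<lambda>s. N s / D s) s) (nhds ?t)"
    using eventually_nhds_in_open[OF chart_open[OF c] t]
    by (auto elim!: eventually_mono simp: form_of_raw intro: remove_sings_cong)
  ultimately show ?thesis using analytic_at_cong by blast
qed

lemma form_holomorphic_on:
  assumes f: "has_density \<alpha> q f"
  shows "holomorphic_form_on X (form_of f zc) (topspace T - E)"
  unfolding holomorphic_form_on_def
proof safe
  fix U \<phi> assume c: "(U, \<phi>) \<in> X"
  have "form_of f zc (U, \<phi>) analytic_on \<phi> ` (U \<inter> (topspace T - E))"
    using form_analytic[OF f c] by (subst analytic_on_analytic_at) auto
  then show "form_of f zc (U, \<phi>) holomorphic_on \<phi> ` (U \<inter> (topspace T - E))"
    by (rule analytic_imp_holomorphic)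
qed

lemma raw_meromorphic:
  assumes f: "has_density \<alpha> q f" and c: "c \<in> X"
  shows "raw f c meromorphic_on snd c ` fst c"
proof -
  obtain N D where ND: "N holomorphic_on snd c ` fst c" "D holomorphic_on snd c ` fst c"
    "\<And>t. t \<in> snd c ` fst c \<Longrightarrow> eventually (\<lambda>s. raw f c s = N s / D s) (at t)"
    by (rule raw_repr[OF f c]) blast
  have "N analytic_on snd c ` fst c" "D analytic_on snd c ` fst c"
    using ND(1,2) chart_open[OF c] by (auto simp: analytic_on_open)
  then have "(\<lambda>s. N s / D s) meromorphic_on snd c ` fst c"
    by (intro meromorphic_intros analytic_on_imp_meromorphic_on)
  then show ?thesis using meromorphic_on_cong[OF ND(3) refl] by blast
qed

lemma form_meromorphic:
  assumes f: "has_density \<alpha> q f"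
  shows "meromorphic_form X (form_of f zc)"
  unfolding meromorphic_form_def
proof
  show "compatible_form X (form_of f zc)"
  proof (rule compatible_form_of)
    fix c t assume c: "c \<in> X" and t: "t \<in> snd c ` fst c"
    show "eventually (\<lambda>s. (zc \<circ> inv_into (fst c) (snd c)) field_differentiable at s) (at t)"
      by (rule raw_repr[OF f c]) (use t in blast)
    have "raw f c meromorphic_on {t}" by (rule meromorphic_on_subset[OF raw_meromorphic[OF f c]]) (use t in blast)
    then show "not_essential (\<lambda>t. f (inv_into (fst c) (snd c) t) * deriv (zc \<circ> inv_into (fst c) (snd c)) t) t"
      using meromorphic_on_not_essential by (simp add: raw_def [abs_def])
  qed
  show "\<forall>(U, \<phi>)\<in>X. form_of f zc (U, \<phi>) nicely_meromorphic_on \<phi> ` U"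
    using remove_sings_nicely_meromorphic raw_meromorphic[OF f] by (auto simp: form_of_raw)
qed

end

section \<open>Scherk ends\<close>

text \<open>The value of \<open>f\<close> at 0 is left open, and \<open>\<rho> = 0\<close> is
  allowed; then \<open>f\<close> has the limit \<open>g 0\<close>. The same statement thus serves
  the components with a pole and those without.\<close>

lemma simple_pole_facts:
  fixes f g :: "complex \<Rightarrow> complex"
  assumes \<delta>: "\<delta> > 0" and g: "g holomorphic_on ball 0 \<delta>"
    and f: "\<And>t. t \<in> ball 0 \<delta> - {0} \<Longrightarrow> f t = \<rho> / t + g t"
  shows "residue f 0 = \<rho>" and "is_pole f 0 \<longleftrightarrow> \<rho> \<noteq> 0" and "\<rho> \<noteq> 0 \<Longrightarrow> zorder f 0 = - 1"
proof -
  define F where "F t = \<rho> + t * g t" for t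
  have F: "F holomorphic_on ball 0 \<delta>" unfolding F_def using g by (intro holomorphic_intros)
  have F0: "F 0 = \<rho>" by (simp add: F_def)
  have fF: "f t = F t / t" if "t \<in> ball 0 \<delta> - {0}" for t
    using that by (simp add: f F_def add_divide_distrib)
  have ev: "eventually (\<lambda>t. t \<in> ball 0 \<delta> - {0}) (at 0)"
    using \<delta> by (intro eventually_at_in_open) auto
  have evf: "eventually (\<lambda>t. f t = F t / (t - 0)) (at 0)"
    using ev by eventually_elim (use fF in auto)
  show "residue f 0 = \<rho>"
    using residue_cong[OF evf refl] residue_simple[OF _ _ F, of 0] \<delta> by (simp add: F_def)
  have pole: "is_pole f 0" if "\<rho> \<noteq> 0"
  proof -
    have "isCont F 0"
      using F \<delta> by (intro analytic_at_imp_isCont) (auto simp: analytic_at intro!: exI[of _ "ball 0 \<delta>"])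
    moreover have "filterlim (\<lambda>t :: complex. t) (at 0) (at 0)" by (rule filterlim_ident)
    ultimately have "is_pole (\<lambda>t. F t / t) 0"
      using that by (intro is_pole_divide) (simp_all add: F0)
    moreover have "eventually (\<lambda>t. f t = F t / t) (at 0)" using evf by simp
    ultimately show ?thesis using is_pole_cong[of f "\<lambda>t. F t / t" 0 0] by auto
  qed
  have "\<not> is_pole f 0" if "\<rho> = 0"
  proof -
    have "g analytic_on {0}" using g \<delta> by (auto simp: analytic_at intro!: exI[of _ "ball 0 \<delta>"])
    then have "g \<midarrow>0\<rightarrow> g 0" using analytic_at_imp_isCont isContD by blast
    moreover have "eventually (\<lambda>t. f t = g t) (at 0)"
      using ev by eventually_elim (use f that in auto)
    ultimately have "f \<midarrow>0\<rightarrow> g 0" using tendsto_cong by fastforce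
    then show ?thesis unfolding is_pole_def using not_tendsto_and_filterlim_at_infinity[OF at_neq_bot] by blast
  qed
  with pole show "is_pole f 0 \<longleftrightarrow> \<rho> \<noteq> 0" by blast
  show "zorder f 0 = - 1" if "\<rho> \<noteq> 0"
    by (rule zorder_eqI[of "ball 0 \<delta>" 0 F])
      (use \<delta> F fF that in \<open>auto simp: F_def power_int_minus divide_inverse\<close>)
qed

context riemann
begin

text \<open>Direction \<open>i\<close> carries the period, \<open>k\<close> has no residue, and the
  third residue is \<open>- \<sigma>\<close>. So coordinate \<open>k\<close> has a limit at the end,
  the third coordinate is \<open>- \<sigma>\<close> times ln |t| up to a constant, and coordinate
  \<open>i\<close> is absorbed by the half-plane, which extends along \<open>i\<close> in both
  senses.\<close>

lemma scherk_endI: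
  fixes \<omega> :: "3 \<Rightarrow> 'a form" and \<rho> :: "3 \<Rightarrow> complex" and i k :: 3
  assumes c: "(U, \<phi>) \<in> A" "p \<in> U" "\<phi> p = 0" and \<delta>: "\<delta> > 0" "ball 0 \<delta> \<subseteq> \<phi> ` U"
    and S: "U \<inter> \<phi> -` ball 0 \<delta> - {p} \<subseteq> S"
    and comp: "\<And>j. compatible_form A (\<omega> j)" and hol: "\<And>j. holomorphic_form_on A (\<omega> j) S"
    and \<omega>: "\<And>j t. t \<in> ball 0 \<delta> - {0} \<Longrightarrow> \<omega> j (U, \<phi>) t = \<rho> j / t + g j t"
    and g: "\<And>j. g j holomorphic_on ball 0 \<delta>"
    and \<sigma>: "\<sigma> = 1 \<or> \<sigma> = -1" and 3: "\<rho> 3 = - of_real \<sigma>" "\<And>t. g 3 t = 0"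
    and ik: "\<And>j. j = i \<or> j = k \<or> j = 3" "i \<noteq> k" "i \<noteq> 3" "k \<noteq> 3"
    and i: "Im (\<rho> i) \<noteq> 0" and k: "\<rho> k = 0"
  shows "scherk_end A \<omega> \<sigma> (\<chi> j. Re (2 * of_real pi * \<i> * \<rho> j)) p"
proof -
  define T :: "real^3" where "T = (\<chi> j. Re (2 * of_real pi * \<i> * \<rho> j))"
  have T: "T $ i \<noteq> 0" "T $ k = 0" "T $ 3 = 0"
    using i k 3(1) by (simp_all add: T_def)
  define N where "N = U \<inter> \<phi> -` ball 0 \<delta>"
  define \<psi> where "\<psi> = inv_into U \<phi>"
  have inj: "inj_on \<phi> U" using chart_inj[OF c(1)] by simp
  have \<psi>: "\<psi> t \<in> U" "\<phi> (\<psi> t) = t" if "t \<in> ball 0 \<delta>" for t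
    using that \<delta>(2) by (auto simp: \<psi>_def f_inv_into_f inv_into_into subset_iff)
  have NE: "N - {p} = \<psi> ` (ball 0 \<delta> - {0})"
  proof
    show "N - {p} \<subseteq> \<psi> ` (ball 0 \<delta> - {0})"
    proof
      fix q assume q: "q \<in> N - {p}"
      then have "\<phi> q \<noteq> 0" using inj c(2,3) by (metis DiffE IntE N_def inj_on_eq_iff singletonI)
      moreover have "q = \<psi> (\<phi> q)" using q inj by (simp add: N_def \<psi>_def)
      ultimately show "q \<in> \<psi> ` (ball 0 \<delta> - {0})" using q by (auto simp: N_def)
    qed
    show "\<psi> ` (ball 0 \<delta> - {0}) \<subseteq> N - {p}"
    proof (rule image_subsetI)
      fix t :: complex assume "t \<in> ball 0 \<delta> - {0}"
      then have t: "t \<in> ball 0 \<delta>" "t \<noteq> 0" by auto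
      then have "\<psi> t \<noteq> p" using \<psi>(2)[OF t(1)] c(3) by metis
      then show "\<psi> t \<in> N - {p}" using \<psi>[OF t(1)] t by (simp add: N_def)
    qed
  qed
  have N: "openin (surface_topology A) N" "p \<in> N"
    unfolding N_def using openin_chart[OF c(1) open_ball] c \<delta>(1) by auto
  have conn: "connectedin (surface_topology A) (N - {p})"
    unfolding NE
  proof (rule connectedin_continuous_map_image)
    show "continuous_map (top_of_set (\<phi> ` U)) (surface_topology A) \<psi>"
      using continuous_map_inverse_chart[OF c(1)] by (simp add: \<psi>_def)
    have "connected (ball (0::complex) \<delta> - {0})"
      by (rule connected_punctured_ball) simp
    then show "connectedin (top_of_set (\<phi> ` U)) (ball 0 \<delta> - {0})"
      using \<delta>(2) by (auto simp: connectedin_subtopology)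
  qed
  define t0 :: complex where "t0 = of_real (\<delta> / 2)"
  have t0: "t0 \<in> ball 0 \<delta> - {0}" using \<delta>(1) by (auto simp: t0_def)
  define p0 where "p0 = \<psi> t0"
  have p0: "p0 \<in> N - {p}" "\<phi> p0 = t0" using t0 NE \<psi> by (auto simp: p0_def)
  obtain G where G: "\<And>t. t \<in> ball 0 \<delta> \<Longrightarrow> (G has_field_derivative g k t) (at t)"
    using holomorphic_convex_primitive'[OF convex_ball open_ball g[of k]] at_within_open[OF _ open_ball] by metis
  \<comment> \<open>The limit of coordinate \<open>k\<close> for curves that start at
    \<open>t0\<close>; \<open>G\<close> is single-valued on the whole disc because
    \<open>\<rho> k = 0\<close>.\<close>
  define q :: "real^3" where "q = axis k (Re (G 0 - G t0))"
  have curve: "Re (I k) = Re (G (\<phi> (\<gamma> 1)) - G t0) \<and> \<sigma> * Re (I 3) = ln (norm t0) - ln (norm (\<phi> (\<gamma> 1)))"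
    if \<gamma>: "\<gamma> ` {0..1} \<subseteq> N - {p}" "\<gamma> 0 = p0" and I: "\<And>j. has_form_integral A (\<omega> j) \<gamma> (I j)" for \<gamma> I
  proof
    have chart: "\<phi> r \<in> ball 0 \<delta> - {0}" if r: "r \<in> N - {p}" for r
    proof -
      have "\<phi> r \<noteq> 0" using r inj c(2,3) by (metis DiffE IntE N_def inj_on_eq_iff singletonI)
      then show ?thesis using r by (simp add: N_def)
    qed
    have "\<gamma> 1 \<in> N - {p}" using \<gamma>(1) by (auto simp: image_subset_iff)
    then have t1: "\<phi> (\<gamma> 1) \<in> ball 0 \<delta> - {0}" by (rule chart)
    have op: "open (ball (0::complex) \<delta> - {0})" by (intro open_Diff) auto
    \<comment> \<open>With a real exponent the exponential is injective on real parts, so the curve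
      lemma gives the integral itself and not merely its class modulo a period.\<close>
    have "exp (of_real (Re (G (\<phi> (\<gamma> 1))))) = exp (of_real (Re (G (\<phi> (\<gamma> 0))))) * exp (1 * complex_of_real (Re (I k)))"
    proof (rule exp_primitive_along_curve[where \<alpha> = 1 and \<Phi> = "\<lambda>r. exp (of_real (Re (G (\<phi> r))))", OF comp _ \<gamma>(1) I])
      fix r assume r: "r \<in> N - {p}"
      have "exp_primitive_at (\<omega> k) 1 (\<lambda>r. exp (of_real (Re (G (\<phi> r))))) (U, \<phi>) r"
        unfolding exp_primitive_at_def
      proof (intro exI conjI ballI impI)
        show "open (ball (0::complex) \<delta> - {0})" by (rule op)
        show "snd (U, \<phi>) r \<in> ball 0 \<delta> - {0}" using chart[OF r] by simp
        show "ball 0 \<delta> - {0} \<subseteq> snd (U, \<phi>) ` fst (U, \<phi>)" using \<delta>(2) by auto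
        show "(G has_field_derivative \<omega> k (U, \<phi>) t) (at t)" if "t \<in> ball 0 \<delta> - {0}" for t
          using G[of t] \<omega>[OF that, of k] that k by simp
        show "exp (of_real (Re (G (\<phi> r')))) = 1 * exp (1 * complex_of_real (Re (G (snd (U, \<phi>) r'))))" for r'
          by simp
      qed
      then show "\<exists>c\<in>A. r \<in> fst c \<and> exp_primitive_at (\<omega> k) 1 (\<lambda>r. exp (of_real (Re (G (\<phi> r))))) c r"
        using r by (intro bexI[OF conjI c(1)]) (simp_all only: N_def fst_conv Diff_iff Int_iff)
    qed
    then have "complex_of_real (exp (Re (G (\<phi> (\<gamma> 1))))) = of_real (exp (Re (G t0) + Re (I k)))"
      using \<gamma>(2) p0(2) by (simp add: exp_of_real exp_add)
    then have "exp (Re (G (\<phi> (\<gamma> 1)))) = exp (Re (G t0) + Re (I k))" by (simp only: of_real_eq_iff)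
    then show "Re (I k) = Re (G (\<phi> (\<gamma> 1)) - G t0)" by simp
    \<comment> \<open>The logarithm of t is multivalued on the punctured disc, the modulus |t| is
      not. This computes the third coordinate.\<close>
    have "complex_of_real (norm (\<phi> (\<gamma> 1))) = of_real (norm (\<phi> (\<gamma> 0))) * exp (- of_real \<sigma> * of_real (Re (I 3)))"
    proof (rule exp_primitive_along_curve[where \<alpha> = "- of_real \<sigma>" and \<Phi> = "\<lambda>r. of_real (norm (\<phi> r))", OF comp _ \<gamma>(1) I])
      fix r assume r: "r \<in> N - {p}"
      define s where "s = \<phi> r"
      have s: "s \<in> ball 0 \<delta>" "s \<noteq> 0" using chart[OF r] by (auto simp: s_def)
      \<comment> \<open>On the ball about \<open>s\<close> of radius |s| the quotient t/s has
        positive real part, so the principal logarithm of t/s is a primitive of dt/t there.\<close>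
      define V where "V = ball 0 \<delta> \<inter> ball s (norm s)"
      have V: "t \<in> ball 0 \<delta> - {0} \<and> t / s \<notin> \<real>\<^sub>\<le>\<^sub>0" if t: "t \<in> V" for t
      proof -
        have "t / s \<in> ball 1 1"
        proof -
          have "dist 1 (t / s) = norm (s - t) / norm s"
            using s(2) by (simp add: dist_norm diff_divide_distrib flip: norm_divide)
          also have "\<dots> < 1" using t s(2) by (simp add: V_def dist_norm)
          finally show ?thesis by simp
        qed
        then have "Re (t / s) > 0"
          using abs_Re_le_cmod[of "1 - t / s"] by (simp add: dist_norm)
        then show ?thesis using t by (auto simp: V_def complex_nonpos_Reals_iff)
      qed
      have "exp_primitive_at (\<omega> 3) (- of_real \<sigma>) (\<lambda>r. of_real (norm (\<phi> r))) (U, \<phi>) r"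
        unfolding exp_primitive_at_def
      proof (intro exI conjI ballI impI)
        show "open V" by (auto simp: V_def)
        show "snd (U, \<phi>) r \<in> V" using s by (simp add: V_def s_def)
        show "V \<subseteq> snd (U, \<phi>) ` fst (U, \<phi>)" using \<delta>(2) by (auto simp: V_def)
        show "((\<lambda>t. - of_real \<sigma> * Ln (t / s)) has_field_derivative \<omega> 3 (U, \<phi>) t) (at t)" if t: "t \<in> V" for t
          using V[OF t] s(2) by (auto intro!: derivative_eq_intros simp: \<omega> 3)
        show "of_real (norm (\<phi> r')) = of_real (norm s) * exp (- complex_of_real \<sigma> * of_real (Re (- of_real \<sigma> * Ln (snd (U, \<phi>) r' / s))))"
          if "r' \<in> fst (U, \<phi>)" "snd (U, \<phi>) r' \<in> V" for r'
        proof -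
          have "\<phi> r' \<noteq> 0" using V[of "\<phi> r'"] that by simp
          then have "exp (Re (Ln (\<phi> r' / s))) = norm (\<phi> r') / norm s"
            using s(2) by (simp add: norm_divide)
          moreover have "- complex_of_real \<sigma> * of_real (Re (- of_real \<sigma> * Ln (\<phi> r' / s))) = of_real (Re (Ln (\<phi> r' / s)))"
            using \<sigma> by auto
          ultimately have e: "exp (- complex_of_real \<sigma> * of_real (Re (- of_real \<sigma> * Ln (\<phi> r' / s)))) =
              of_real (norm (\<phi> r') / norm s)"
            by (simp only: exp_of_real)
          show ?thesis unfolding snd_conv e using s(2) by simp
        qed
      qed
      then show "\<exists>c\<in>A. r \<in> fst c \<and> exp_primitive_at (\<omega> 3) (- of_real \<sigma>) (\<lambda>r. of_real (norm (\<phi> r))) c r"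
        using c(1) r by (intro bexI[of _ "(U, \<phi>)"]) (auto simp: N_def)
    qed
    also have "exp (- of_real \<sigma> * of_real (Re (I 3))) = complex_of_real (exp (- (\<sigma> * Re (I 3))))"
      by (simp add: exp_of_real [symmetric])
    also have "of_real (norm (\<phi> (\<gamma> 0))) * complex_of_real (exp (- (\<sigma> * Re (I 3)))) =
        of_real (norm t0 * exp (- (\<sigma> * Re (I 3))))"
      using \<gamma>(2) p0(2) by simp
    finally have "norm (\<phi> (\<gamma> 1)) = norm t0 * exp (- (\<sigma> * Re (I 3)))" using of_real_eq_iff by blast
    then have "ln (norm (\<phi> (\<gamma> 1))) = ln (norm t0) - \<sigma> * Re (I 3)" using t0 by (simp add: ln_mult)
    then show "\<sigma> * Re (I 3) = ln (norm t0) - ln (norm (\<phi> (\<gamma> 1)))" by simp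
  qed
  have "asymptotic_to_half_plane A \<omega> \<sigma> T p"
    unfolding asymptotic_to_half_plane_def
  proof (rule exI[of _ q], rule exI[of _ N], rule exI[of _ p0], intro conjI allI impI)
    have "holomorphic_form_on A (\<omega> j) (N - {p})" for j
      using hol[of j] S unfolding holomorphic_form_on_def N_def
      by (auto elim!: ballE holomorphic_on_subset)
    then show "holomorphic_form_on A (\<omega> 1) (N - {p})" "holomorphic_form_on A (\<omega> 2) (N - {p})"
      "holomorphic_form_on A (\<omega> 3) (N - {p})" by blast+
    fix \<epsilon> :: real assume \<epsilon>: "0 < \<epsilon>"
    have "isCont G 0" using G[of 0] \<delta>(1) DERIV_isCont by auto
    then obtain d where d: "d > 0" "\<And>t. dist t 0 < d \<Longrightarrow> dist (G t) (G 0) < \<epsilon>"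
      using \<epsilon> unfolding continuous_at_eps_delta by blast
    \<comment> \<open>\<open>d\<close> controls coordinate \<open>k\<close>; the bound |t0|
      exp(-1/\<epsilon>) makes ln |t0| - ln |t| exceed 1/\<epsilon>.\<close>
    define \<delta>' where "\<delta>' = min (min d \<delta>) (norm t0 * exp (- (1 / \<epsilon>)))"
    have \<delta>': "\<delta>' > 0" using d(1) \<delta>(1) t0 by (simp add: \<delta>'_def)
    define M where "M = U \<inter> \<phi> -` ball 0 \<delta>'"
    show "\<exists>M. openin (surface_topology A) M \<and> p \<in> M \<and> M \<subseteq> N \<and>
           (\<forall>\<gamma> x. \<gamma> ` {0..1} \<subseteq> N - {p} \<longrightarrow> \<gamma> 0 = p0 \<longrightarrow> \<gamma> 1 \<in> M - {p} \<longrightarrow>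
              has_real_integral A \<omega> \<gamma> x \<longrightarrow>
                infdist x (vertical_half_plane \<sigma> q T) < \<epsilon> \<and> \<sigma> * x $ 3 > 1 / \<epsilon>)"
    proof (intro exI[of _ M] conjI allI impI)
      show "openin (surface_topology A) M" unfolding M_def by (rule openin_chart[OF c(1) open_ball])
      show "p \<in> M" using c \<delta>' by (simp add: M_def)
      show "M \<subseteq> N" by (auto simp: M_def N_def \<delta>'_def)
      fix \<gamma> x
      assume \<gamma>: "\<gamma> ` {0..1} \<subseteq> N - {p}" "\<gamma> 0 = p0" and \<gamma>1: "\<gamma> 1 \<in> M - {p}" and x: "has_real_integral A \<omega> \<gamma> x"
      obtain I where I: "\<And>j. has_form_integral A (\<omega> j) \<gamma> (I j)" "x = (\<chi> j. Re (I j))"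
        using x unfolding has_real_integral_def by blast
      let ?t = "\<phi> (\<gamma> 1)"
      have xk: "x $ k = Re (G ?t - G t0)" and x3: "\<sigma> * x $ 3 = ln (norm t0) - ln (norm ?t)"
        using curve[OF \<gamma> I(1)] I(2) by simp_all
      have "\<phi> (\<gamma> 1) \<noteq> 0" using \<gamma>1 inj c(2,3) by (metis DiffE IntE M_def inj_on_eq_iff singletonI)
      then have "ln (norm ?t) < ln (norm t0 * exp (- (1 / \<epsilon>)))"
        using \<gamma>1 t0 by (subst ln_less_cancel_iff) (auto simp: M_def \<delta>'_def)
      also have "\<dots> = ln (norm t0) - 1 / \<epsilon>" using t0 by (simp add: ln_mult)
      finally show s3: "\<sigma> * x $ 3 > 1 / \<epsilon>" using x3 by simp
      \<comment> \<open>The point of the half-plane that shares the coordinates \<open>i\<close> and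
        3 with \<open>x\<close>, so that only coordinate \<open>k\<close> contributes to the
        distance. The repeated \<open>\<sigma>\<close> writes \<open>x $ 3\<close> as
        \<open>\<sigma>\<close> times a nonnegative height.\<close>
      define y where "y = q + (x $ i / T $ i) *\<^sub>R T + (\<sigma> * (\<sigma> * x $ 3)) *\<^sub>R axis 3 1"
      have "0 \<le> \<sigma> * x $ 3" using s3 \<epsilon> by (meson less_eq_real_def less_trans zero_less_divide_1_iff)
      then have y: "y \<in> vertical_half_plane \<sigma> q T"
        unfolding vertical_half_plane_def y_def by blast
      have xy: "x - y = (Re (G ?t - G 0)) *\<^sub>R axis k 1"
      proof (rule vec_eq_iff[THEN iffD2], rule allI)
        fix j
        have "\<sigma> * (\<sigma> * x $ 3) = x $ 3" using \<sigma> by auto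
        then have "y $ i = x $ i" "y $ k = Re (G 0 - G t0)" "y $ 3 = x $ 3"
          using T ik by (auto simp: y_def q_def axis_def)
        then show "(x - y) $ j = ((Re (G ?t - G 0)) *\<^sub>R axis k 1) $ j"
          using ik(1)[of j] ik(2-4) xk by (auto simp: axis_def)
      qed
      from y have "infdist x (vertical_half_plane \<sigma> q T) \<le> dist x y" by (rule infdist_le)
      also have "dist x y = \<bar>Re (G ?t - G 0)\<bar>" unfolding dist_norm xy by (simp add: norm_axis_1)
      also have "\<dots> \<le> dist (G ?t) (G 0)" unfolding dist_norm by (rule abs_Re_le_cmod)
      also have "\<dots> < \<epsilon>" using \<gamma>1 by (intro d(2)) (auto simp: M_def \<delta>'_def)
      finally show "infdist x (vertical_half_plane \<sigma> q T) < \<epsilon>" .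
    qed
  qed (use N conn p0 in auto)
  moreover have pole: "residue (\<omega> j (U, \<phi>)) 0 = \<rho> j" "is_pole (\<omega> j (U, \<phi>)) 0 \<longleftrightarrow> \<rho> j \<noteq> 0"
    "\<rho> j \<noteq> 0 \<Longrightarrow> zorder (\<omega> j (U, \<phi>)) 0 = - 1" for j
    using simple_pole_facts[OF \<delta>(1) g[of j] \<omega>[of _ j]] by blast+
  moreover have "\<rho> 3 \<noteq> 0" "\<rho> 3 \<in> \<real>" using 3(1) \<sigma> by auto
  moreover have "T \<noteq> 0" using T(1) by (metis zero_index)
  ultimately show ?thesis
    unfolding scherk_end_def T_def [symmetric]
    using c T by (intro conjI bexI[of _ "(U, \<phi>)"]) (auto simp: T_def)
qed

text \<open>The difference quotient of \<open>N j\<close> at 0 extends holomorphically, so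
  \<open>N j t / t\<close> splits into \<open>N j 0 / t\<close> and a holomorphic part; the residues
  are the values at 0.\<close>

lemma scherk_end_of_quotients:
  fixes \<omega> :: "3 \<Rightarrow> 'a form" and i k :: 3
  assumes c: "(U, \<phi>) \<in> A" "p \<in> U" "\<phi> p = 0"
    and S: "U - {p} \<subseteq> S"
    and comp: "\<And>j. compatible_form A (\<omega> j)" and hol: "\<And>j. holomorphic_form_on A (\<omega> j) S"
    and \<omega>: "\<And>j t. t \<in> \<phi> ` U - {0} \<Longrightarrow> \<omega> j (U, \<phi>) t = N j t / t"
    and N: "\<And>j. N j holomorphic_on \<phi> ` U" "\<And>t. N 3 t = - of_real \<sigma>"
    and \<sigma>: "\<sigma> = 1 \<or> \<sigma> = -1"
    and ik: "i = 1 \<and> k = 2 \<or> i = 2 \<and> k = 1" "Im (N i 0) \<noteq> 0" "N k 0 = 0"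
  shows "scherk_end A \<omega> \<sigma> (\<chi> j. Re (2 * of_real pi * \<i> * N j 0)) p"
proof -
  have "open (\<phi> ` U)" "0 \<in> \<phi> ` U" using chart_open[OF c(1)] c(2,3) by (auto intro: image_eqI[of _ _ p])
  then obtain \<delta> where \<delta>: "\<delta> > 0" "ball 0 \<delta> \<subseteq> \<phi> ` U" using openE by blast
  define g where "g j t = (if j = 3 then 0 else if t = 0 then deriv (N j) 0 else (N j t - N j 0) / (t - 0))" for j t
  show ?thesis
  proof (rule scherk_endI[OF c \<delta> _ comp hol, where g = g and i = i and k = k])
    show "\<omega> j (U, \<phi>) t = N j 0 / t + g j t" if t: "t \<in> ball 0 \<delta> - {0}" for j t
    proof -
      have "\<omega> j (U, \<phi>) t = N j t / t" by (rule \<omega>) (use t \<delta>(2) in blast)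
      then show ?thesis using t N(2) by (simp add: g_def flip: add_divide_distrib)
    qed
    show "g j holomorphic_on ball 0 \<delta>" for j
    proof (cases "j = 3")
      case False
      have "(\<lambda>t. if t = 0 then deriv (N j) 0 else (N j t - N j 0) / (t - 0)) holomorphic_on ball 0 \<delta>"
        by (rule pole_lemma[OF holomorphic_on_subset[OF N(1) \<delta>(2)]]) (use \<delta> in simp)
      then show ?thesis using False by (simp add: g_def [abs_def])
    qed (simp add: g_def [abs_def])
    show "j = i \<or> j = k \<or> j = 3" for j using ik(1) exhaust_3[of j] by auto
  qed (use S \<sigma> ik N(2) in \<open>auto simp: g_def\<close>)
qed

end

section \<open>The genus\<close>

context riemann
begin

lemma form_analytic_change_chart:
  assumes \<omega>: "compatible_form A \<omega>" and cd: "c \<in> A" "d \<in> A" and p: "p \<in> fst c" "p \<in> fst d"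
    and an: "\<omega> c analytic_on {snd c p}"
  shows "\<omega> d analytic_on {snd d p}"
proof -
  let ?O = "snd d ` (fst d \<inter> fst c)" and ?\<tau> = "transition d c"
  have O: "open ?O" "snd d p \<in> ?O" using overlap_open[OF cd(2,1)] p by auto
  have \<tau>: "?\<tau> analytic_on {snd d p}"
    using transition_holomorphic[OF cd(2,1)] O unfolding analytic_at by blast
  have d\<tau>: "deriv ?\<tau> analytic_on {snd d p}"
    using holomorphic_deriv[OF transition_holomorphic[OF cd(2,1)] O(1)] O unfolding analytic_at by blast
  have e: "?\<tau> (snd d p) = snd c p" using cd p by (simp add: transition_eq)
  have "(\<omega> c \<circ> ?\<tau>) analytic_on {snd d p}"
    by (rule analytic_on_compose[OF \<tau>]) (use an e in simp)
  then have "(\<lambda>t. \<omega> c (?\<tau> t) * deriv ?\<tau> t) analytic_on {snd d p}"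
    using d\<tau> by (intro analytic_on_mult) (simp_all add: o_def)
  moreover have "eventually (\<lambda>t. \<omega> d t = \<omega> c (?\<tau> t) * deriv ?\<tau> t) (nhds (snd d p))"
    using eventually_nhds_in_open[OF O]
    by eventually_elim (use \<omega> cd in \<open>auto simp: compatible_form_def\<close>)
  ultimately show ?thesis by (simp add: analytic_at_cong[OF _ refl])
qed

text \<open>A form takes the whole chart as its argument, including the domain. With equal
  coordinates the transition map is the identity and has derivative 1.\<close>

lemma form_same_coordinate:
  assumes "(U, \<phi>) \<in> A" "(V, \<phi>) \<in> A" "compatible_form A \<eta>" "p \<in> U" "p \<in> V"
  shows "\<eta> (U, \<phi>) (\<phi> p) = \<eta> (V, \<phi>) (\<phi> p)"
proof -
  let ?O = "\<phi> ` (U \<inter> V)" and ?\<tau> = "transition (U, \<phi>) (V, \<phi>)"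
  have \<tau>: "?\<tau> t = t" if "t \<in> ?O" for t using that transition_eq[OF assms(1)] by force
  have O: "open ?O" "\<phi> p \<in> ?O" using overlap_open[OF assms(1,2)] assms(4,5) by auto
  have "(?\<tau> has_field_derivative 1) (at (\<phi> p))"
    by (rule has_field_derivative_transform_within_open[OF DERIV_ident O]) (simp add: \<tau>)
  then have "deriv ?\<tau> (\<phi> p) = 1" by (rule DERIV_imp_deriv)
  moreover have "\<eta> (U, \<phi>) (\<phi> p) = \<eta> (V, \<phi>) (?\<tau> (\<phi> p)) * deriv ?\<tau> (\<phi> p)"
    using assms(1-3) O(2) unfolding compatible_form_def by force
  ultimately show ?thesis using \<tau>[OF O(2)] by simp
qed

lemma forms_eqI:
  fixes f g :: "complex \<Rightarrow> complex"
  assumes F: "finite F" and c: "(U, \<phi>) \<in> A" and t: "t \<in> \<phi> ` U"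
    and cont: "continuous_on (\<phi> ` U) f" "continuous_on (\<phi> ` U) g"
    and eq: "\<And>p. p \<in> U - F \<Longrightarrow> f (\<phi> p) = g (\<phi> p)"
  shows "f t = g t"
proof -
  have op: "open (\<phi> ` U)" using chart_open[OF c] by simp
  have "eventually (\<lambda>s. s \<notin> \<phi> ` F) (at t)"
    using finite_imp_closed[of "\<phi> ` F - {t}"] F
    by (auto simp: eventually_at_topological intro!: exI[of _ "- (\<phi> ` F - {t})"])
  moreover have "eventually (\<lambda>s. s \<in> \<phi> ` U) (at t)" using op t by (rule eventually_at_in_open')
  ultimately have "eventually (\<lambda>s. f s = g s) (at t)"
  proof eventually_elim
    case (elim s)
    then obtain p where "p \<in> U" "s = \<phi> p" by blast
    with elim eq show ?case by blast
  qed
  moreover have "(f \<longlongrightarrow> f t) (at t)" "(g \<longlongrightarrow> g t) (at t)"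
    using cont op t by (auto simp: continuous_on_eq_continuous_at isContD)
  ultimately have "(g \<longlongrightarrow> f t) (at t)" "(g \<longlongrightarrow> g t) (at t)"
    using tendsto_cong[of f g "at t" "f t"] by blast+
  then show ?thesis by (rule tendsto_unique[OF at_neq_bot])
qed

end

section \<open>Holomorphic forms as functions times dz/w\<close>

context connected_sextic
begin

lemma zc_ne_wc: "zc \<noteq> wc" and zc_ne_uc: "zc \<noteq> uc" and wc_ne_uc: "wc \<noteq> uc"
proof -
  have "zc (Affine 2 0) \<noteq> wc (Affine 2 0)" "zc (Affine 2 0) \<noteq> uc (Affine 2 0)" "wc (Affine 1 0) \<noteq> uc (Affine 1 0)"
    by simp_all
  then show "zc \<noteq> wc" "zc \<noteq> uc" "wc \<noteq> uc" by metis+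
qed

lemma z_chartE:
  assumes "(U, zc) \<in> X"
  obtains G where "open G" "U = aff.cut G" "inj_on zc U" "\<forall>p\<in>U. wc p \<noteq> 0"
  using assms by (cases rule: X_cases) (use zc_ne_wc zc_ne_uc in auto)

lemma w_chartE:
  assumes "(U, wc) \<in> X"
  obtains G where "open G" "U = aff.cut G" "inj_on wc U" "\<forall>p\<in>U. poly (pderiv P) (zc p) \<noteq> 0"
  using assms by (cases rule: X_cases) (use zc_ne_wc wc_ne_uc in auto)

lemma u_chartE:
  assumes "(U, uc) \<in> X"
  obtains G where "open G" "U = inf.cut G" "inj_on uc U" "\<forall>p\<in>U. vc 3 p \<noteq> 0"
  using assms by (cases rule: X_cases) (use zc_ne_uc wc_ne_uc in auto)

text \<open>The relation 2 w dw = P'(z) dz, multiplied out. Both sides are the quotient of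
  \<open>\<eta>\<close> by dz/w, and the right-hand expression stays meaningful at a branch
  point.\<close>

lemma transition_w_z:
  assumes U: "(U, wc) \<in> X" and V: "(V, zc) \<in> X" and \<eta>: "compatible_form X \<eta>" and p: "p \<in> U" "p \<in> V"
  shows "wc p * \<eta> (V, zc) (zc p) = poly (pderiv P) (zc p) / 2 * \<eta> (U, wc) (wc p)"
proof -
  obtain G where G: "open G" "U = aff.cut G" "inj_on wc U" "\<forall>p\<in>U. poly (pderiv P) (zc p) \<noteq> 0"
    using w_chartE[OF U] by metis
  have inv: "inv_into U wc (wc p) = p" using G(3) p by simp
  have "deriv (transition (U, wc) (V, zc)) (wc p) = 2 * wc p / poly (pderiv P) (zc p)"
    using w_chart_derivative[OF G, of "wc p"] p inv by (simp add: transition_def)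
  moreover have "transition (U, wc) (V, zc) (wc p) = zc p" using transition_eq[OF U, of p] p by simp
  moreover have "\<eta> (U, wc) (wc p) = \<eta> (V, zc) (transition (U, wc) (V, zc) (wc p)) * deriv (transition (U, wc) (V, zc)) (wc p)"
    using U V \<eta> p unfolding compatible_form_def by force
  ultimately show ?thesis using G(4) p by simp
qed

lemma transition_z_u:
  assumes U: "(U, zc) \<in> X" and V: "(V, uc) \<in> X" and \<eta>: "compatible_form X \<eta>" and p: "p \<in> U" "p \<in> V"
  shows "zc p \<noteq> 0" "\<eta> (U, zc) (zc p) = - \<eta> (V, uc) (1 / zc p) / (zc p)\<^sup>2"
proof -
  let ?O = "zc ` (U \<inter> V)" and ?\<tau> = "transition (U, zc) (V, uc)"
  have sub: "U \<subseteq> affine_points P" "V \<subseteq> infpts"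
    using z_chartE[OF U] u_chartE[OF V] aff_cut_subset inf_cut_subset by metis+
  have nz: "zc q \<noteq> 0 \<and> uc q = 1 / zc q" if "q \<in> U \<inter> V" for q using infpts_Int_aff[of q] sub that by blast
  then show z0: "zc p \<noteq> 0" using p by blast
  have \<tau>: "?\<tau> t = 1 / t" if "t \<in> ?O" for t using that transition_eq[OF U] nz by force
  have O: "open ?O" "zc p \<in> ?O" using overlap_open[OF U V] p by auto
  have "((\<lambda>t. 1 / t) has_field_derivative - 1 / (zc p)\<^sup>2) (at (zc p))"
    using z0 by (auto intro!: derivative_eq_intros simp: power2_eq_square)
  then have "(?\<tau> has_field_derivative - 1 / (zc p)\<^sup>2) (at (zc p))"
    by (rule has_field_derivative_transform_within_open[OF _ O]) (simp add: \<tau>)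
  then have "deriv ?\<tau> (zc p) = - 1 / (zc p)\<^sup>2" by (rule DERIV_imp_deriv)
  moreover have "\<eta> (U, zc) (zc p) = \<eta> (V, uc) (?\<tau> (zc p)) * deriv ?\<tau> (zc p)"
    using U V \<eta> O(2) unfolding compatible_form_def by force
  ultimately show "\<eta> (U, zc) (zc p) = - \<eta> (V, uc) (1 / zc p) / (zc p)\<^sup>2" using \<tau>[OF O(2)] by simp
qed

lemma z_chart_at:
  assumes "p \<in> affine_points P" "wc p \<noteq> 0"
  obtains G where "open G" "p \<in> aff.cut G" "(aff.cut G, zc) \<in> X"
  using aff.x_chart_exists[OF open_UNIV, of p] assms z_chartI
  by (metis (no_types, lifting) UNIV_I aff.cut_def mem_Collect_eq)

lemma w_chart_at:
  assumes "p \<in> affine_points P" "wc p = 0"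
  obtains G where "open G" "p \<in> aff.cut G" "(aff.cut G, wc) \<in> X"
proof -
  have "poly (pderiv P) (zc p) \<noteq> 0" using aff.y_square[OF assms(1)] assms(2) simple_roots by simp
  then show thesis using aff.y_chart_exists[OF open_UNIV, of p] assms w_chartI that
    by (metis (no_types, lifting) UNIV_I aff.cut_def mem_Collect_eq)
qed

lemma u_chart_at:
  assumes "p \<in> infpts" "vc 3 p \<noteq> 0"
  obtains G where "open G" "p \<in> inf.cut G" "(inf.cut G, uc) \<in> X"
  using inf.x_chart_exists[OF open_UNIV, of p] assms u_chartI
  by (metis (no_types, lifting) UNIV_I inf.cut_def mem_Collect_eq)

text \<open>A sum over both sheets does not see which root \<open>csqrt\<close> selects, so locally
  two holomorphic branches can replace it. At the roots of P the sheets meet and the sum is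
  continuous, so these singularities are removable.\<close>

lemma sheet_sum_entire:
  fixes F :: "complex \<times> complex \<Rightarrow> complex"
  assumes hol: "\<And>z0 w0. w0\<^sup>2 = poly P z0 \<Longrightarrow> w0 \<noteq> 0 \<Longrightarrow> \<exists>\<delta> s. \<delta> > 0 \<and> s holomorphic_on ball z0 \<delta> \<and> s z0 = w0 \<and>
      (\<forall>z\<in>ball z0 \<delta>. (s z)\<^sup>2 = poly P z) \<and> (\<lambda>z. F (z, s z)) holomorphic_on ball z0 \<delta>"
    and cont: "continuous_on C0 F"
  shows "(\<lambda>z. F (z, csqrt (poly P z)) + F (z, - csqrt (poly P z))) holomorphic_on UNIV" (is "?S holomorphic_on _")
proof (rule no_isolated_singularity'[of "{z. poly P z = 0}"])
  show "finite {z. poly P z = 0}" by (rule card_ge_0_finite) (simp add: six_roots)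
  have an: "?S analytic_on {z0}" if z0: "poly P z0 \<noteq> 0" for z0
  proof -
    define w0 where "w0 = csqrt (poly P z0)"
    have w0: "w0\<^sup>2 = poly P z0" "(- w0)\<^sup>2 = poly P z0" "w0 \<noteq> 0" "- w0 \<noteq> 0" using z0 by (auto simp: w0_def)
    obtain \<delta> s where s: "\<delta> > 0" "s holomorphic_on ball z0 \<delta>" "s z0 = w0"
      "\<And>z. z\<in>ball z0 \<delta> \<Longrightarrow> (s z)\<^sup>2 = poly P z" "(\<lambda>z. F (z, s z)) holomorphic_on ball z0 \<delta>"
      using hol[OF w0(1,3)] by blast
    obtain \<delta>' s' where s': "\<delta>' > 0" "s' holomorphic_on ball z0 \<delta>'" "s' z0 = - w0"
      "\<And>z. z\<in>ball z0 \<delta>' \<Longrightarrow> (s' z)\<^sup>2 = poly P z" "(\<lambda>z. F (z, s' z)) holomorphic_on ball z0 \<delta>'"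
      using hol[OF w0(2,4)] by blast
    have an: "s analytic_on {z0}" "s' analytic_on {z0}" "(\<lambda>z. F (z, s z)) analytic_on {z0}" "(\<lambda>z. F (z, s' z)) analytic_on {z0}"
      unfolding analytic_at using s s' centre_in_ball open_ball by metis+
    \<comment> \<open>The two local branches stay distinct near \<open>z0\<close> and must therefore
      be opposite roots.\<close>
    have "isCont (\<lambda>z. s z - s' z) z0" using an(1,2) by (intro continuous_diff analytic_at_imp_isCont)
    moreover have "s z0 - s' z0 \<noteq> 0" using s(3) s'(3) w0(3) by simp
    ultimately have "eventually (\<lambda>z. s z - s' z \<noteq> 0) (nhds z0)"
      using continuous_at_avoid[of z0 "\<lambda>z. s z - s' z" 0] unfolding eventually_nhds_metric by (auto simp: dist_commute)
    moreover have "eventually (\<lambda>z. z \<in> ball z0 \<delta>) (nhds z0)" "eventually (\<lambda>z. z \<in> ball z0 \<delta>') (nhds z0)"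
      using s(1) s'(1) by (intro eventually_nhds_in_open; simp)+
    ultimately have "eventually (\<lambda>z. ?S z = F (z, s z) + F (z, s' z)) (nhds z0)"
    proof eventually_elim
      case (elim z)
      then have "(s z)\<^sup>2 = (s' z)\<^sup>2" using s(4) s'(4) by simp
      then have "s' z = - s z" using elim(1) by (auto simp: power2_eq_iff)
      moreover have "s z = csqrt (poly P z) \<or> s z = - csqrt (poly P z)"
        using s(4)[OF elim(2)] square_eq_csqrt by blast
      ultimately show ?case by auto
    qed
    then have "?S analytic_on {z0} \<longleftrightarrow> (\<lambda>z. F (z, s z) + F (z, s' z)) analytic_on {z0}"
      by (rule analytic_at_cong) simp
    with an(3,4) show ?thesis by (auto intro: analytic_on_add)
  qed
  then show "?S holomorphic_on UNIV - {z. poly P z = 0}"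
    by (intro analytic_imp_holomorphic) (subst analytic_on_analytic_at, auto)
  show "(?S \<longlongrightarrow> ?S r) (at r within UNIV)" if "r \<in> {z. poly P z = 0}" for r
  proof -
    have r: "poly P r = 0" using that by simp
    have "((\<lambda>z. poly P z) \<longlongrightarrow> poly P r) (at r)" by (intro tendsto_intros)
    then have "((\<lambda>z. sqrt (norm (poly P z))) \<longlongrightarrow> sqrt (norm (poly P r))) (at r)"
      by (intro tendsto_intros)
    then have "((\<lambda>z. norm (csqrt (poly P z))) \<longlongrightarrow> 0) (at r)" by (simp add: r norm_csqrt del: csqrt.simps)
    then have c: "((\<lambda>z. csqrt (poly P z)) \<longlongrightarrow> 0) (at r)" by (rule tendsto_norm_zero_cancel)
    have 0: "csqrt (poly P r) = 0" by (simp add: r)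
    have "((\<lambda>z. F (z, csqrt (poly P z))) \<longlongrightarrow> F (r, 0)) (at r)"
      by (rule continuous_on_tendsto_compose[OF cont]) (use r c in \<open>auto intro!: tendsto_intros simp del: csqrt.simps\<close>)
    moreover have "((\<lambda>z. - csqrt (poly P z)) \<longlongrightarrow> - 0) (at r)" using c by (rule tendsto_minus)
    then have "((\<lambda>z. F (z, - csqrt (poly P z))) \<longlongrightarrow> F (r, - 0)) (at r)"
      by (intro continuous_on_tendsto_compose[OF cont] tendsto_Pair tendsto_ident_at) (use r in \<open>auto simp del: csqrt.simps\<close>)
    ultimately show ?thesis unfolding 0 by (intro tendsto_add) simp_all
  qed
qed auto

text \<open>\<open>density_of \<eta>\<close> is the function \<open>\<eta> / (dz / w)\<close>.\<close>

definition density_of :: "hpoint form \<Rightarrow> hpoint \<Rightarrow> complex" where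
  "density_of \<eta> p = (if wc p \<noteq> 0 then wc p * \<eta> (SOME U. (U, zc) \<in> X \<and> p \<in> U, zc) (zc p)
     else poly (pderiv P) (zc p) / 2 * \<eta> (SOME U. (U, wc) \<in> X \<and> p \<in> U, wc) (wc p))"

lemma density_of_z:
  assumes \<eta>: "compatible_form X \<eta>" and U: "(U, zc) \<in> X" "p \<in> U"
  shows "density_of \<eta> p = wc p * \<eta> (U, zc) (zc p)"
proof -
  have "wc p \<noteq> 0" using z_chartE[OF U(1)] U(2) by metis
  moreover have "(SOME U. (U, zc) \<in> X \<and> p \<in> U, zc) \<in> X \<and> p \<in> (SOME U. (U, zc) \<in> X \<and> p \<in> U)"
    by (rule someI[of "\<lambda>U. (U, zc) \<in> X \<and> p \<in> U" U]) (use U in simp)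
  ultimately show ?thesis unfolding density_of_def using form_same_coordinate[OF _ U(1) \<eta> _ U(2)] by simp
qed

lemma density_of_w:
  assumes \<eta>: "compatible_form X \<eta>" and U: "(U, wc) \<in> X" "p \<in> U"
  shows "density_of \<eta> p = poly (pderiv P) (zc p) / 2 * \<eta> (U, wc) (wc p)"
proof (cases "wc p = 0")
  case True
  have "(SOME U. (U, wc) \<in> X \<and> p \<in> U, wc) \<in> X \<and> p \<in> (SOME U. (U, wc) \<in> X \<and> p \<in> U)"
    by (rule someI[of "\<lambda>U. (U, wc) \<in> X \<and> p \<in> U" U]) (use U in simp)
  then show ?thesis unfolding density_of_def using form_same_coordinate[OF _ U(1) \<eta> _ U(2)] True by auto
next
  case False
  have "p \<in> affine_points P" using w_chartE[OF U(1)] U(2) aff_cut_subset by (metis subsetD)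
  then obtain G where "(aff.cut G, zc) \<in> X" "p \<in> aff.cut G" using z_chart_at False by metis
  then show ?thesis using density_of_z[OF \<eta>] transition_w_z[OF U(1) _ \<eta> U(2)] by metis
qed

text \<open>At branch points, where no z-chart exists, continuity comes from w-charts;
  \<open>density_of_w\<close> makes their formula valid on a full neighbourhood and not only at w =
  0.\<close>

lemma density_of_continuous:
  assumes \<eta>: "holomorphic_form X \<eta>"
  shows "continuous_on C0 (\<lambda>q. density_of \<eta> (Affine (fst q) (snd q)))" (is "continuous_on C0 ?m")
proof -
  have comp: "compatible_form X \<eta>" using \<eta> by (simp add: holomorphic_form_def)
  have hol: "\<eta> (U, \<phi>) holomorphic_on \<phi> ` U" if "(U, \<phi>) \<in> X" for U \<phi>
  proof -
    have "U \<inter> topspace T = U" using topspace_sub[OF that] by (auto simp: topspace_X)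
    then show ?thesis using \<eta> that unfolding holomorphic_form_def holomorphic_form_on_def by fastforce
  qed
  have "\<exists>W. open W \<and> q \<in> W \<and> continuous_on (C0 \<inter> W) ?m" if q: "q \<in> C0" for q
  proof -
    let ?p = "Affine (fst q) (snd q)"
    have p: "?p \<in> affine_points P" using q by simp
    show ?thesis
    proof (cases "snd q = 0")
      case False
      then obtain G where G: "open G" "?p \<in> aff.cut G" "(aff.cut G, zc) \<in> X" using z_chart_at[OF p] by auto
      have "continuous_on (C0 \<inter> G) (\<lambda>q. snd q * \<eta> (aff.cut G, zc) (fst q))"
      proof (intro continuous_intros continuous_on_compose2[OF holomorphic_on_imp_continuous_on[OF hol[OF G(3)]]])
        show "fst ` (C0 \<inter> G) \<subseteq> zc ` aff.cut G"
        proof (rule image_subsetI)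
          fix r assume "r \<in> C0 \<inter> G"
          then show "fst r \<in> zc ` aff.cut G"
            by (intro image_eqI[of _ _ "Affine (fst r) (snd r)"]) (auto simp: aff.mk_in_cut)
        qed
      qed
      then have "continuous_on (C0 \<inter> G) ?m"
        by (rule continuous_on_eq) (auto simp: density_of_z[OF comp G(3)] aff.mk_in_cut)
      then show ?thesis using G(1,2) by (auto simp: aff.mk_in_cut)
    next
      case True
      then obtain G where G: "open G" "?p \<in> aff.cut G" "(aff.cut G, wc) \<in> X" using w_chart_at[OF p] by auto
      have "continuous_on (C0 \<inter> G) (\<lambda>q. poly (pderiv P) (fst q) / 2 * \<eta> (aff.cut G, wc) (snd q))"
      proof (intro continuous_intros continuous_on_compose2[OF holomorphic_on_imp_continuous_on[OF hol[OF G(3)]]])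
        show "snd ` (C0 \<inter> G) \<subseteq> wc ` aff.cut G"
        proof (rule image_subsetI)
          fix r assume "r \<in> C0 \<inter> G"
          then show "snd r \<in> wc ` aff.cut G"
            by (intro image_eqI[of _ _ "Affine (fst r) (snd r)"]) (auto simp: aff.mk_in_cut)
        qed
      qed auto
      then have "continuous_on (C0 \<inter> G) ?m"
        by (rule continuous_on_eq) (auto simp: density_of_w[OF comp G(3)] aff.mk_in_cut)
      then show ?thesis using G(1,2) by (auto simp: aff.mk_in_cut)
    qed
  qed
  then have "\<forall>q\<in>C0. \<exists>W. open W \<and> q \<in> W \<and> continuous_on (C0 \<inter> W) ?m" by blast
  then show ?thesis
    unfolding continuous_on_eq_continuous_within
  proof (intro ballI)
    fix q assume q: "q \<in> C0" and "\<forall>q\<in>C0. \<exists>W. open W \<and> q \<in> W \<and> (\<forall>x\<in>C0 \<inter> W. continuous (at x within C0 \<inter> W) ?m)"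
    then obtain W where W: "open W" "q \<in> W" "continuous (at q within C0 \<inter> W) ?m" by blast
    moreover have "at q within C0 \<inter> W = at q within C0"
      by (rule at_within_nhd[OF W(2,1)]) blast
    ultimately show "continuous (at q within C0) ?m" by simp
  qed
qed

lemma density_of_section:
  assumes \<eta>: "holomorphic_form X \<eta>" and w0: "w0\<^sup>2 = poly P z0" "w0 \<noteq> 0"
  shows "\<exists>\<delta> s. \<delta> > 0 \<and> s holomorphic_on ball z0 \<delta> \<and> s z0 = w0 \<and> (\<forall>z\<in>ball z0 \<delta>. (s z)\<^sup>2 = poly P z) \<and>
    (\<lambda>z. density_of \<eta> (Affine z (s z))) holomorphic_on ball z0 \<delta>"
proof -
  have comp: "compatible_form X \<eta>" using \<eta> by (simp add: holomorphic_form_def)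
  let ?p = "Affine z0 w0"
  obtain G where G: "open G" "?p \<in> aff.cut G" "(aff.cut G, zc) \<in> X" using z_chart_at[of ?p] w0 by auto
  obtain \<delta> s where s: "\<delta> > 0" "s holomorphic_on ball z0 \<delta>" "s z0 = w0"
    "\<And>z. z \<in> ball z0 \<delta> \<Longrightarrow> Affine z (s z) \<in> aff.cut G \<and> s z \<noteq> 0"
    using aff.section_in_cut[OF G(1,2)] w0(2) unfolding zc.simps wc.simps by metis
  have "aff.cut G \<inter> topspace T = aff.cut G" using topspace_sub[OF G(3)] by (auto simp: topspace_X)
  then have hol: "\<eta> (aff.cut G, zc) holomorphic_on zc ` aff.cut G"
    using \<eta> G(3) unfolding holomorphic_form_def holomorphic_form_on_def by fastforce
  have "z \<in> zc ` aff.cut G" if "z \<in> ball z0 \<delta>" for z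
    using s(4)[OF that] by (intro image_eqI[of _ _ "Affine z (s z)"]) auto
  then have "(\<lambda>z. s z * \<eta> (aff.cut G, zc) z) holomorphic_on ball z0 \<delta>"
    by (intro holomorphic_intros s holomorphic_on_subset[OF hol]) blast
  then have "(\<lambda>z. density_of \<eta> (Affine z (s z))) holomorphic_on ball z0 \<delta>"
    by (rule holomorphic_transform) (simp add: density_of_z[OF comp G(3)] s)
  moreover have "\<forall>z\<in>ball z0 \<delta>. (s z)\<^sup>2 = poly P z" using s(4) by (simp add: aff.mk_in_cut)
  ultimately show ?thesis using s by blast
qed

lemma poly_growth:
  obtains C where "C > 0" "\<And>z. norm z \<ge> 1 \<Longrightarrow> norm (poly P z) \<le> C * norm z ^ 6"
proof -
  have "compact (poly R ` cball 0 1)" by (intro compact_continuous_image continuous_intros compact_cball)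
  then have "bounded (poly R ` cball 0 1)" by (rule compact_imp_bounded)
  then obtain C where C: "C > 0" "\<And>u. norm u \<le> 1 \<Longrightarrow> norm (poly R u) \<le> C"
    unfolding bounded_pos by (metis image_eqI mem_cball_0)
  have "norm (poly P z) \<le> C * norm z ^ 6" if z: "norm z \<ge> 1" for z
  proof -
    have z0: "z \<noteq> 0" using z by auto
    then have RP: "poly R (1 / z) = poly P z / z ^ 6" by (simp add: poly_R power_one_over)
    have le: "norm (poly R (1 / z)) \<le> C" using C(2)[of "1 / z"] z z0 by (simp add: norm_divide divide_le_eq_1)
    have "poly P z = poly R (1 / z) * z ^ 6" using z0 RP by simp
    then have "norm (poly P z) = norm (poly R (1 / z)) * norm z ^ 6" by (simp add: norm_mult norm_power)
    then show ?thesis using le by (simp add: mult_right_mono)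
  qed
  with C(1) that show thesis by blast
qed

text \<open>In a u-chart \<open>\<eta>\<close> is a bounded function times du = - dz/z^2. Dividing
  by dz/w multiplies by w, which is O(z^3), so the quotient is O(z).\<close>

lemma density_of_growth:
  assumes \<eta>: "holomorphic_form X \<eta>"
  obtains A B where "A \<ge> 1" "B > 0" "\<And>z w. norm z \<ge> A \<Longrightarrow> w\<^sup>2 = poly P z \<Longrightarrow> norm (density_of \<eta> (Affine z w)) \<le> B * norm z"
proof -
  have comp: "compatible_form X \<eta>" using \<eta> by (simp add: holomorphic_form_def)
  obtain C where C: "C > 0" "\<And>z. norm z \<ge> 1 \<Longrightarrow> norm (poly P z) \<le> C * norm z ^ 6" using poly_growth by blast
  define v0 where "v0 = csqrt (lead_coeff P)"
  have v0: "v0\<^sup>2 = lead_coeff P" "v0 \<noteq> 0" using R0 poly_R0 by (auto simp: v0_def)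
  have end_bound: "\<exists>\<epsilon> K. \<epsilon> > 0 \<and> K > 0 \<and> (\<forall>z w. w\<^sup>2 = poly P z \<longrightarrow> z \<noteq> 0 \<longrightarrow> w \<noteq> 0 \<longrightarrow> norm (1 / z) < \<epsilon> \<longrightarrow> dist v (w / z ^ 3) < \<epsilon> \<longrightarrow>
      norm (density_of \<eta> (Affine z w)) \<le> K * norm w / (norm z)\<^sup>2)"
    if v: "v\<^sup>2 = lead_coeff P" for v
  proof -
    let ?p = "At_infinity v"
    have "?p \<in> infpts" "vc 3 ?p \<noteq> 0" using v v0 by auto
    then obtain G where G: "open G" "?p \<in> inf.cut G" "(inf.cut G, uc) \<in> X" using u_chart_at by blast
    have "inf.cut G \<inter> topspace T = inf.cut G" using topspace_sub[OF G(3)] by (auto simp: topspace_X)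
    then have hol: "\<eta> (inf.cut G, uc) holomorphic_on uc ` inf.cut G"
      using \<eta> G(3) unfolding holomorphic_form_def holomorphic_form_on_def by fastforce
    have op: "open (uc ` inf.cut G)" "0 \<in> uc ` inf.cut G"
      using chart_open_image[OF G(3)] G(2) by (auto intro: image_eqI[of _ _ ?p])
    then obtain e where e: "e > 0" "cball 0 e \<subseteq> uc ` inf.cut G" using open_contains_cball by blast
    have "compact (\<eta> (inf.cut G, uc) ` cball 0 e)"
      by (intro compact_continuous_image continuous_on_subset[OF holomorphic_on_imp_continuous_on[OF hol]] compact_cball e)
    then have "bounded (\<eta> (inf.cut G, uc) ` cball 0 e)" by (rule compact_imp_bounded)
    then obtain K where K: "K > 0" "\<And>u. norm u \<le> e \<Longrightarrow> norm (\<eta> (inf.cut G, uc) u) \<le> K"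
      unfolding bounded_pos by (metis image_eqI mem_cball_0)
    have "(0, v) \<in> G" using G(2) by (simp add: inf.cut_def)
    then obtain W1 W2 where W: "open W1" "open W2" "0 \<in> W1" "v \<in> W2" "W1 \<times> W2 \<subseteq> G"
      using open_prod_elim[OF G(1)] by (metis mem_Sigma_iff)
    obtain e1 e2 where e12: "e1 > 0" "ball 0 e1 \<subseteq> W1" "e2 > 0" "ball v e2 \<subseteq> W2"
      using W openE by metis
    define \<epsilon> where "\<epsilon> = min e (min e1 e2)"
    have "norm (density_of \<eta> (Affine z w)) \<le> K * norm w / (norm z)\<^sup>2"
      if zw: "w\<^sup>2 = poly P z" "z \<noteq> 0" "w \<noteq> 0" "norm (1 / z) < \<epsilon>" "dist v (w / z ^ 3) < \<epsilon>" for z w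
    proof -
      let ?q = "Affine z w"
      have "(1 / z, w / z ^ 3) \<in> G" using zw e12 W(5) by (auto simp: \<epsilon>_def subset_iff)
      then have qG: "?q \<in> inf.cut G" using zw by (simp add: inf.cut_def)
      obtain G' where G': "?q \<in> aff.cut G'" "(aff.cut G', zc) \<in> X" using z_chart_at[of ?q] zw by auto
      have "density_of \<eta> ?q = w * (- \<eta> (inf.cut G, uc) (1 / z) / z\<^sup>2)"
        using density_of_z[OF comp G'(2,1)] transition_z_u(2)[OF G'(2) G(3) comp G'(1) qG] by simp
      then have "norm (density_of \<eta> ?q) = norm (\<eta> (inf.cut G, uc) (1 / z)) * norm w / (norm z)\<^sup>2"
        by (simp add: norm_mult norm_divide norm_power mult.commute)
      also have "\<dots> \<le> K * norm w / (norm z)\<^sup>2"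
        by (intro divide_right_mono mult_right_mono K) (use zw(4) in \<open>auto simp: \<epsilon>_def\<close>)
      finally show ?thesis .
    qed
    moreover have "\<epsilon> > 0" using e e12 by (simp add: \<epsilon>_def)
    ultimately show ?thesis using K(1) by blast
  qed
  obtain \<epsilon>1 K1 where 1: "\<epsilon>1 > 0" "K1 > 0" "\<And>z w. w\<^sup>2 = poly P z \<Longrightarrow> z \<noteq> 0 \<Longrightarrow> w \<noteq> 0 \<Longrightarrow> norm (1 / z) < \<epsilon>1 \<Longrightarrow> dist v0 (w / z ^ 3) < \<epsilon>1 \<Longrightarrow>
      norm (density_of \<eta> (Affine z w)) \<le> K1 * norm w / (norm z)\<^sup>2"
    using end_bound[OF v0(1)] by blast
  obtain \<epsilon>2 K2 where 2: "\<epsilon>2 > 0" "K2 > 0" "\<And>z w. w\<^sup>2 = poly P z \<Longrightarrow> z \<noteq> 0 \<Longrightarrow> w \<noteq> 0 \<Longrightarrow> norm (1 / z) < \<epsilon>2 \<Longrightarrow> dist (- v0) (w / z ^ 3) < \<epsilon>2 \<Longrightarrow>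
      norm (density_of \<eta> (Affine z w)) \<le> K2 * norm w / (norm z)\<^sup>2"
    using end_bound[of "- v0"] v0(1) by auto
  define \<epsilon> where "\<epsilon> = min \<epsilon>1 \<epsilon>2"
  define K where "K = max K1 K2"
  have \<epsilon>: "\<epsilon> > 0" using 1 2 by (simp add: \<epsilon>_def)
  have "isCont (poly R) 0" by (rule poly_isCont)
  \<comment> \<open>Since v^2 - v0^2 = (v - v0)(v + v0), the bound
    \<open>\<epsilon> * \<epsilon>\<close> puts v within \<open>\<epsilon>\<close> of
    \<open>v0\<close> or of \<open>- v0\<close>, that is, near one of the two points at infinity.
    The second bound keeps v, hence w, from being 0.\<close>
  then obtain d where d: "d > 0" "\<And>u. norm u < d \<Longrightarrow> norm (poly R u - poly R 0) < min (\<epsilon> * \<epsilon>) (norm (poly R 0))"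
  proof -
    have "0 < min (\<epsilon> * \<epsilon>) (norm (poly R 0))" using \<epsilon> R0 by (simp del: poly_reflect_poly_0)
    then obtain d where "d > 0" "\<And>u. dist u 0 < d \<Longrightarrow> dist (poly R u) (poly R 0) < min (\<epsilon> * \<epsilon>) (norm (poly R 0))"
      using \<open>isCont (poly R) 0\<close> unfolding continuous_at_eps_delta by blast
    then show ?thesis using that by (simp add: dist_norm del: poly_reflect_poly_0)
  qed
  define A where "A = max 1 (max (2 / d) (2 / \<epsilon>))"
  show thesis
  proof
    show "A \<ge> 1" by (simp add: A_def)
    show "K * sqrt C > 0" using C 1 by (simp add: K_def less_max_iff_disj)
    fix z w assume z: "norm z \<ge> A" and w: "w\<^sup>2 = poly P z"
    have z1: "norm z \<ge> 1" and z0: "z \<noteq> 0" using z by (auto simp: A_def)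
    have "norm z \<ge> 2 / d" "norm z \<ge> 2 / \<epsilon>" using z by (simp_all add: A_def)
    then have "2 \<le> norm z * d" "2 \<le> norm z * \<epsilon>" using d(1) \<epsilon> by (simp_all add: field_simps)
    then have u: "norm (1 / z) < d" "norm (1 / z) < \<epsilon>" using z0 by (simp_all add: norm_divide field_simps)
    define v where "v = w / z ^ 3"
    have v: "v\<^sup>2 = poly R (1 / z)" using z0 w by (simp add: v_def poly_R power_divide)
    have small: "norm (v\<^sup>2 - v0\<^sup>2) < min (\<epsilon> * \<epsilon>) (norm (poly R 0))"
      using d(2)[OF u(1)] v v0(1) poly_R0 by simp
    have "v \<noteq> 0" using small v0(1) poly_R0 by auto
    then have wnz: "w \<noteq> 0" by (auto simp: v_def)
    have "norm (v - v0) * norm (v + v0) < \<epsilon> * \<epsilon>"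
      using small by (simp add: power2_eq_square square_diff_square_factored mult.commute flip: norm_mult)
    then have "norm (v - v0) < \<epsilon> \<or> norm (v + v0) < \<epsilon>"
      by (metis \<epsilon> less_eq_real_def linorder_not_less mult_mono' norm_ge_zero)
    then have "norm (density_of \<eta> (Affine z w)) \<le> K * norm w / (norm z)\<^sup>2"
    proof
      assume "norm (v - v0) < \<epsilon>"
      then have "norm (density_of \<eta> (Affine z w)) \<le> K1 * norm w / (norm z)\<^sup>2"
        using u by (intro 1(3)[OF w z0 wnz]) (auto simp: \<epsilon>_def v_def dist_norm norm_minus_commute)
      also have "\<dots> \<le> K * norm w / (norm z)\<^sup>2"
        by (intro divide_right_mono mult_right_mono) (auto simp: K_def)
      finally show ?thesis .
    next
      assume "norm (v + v0) < \<epsilon>"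
      moreover have "dist (- v0) (w / z ^ 3) = norm (v + v0)"
        by (simp add: v_def dist_norm norm_minus_commute [of _ "w / z ^ 3"] add.commute)
      ultimately have "norm (density_of \<eta> (Affine z w)) \<le> K2 * norm w / (norm z)\<^sup>2"
        using u by (intro 2(3)[OF w z0 wnz]) (auto simp: \<epsilon>_def)
      also have "\<dots> \<le> K * norm w / (norm z)\<^sup>2"
        by (intro divide_right_mono mult_right_mono) (auto simp: K_def)
      finally show ?thesis .
    qed
    also have "norm w \<le> sqrt C * norm z ^ 3"
    proof (rule power2_le_imp_le)
      have "(norm w)\<^sup>2 = norm (poly P z)" using w by (simp flip: norm_power)
      also have "\<dots> \<le> C * norm z ^ 6" by (rule C(2)[OF z1])
      also have "\<dots> = (sqrt C * norm z ^ 3)\<^sup>2" using C(1) by (simp add: power_mult_distrib flip: power_mult)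
      finally show "(norm w)\<^sup>2 \<le> (sqrt C * norm z ^ 3)\<^sup>2" .
    qed (use C(1) in simp)
    then have "K * norm w / (norm z)\<^sup>2 \<le> K * (sqrt C * norm z ^ 3) / (norm z)\<^sup>2"
      using 1(2) by (intro divide_right_mono mult_left_mono) (auto simp: K_def)
    also have "\<dots> = K * sqrt C * norm z" using z0 by (simp add: power2_eq_square power3_eq_cube)
    finally show "norm (density_of \<eta> (Affine z w)) \<le> K * sqrt C * norm z" .
  qed
qed

text \<open>Let m be the quotient of \<open>\<eta>\<close> by dz/w. Its sheet sum is entire of
  linear growth, hence of the form c + d z. The sheet sum of w m is entire of growth z^4, so a
  polynomial of degree at most 4; it vanishes at the six roots of P and is therefore 0. Hence m
  agrees on both sheets and is half of its sheet sum.\<close>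

lemma density_of_affine_linear:
  assumes \<eta>: "holomorphic_form X \<eta>"
  obtains k0 k1 where "\<And>z w. w\<^sup>2 = poly P z \<Longrightarrow> w \<noteq> 0 \<Longrightarrow> density_of \<eta> (Affine z w) = k0 + k1 * z"
proof -
  define m where "m q = density_of \<eta> (Affine (fst q) (snd q))" for q :: "complex \<times> complex"
  define c where "c z = csqrt (poly P z)" for z
  have c2: "(c z)\<^sup>2 = poly P z" for z by (simp add: c_def)
  define D where "D z = m (z, c z) + m (z, - c z)" for z
  define S where "S z = c z * m (z, c z) - c z * m (z, - c z)" for z
  have cont: "continuous_on C0 m" unfolding m_def by (rule density_of_continuous[OF \<eta>])
  have D: "D holomorphic_on UNIV"
    unfolding D_def c_def
  proof (rule sheet_sum_entire[OF _ cont])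
    fix z0 w0 assume "w0\<^sup>2 = poly P z0" "w0 \<noteq> 0"
    from density_of_section[OF \<eta> this] show "\<exists>\<delta> s. \<delta> > 0 \<and> s holomorphic_on ball z0 \<delta> \<and> s z0 = w0 \<and>
      (\<forall>z\<in>ball z0 \<delta>. (s z)\<^sup>2 = poly P z) \<and> (\<lambda>z. m (z, s z)) holomorphic_on ball z0 \<delta>"
      by (simp add: m_def)
  qed
  have "(\<lambda>z. (\<lambda>q. snd q * m q) (z, csqrt (poly P z)) + (\<lambda>q. snd q * m q) (z, - csqrt (poly P z))) holomorphic_on UNIV"
  proof (rule sheet_sum_entire)
    show "continuous_on C0 (\<lambda>q. snd q * m q)" by (intro continuous_intros cont)
    fix z0 w0 assume "w0\<^sup>2 = poly P z0" "w0 \<noteq> 0"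
    from density_of_section[OF \<eta> this] obtain \<delta> s where "\<delta> > 0" "s holomorphic_on ball z0 \<delta>" "s z0 = w0"
      "\<forall>z\<in>ball z0 \<delta>. (s z)\<^sup>2 = poly P z" "(\<lambda>z. m (z, s z)) holomorphic_on ball z0 \<delta>"
      by (auto simp: m_def)
    then show "\<exists>\<delta> s. \<delta> > 0 \<and> s holomorphic_on ball z0 \<delta> \<and> s z0 = w0 \<and>
      (\<forall>z\<in>ball z0 \<delta>. (s z)\<^sup>2 = poly P z) \<and> (\<lambda>z. snd (z, s z) * m (z, s z)) holomorphic_on ball z0 \<delta>"
      unfolding snd_conv by (intro exI[of _ \<delta>] exI[of _ s] conjI holomorphic_intros)
  qed
  then have S: "S holomorphic_on UNIV" by (simp add: S_def [abs_def] c_def del: csqrt.simps)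
  obtain A B where AB: "A \<ge> 1" "B > 0" "\<And>z w. norm z \<ge> A \<Longrightarrow> w\<^sup>2 = poly P z \<Longrightarrow> norm (density_of \<eta> (Affine z w)) \<le> B * norm z"
    using density_of_growth[OF \<eta>] by metis
  have m: "norm (m (z, c z)) \<le> B * norm z" "norm (m (z, - c z)) \<le> B * norm z" if "norm z \<ge> A" for z
    using AB(3)[OF that] c2[of z] by (auto simp: m_def)
  obtain C where C: "C > 0" "\<And>z. norm z \<ge> 1 \<Longrightarrow> norm (poly P z) \<le> C * norm z ^ 6" using poly_growth by blast
  have "norm (D z) \<le> 2 * B * norm z ^ 1" if z: "A \<le> norm z" for z
    using norm_triangle_ineq[of "m (z, c z)" "m (z, - c z)"] m[OF z] by (simp add: D_def)
  note D_bound = this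
  have D1: "D z = deriv D 0 * z + D 0" for z
    by (subst Liouville_polynomial[where \<xi> = z, OF D D_bound]) simp_all
  have "norm (S z) \<le> 2 * B * sqrt C * norm z ^ 4" if z: "A \<le> norm z" for z
  proof -
    have z1: "norm z \<ge> 1" using z AB(1) by simp
    have "norm (c z) \<le> sqrt C * norm z ^ 3"
    proof (rule power2_le_imp_le)
      have "(norm (c z))\<^sup>2 = norm (poly P z)" using c2[of z] by (simp flip: norm_power)
      also have "\<dots> \<le> C * norm z ^ 6" by (rule C(2)[OF z1])
      also have "\<dots> = (sqrt C * norm z ^ 3)\<^sup>2" using C(1) by (simp add: power_mult_distrib flip: power_mult)
      finally show "(norm (c z))\<^sup>2 \<le> (sqrt C * norm z ^ 3)\<^sup>2" .
    qed (use C(1) in simp)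
    moreover have "norm (m (z, c z) - m (z, - c z)) \<le> 2 * B * norm z"
      using norm_triangle_ineq4[of "m (z, c z)" "m (z, - c z)"] m[OF z] by simp
    ultimately have "norm (c z) * norm (m (z, c z) - m (z, - c z)) \<le> (sqrt C * norm z ^ 3) * (2 * B * norm z)"
      using C(1) by (intro mult_mono) auto
    moreover have "S z = c z * (m (z, c z) - m (z, - c z))" by (simp add: S_def algebra_simps)
    ultimately show ?thesis by (simp add: norm_mult power3_eq_cube power4_eq_xxxx mult_ac)
  qed
  from Liouville_polynomial[OF S this]
  have S4: "S z = (\<Sum>k\<le>4. (deriv ^^ k) S 0 / fact k * z ^ k)" for z by blast
  define q where "q = (\<Sum>k\<le>4. monom ((deriv ^^ k) S 0 / fact k) k)"
  have q: "poly q z = S z" for z by (simp add: q_def poly_sum poly_monom S4)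
  have "degree q \<le> 4" unfolding q_def by (intro degree_sum_le) (auto intro: order_trans[OF degree_monom_le])
  have "q = 0"
  proof (rule ccontr)
    assume q0: "q \<noteq> 0"
    have "{z. poly P z = 0} \<subseteq> {z. poly q z = 0}" by (auto simp: q S_def c_def)
    then have "6 \<le> card {z. poly q z = 0}"
      using card_mono[OF poly_roots_finite[OF q0]] six_roots by metis
    also have "\<dots> \<le> degree q" by (rule card_poly_roots_bound[OF q0])
    finally show False using \<open>degree q \<le> 4\<close> by simp
  qed
  then have S0: "S z = 0" for z using q by (metis poly_0)
  show thesis
  proof (rule that[of "D 0 / 2" "deriv D 0 / 2"])
    fix z w assume w: "w\<^sup>2 = poly P z" "w \<noteq> 0"
    then have wc: "w = c z \<or> w = - c z" by (simp add: c_def square_eq_csqrt del: csqrt.simps)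
    with w(2) have "c z \<noteq> 0" by auto
    with S0[of z] have "m (z, c z) = m (z, - c z)" by (simp add: S_def)
    with wc have "m (z, w) = D z / 2" by (auto simp: D_def)
    also have "\<dots> = (deriv D 0 * z + D 0) / 2" by (rule arg_cong[OF D1])
    finally have mD: "m (z, w) = (deriv D 0 * z + D 0) / 2" .
    then show "density_of \<eta> (Affine z w) = D 0 / 2 + deriv D 0 / 2 * z"
      using mD by (simp add: m_def add_divide_distrib)
  qed
qed

text \<open>The classical basis dz/w, z dz/w of the holomorphic forms in genus two.\<close>

definition \<theta> :: "nat \<Rightarrow> hpoint form" where
  "\<theta> i = form_of (\<lambda>p. zc p ^ i / wc p) zc"

text \<open>Over the common denominator z w the exponent rises by one, hence the index
  \<open>Suc i\<close>.\<close>

lemma has_density_\<theta>: "i < 2 \<Longrightarrow> has_density 0 (\<lambda>j. if j = Suc i then 1 else 0) (\<lambda>p. zc p ^ i / wc p)"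
  by (auto simp: has_density_def cubic_def sum.delta if_distrib[of "\<lambda>x. x * _"] cong: if_cong)

lemma cubic_\<theta>: "i < 2 \<Longrightarrow> cubic (\<lambda>j. if j = Suc i then 1 else 0) z = z ^ Suc i"
    "i < 2 \<Longrightarrow> cubic_rev (\<lambda>j. if j = Suc i then 1 else 0) z = z ^ (2 - i)"
  by (auto simp: cubic_def cubic_rev_def sum.delta if_distrib[of "\<lambda>x. x * _"] cong: if_cong)

lemma \<theta>_z:
  assumes i: "i < 2" and U: "(U, zc) \<in> X" and t: "t \<in> zc ` U"
  shows "\<theta> i (U, zc) t = t ^ i / wc (inv_into U zc t)" "\<theta> i (U, zc) analytic_on {t}"
proof -
  obtain G where G: "open G" "U = aff.cut G" "inj_on zc U" "\<forall>p\<in>U. wc p \<noteq> 0" using z_chartE[OF U] by metis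
  note zf = z_chart_facts[OF G]
  let ?g = "\<lambda>t. t ^ i / wc (inv_into U zc t)"
  have nz: "wc (inv_into U zc s) \<noteq> 0" if "s \<in> zc ` U" for s using that G(4) inv_into_into by metis
  have g: "?g holomorphic_on zc ` U" using zf nz by (intro holomorphic_intros) auto
  have val: "\<theta> i (U, zc) s = ?g s" if s: "s \<in> zc ` U" for s
    unfolding \<theta>_def
  proof (rule form_value)
    have "eventually (\<lambda>r. r \<in> zc ` U) (at s)" using zf(1) s by (rule eventually_at_in_open')
    moreover have "eventually (\<lambda>r. r \<noteq> 0) (at s)" using eventually_not_in_finite[of "{0}" s] by simp
    ultimately show "eventually (\<lambda>r. raw (\<lambda>p. zc p ^ i / wc p) (U, zc) r = ?g r) (at s)"
      by eventually_elim (simp add: raw_z[OF has_density_\<theta>[OF i] G] cubic_\<theta> i)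
    show "?g analytic_on {s}" using g zf(1) s unfolding analytic_at by blast
  qed
  show "\<theta> i (U, zc) t = ?g t" by (rule val[OF t])
  have "\<theta> i (U, zc) holomorphic_on zc ` U" by (rule holomorphic_transform[OF g]) (simp add: val)
  then show "\<theta> i (U, zc) analytic_on {t}" using zf(1) t unfolding analytic_at by blast
qed

text \<open>In the coordinate u the form is - u^(1-i) du / v, which is regular for i = 0 and i = 1
  because v does not vanish in the chart.\<close>

lemma \<theta>_u:
  assumes i: "i < 2" and U: "(U, uc) \<in> X" and t: "t \<in> uc ` U"
  shows "\<theta> i (U, uc) analytic_on {t}"
proof -
  obtain G where G: "open G" "U = inf.cut G" "inj_on uc U" "\<forall>p\<in>U. vc 3 p \<noteq> 0" using u_chartE[OF U] by metis
  note uf = u_chart_facts[OF G]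
  let ?g = "\<lambda>t. - (t ^ (1 - i) / vc 3 (inv_into U uc t))"
  have nz: "vc 3 (inv_into U uc s) \<noteq> 0" if "s \<in> uc ` U" for s using that G(4) inv_into_into by metis
  have g: "?g holomorphic_on uc ` U" using uf nz by (intro holomorphic_intros) auto
  have p: "s ^ (2 - i) = s ^ (1 - i) * s" for s :: complex
    using i by (cases "i = 0") (auto simp: power2_eq_square less_2_cases_iff)
  have val: "\<theta> i (U, uc) s = ?g s" if s: "s \<in> uc ` U" for s
    unfolding \<theta>_def
  proof (rule form_value)
    have "eventually (\<lambda>r. r \<in> uc ` U) (at s)" using uf(1) s by (rule eventually_at_in_open')
    moreover have "eventually (\<lambda>r. r \<noteq> 0) (at s)" using eventually_not_in_finite[of "{0}" s] by simp
    ultimately show "eventually (\<lambda>r. raw (\<lambda>p. zc p ^ i / wc p) (U, uc) r = ?g r) (at s)"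
      by eventually_elim (simp add: raw_u[OF has_density_\<theta>[OF i] G] cubic_\<theta> i p)
    show "?g analytic_on {s}" using g uf(1) s unfolding analytic_at by blast
  qed
  have "\<theta> i (U, uc) holomorphic_on uc ` U" by (rule holomorphic_transform[OF g]) (simp add: val)
  then show ?thesis using uf(1) t unfolding analytic_at by blast
qed

lemma holomorphic_\<theta>: assumes i: "i < 2" shows "holomorphic_form X (\<theta> i)"
  unfolding holomorphic_form_def
proof
  show comp: "compatible_form X (\<theta> i)"
    using form_meromorphic[OF has_density_\<theta>[OF i]] by (simp add: \<theta>_def meromorphic_form_def)
  have an: "\<theta> i c analytic_on {snd c p}" if c: "c \<in> X" and p: "p \<in> fst c" for c p
  proof -
    have "p \<in> affine_points P \<union> infpts" using c p topspace_sub by (metis prod.collapse subsetD)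
    \<comment> \<open>Points over z = 0 have w nonzero and belong to z-charts, points at infinity
      belong to u-charts. Branch points are not ends, since P(0) is nonzero, so regularity off
      \<open>E\<close> applies to them.\<close>
    then consider "p \<in> affine_points P" "wc p \<noteq> 0" | "p \<in> infpts" "vc 3 p \<noteq> 0" | "p \<notin> E"
      using E_iff(1)[of p] E_iff(2)[of p] aff.y_square[of p] inf.y_square[of p] P0 R0 by fastforce
    then show ?thesis
    proof cases
      case 1
      then obtain G where G: "p \<in> aff.cut G" "(aff.cut G, zc) \<in> X" using z_chart_at by metis
      have "\<theta> i (aff.cut G, zc) analytic_on {zc p}" by (rule \<theta>_z(2)[OF i G(2)]) (use G(1) in blast)
      then show ?thesis using form_analytic_change_chart[OF comp G(2) c _ p] G(1) by simp
    next
      case 2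
      then obtain G where G: "p \<in> inf.cut G" "(inf.cut G, uc) \<in> X" using u_chart_at by metis
      have "\<theta> i (inf.cut G, uc) analytic_on {uc p}" by (rule \<theta>_u[OF i G(2)]) (use G(1) in blast)
      then show ?thesis using form_analytic_change_chart[OF comp G(2) c _ p] G(1) by simp
    next
      case 3
      then show ?thesis unfolding \<theta>_def by (rule form_analytic[OF has_density_\<theta>[OF i] c p])
    qed
  qed
  show "holomorphic_form_on X (\<theta> i) (topspace T)"
    unfolding holomorphic_form_on_def
  proof safe
    fix U \<phi> assume c: "(U, \<phi>) \<in> X"
    have "\<theta> i (U, \<phi>) analytic_on \<phi> ` (U \<inter> topspace T)"
      using an[OF c] by (subst analytic_on_analytic_at) auto
    then show "\<theta> i (U, \<phi>) holomorphic_on \<phi> ` (U \<inter> topspace T)" by (rule analytic_imp_holomorphic)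
  qed
qed

lemma finite_branch_points: "finite ({p \<in> affine_points P. wc p = 0} \<union> points_over_infinity P)"
proof -
  have "{p \<in> affine_points P. wc p = 0} \<subseteq> (\<lambda>z. Affine z 0) ` {z. poly P z = 0}"
    by (auto simp: affine_points_def)
  moreover have "finite {z. poly P z = 0}" by (rule card_ge_0_finite) (simp add: six_roots)
  ultimately show ?thesis using finite_E finite_subset by blast
qed

text \<open>It suffices to compare at affine points with w nonzero, where a z-chart is available;
  continuity settles the finitely many branch points and points at infinity.\<close>

lemma holomorphic_form_combination:
  assumes \<eta>: "holomorphic_form X \<eta>"
    and k: "\<And>z w. w\<^sup>2 = poly P z \<Longrightarrow> w \<noteq> 0 \<Longrightarrow> density_of \<eta> (Affine z w) = k0 + k1 * z"
    and c: "(U, \<phi>) \<in> X" and t: "t \<in> \<phi> ` U"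
  shows "\<eta> (U, \<phi>) t = k0 * \<theta> 0 (U, \<phi>) t + k1 * \<theta> 1 (U, \<phi>) t"
proof (rule forms_eqI[OF finite_branch_points c t])
  have hol: "\<xi> (U, \<phi>) holomorphic_on \<phi> ` U" if "holomorphic_form X \<xi>" for \<xi>
  proof -
    have "U \<inter> topspace T = U" using topspace_sub[OF c] by (auto simp: topspace_X)
    then show ?thesis using that c unfolding holomorphic_form_def holomorphic_form_on_def by fastforce
  qed
  show "continuous_on (\<phi> ` U) (\<eta> (U, \<phi>))" using hol[OF \<eta>] by (rule holomorphic_on_imp_continuous_on)
  show "continuous_on (\<phi> ` U) (\<lambda>t. k0 * \<theta> 0 (U, \<phi>) t + k1 * \<theta> 1 (U, \<phi>) t)"
    by (intro continuous_intros holomorphic_on_imp_continuous_on hol holomorphic_\<theta>) auto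
  fix p assume p: "p \<in> U - ({p \<in> affine_points P. wc p = 0} \<union> points_over_infinity P)"
  then have pa: "p \<in> affine_points P" "wc p \<noteq> 0"
    using topspace_sub[OF c] by (auto simp: infpts_def)
  then obtain G where G: "p \<in> aff.cut G" "(aff.cut G, zc) \<in> X" using z_chart_at by metis
  let ?V = "aff.cut G"
  have inv: "inv_into ?V zc (zc p) = p" using chart_inj_on[OF G(2)] G(1) by simp
  have cz: "\<eta> (?V, zc) (zc p) = k0 * \<theta> 0 (?V, zc) (zc p) + k1 * \<theta> 1 (?V, zc) (zc p)"
  proof -
    have comp: "compatible_form X \<eta>" using \<eta> by (simp add: holomorphic_form_def)
    have "wc p * \<eta> (?V, zc) (zc p) = k0 + k1 * zc p"
      using density_of_z[OF comp G(2,1)] k[of "wc p" "zc p"] aff.y_square[OF pa(1)] pa(2) aff.mk_xy[OF pa(1)] by simp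
    then have "\<eta> (?V, zc) (zc p) = (k0 + k1 * zc p) / wc p" using pa(2) by (simp add: field_simps)
    then show ?thesis using \<theta>_z(1)[OF _ G(2), of _ "zc p"] G(1) inv by (simp add: add_divide_distrib)
  qed
  let ?\<tau> = "transition (U, \<phi>) (?V, zc)"
  have e: "\<xi> (U, \<phi>) (\<phi> p) = \<xi> (?V, zc) (zc p) * deriv ?\<tau> (\<phi> p)" if "holomorphic_form X \<xi>" for \<xi>
  proof -
    have "?\<tau> (\<phi> p) = zc p" using transition_eq[OF c, of p] p by simp
    moreover have "\<phi> p \<in> snd (U, \<phi>) ` (fst (U, \<phi>) \<inter> fst (?V, zc))" using p G(1) by simp
    moreover have "\<forall>c\<in>X. \<forall>d\<in>X. \<forall>t\<in>snd c ` (fst c \<inter> fst d). \<xi> c t = \<xi> d (transition c d t) * deriv (transition c d) t"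
      using that unfolding holomorphic_form_def compatible_form_def by (rule conjunct1)
    ultimately have "?\<tau> (\<phi> p) = zc p" "\<xi> (U, \<phi>) (\<phi> p) = \<xi> (?V, zc) (?\<tau> (\<phi> p)) * deriv ?\<tau> (\<phi> p)"
      using c G(2) by blast+
    then show ?thesis by simp
  qed
  show "\<eta> (U, \<phi>) (\<phi> p) = k0 * \<theta> 0 (U, \<phi>) (\<phi> p) + k1 * \<theta> 1 (U, \<phi>) (\<phi> p)"
    using e[OF \<eta>] e[OF holomorphic_\<theta>[of 0]] e[OF holomorphic_\<theta>[of 1]] cz by (simp add: algebra_simps)
qed

lemma has_genus_2: "has_genus X 2"
  unfolding has_genus_def
proof (intro exI[of _ \<theta>] conjI allI impI)
  show "holomorphic_form X (\<theta> i)" if "i < 2" for i by (rule holomorphic_\<theta>[OF that])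
  fix \<eta> assume \<eta>: "holomorphic_form X \<eta>"
  obtain k0 k1 where k: "\<And>z w. w\<^sup>2 = poly P z \<Longrightarrow> w \<noteq> 0 \<Longrightarrow> density_of \<eta> (Affine z w) = k0 + k1 * z"
    using density_of_affine_linear[OF \<eta>] by metis
  have two: "(\<Sum>i<2. f i) = f 0 + f (Suc 0)" for f :: "nat \<Rightarrow> complex" by (simp add: numeral_2_eq_2)
  \<comment> \<open>The coefficient functions are extensional on {0, 1}, so uniqueness requires the
    value \<open>undefined\<close> elsewhere.\<close>
  define \<kappa> where "\<kappa> = (\<lambda>i::nat. if i = 0 then k0 else if i = 1 then k1 else undefined)"
  let ?Q = "\<lambda>k. k \<in> {..<2} \<rightarrow>\<^sub>E UNIV \<and> (\<forall>(U, \<phi>)\<in>X. \<forall>t\<in>\<phi> ` U. \<eta> (U, \<phi>) t = (\<Sum>i<2. k i * \<theta> i (U, \<phi>) t))"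
  have Q: "?Q \<kappa>"
    using holomorphic_form_combination[OF \<eta> k] by (auto simp: two \<kappa>_def PiE_def extensional_def)
  have uniq: "k = \<kappa>" if k: "?Q k" for k
  proof -
    \<comment> \<open>In a z-chart over z = 0 the equality of two combinations says that a
      polynomial of degree at most one vanishes at 0 and at a further point.\<close>
    define w0 where "w0 = csqrt (poly P 0)"
    have "w0\<^sup>2 = poly P 0" "w0 \<noteq> 0" using P0 by (auto simp: w0_def)
    then obtain G where G: "Affine 0 w0 \<in> aff.cut G" "(aff.cut G, zc) \<in> X" using z_chart_at[of "Affine 0 w0"] by auto
    let ?V = "aff.cut G"
    have op: "open (zc ` ?V)" "0 \<in> zc ` ?V" using chart_open_image[OF G(2)] G(1) by (auto intro: image_eqI[of _ _ "Affine 0 w0"])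
    then obtain e where e: "e > 0" "ball 0 e \<subseteq> zc ` ?V" using openE by blast
    define t1 :: complex where "t1 = of_real (e / 2)"
    have t1: "t1 \<in> zc ` ?V" "t1 \<noteq> 0" using e by (auto simp: t1_def subset_iff)
    have lin: "(k 0 - k0) + (k 1 - k1) * t = 0" if t: "t \<in> zc ` ?V" for t
    proof -
      have "(\<Sum>i<2. k i * \<theta> i (?V, zc) t) = (\<Sum>i<2. \<kappa> i * \<theta> i (?V, zc) t)" using k Q G(2) t by (auto split: prod.splits)
      moreover have "wc (inv_into ?V zc t) \<noteq> 0" using z_chartE[OF G(2)] t inv_into_into by metis
      ultimately show ?thesis using \<theta>_z(1)[OF _ G(2) t] by (simp add: two \<kappa>_def field_simps)
    qed
    have "k 0 = k0" using lin[OF op(2)] by simp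
    moreover have "k 1 = k1" using lin[OF t1(1)] t1(2) calculation by simp
    moreover have "k i = undefined" if "i \<ge> 2" for i using k that by (auto simp: PiE_def extensional_def)
    ultimately show ?thesis by (auto simp: \<kappa>_def fun_eq_iff)
  qed
  show "\<exists>!k. ?Q k" using Q uniq by (rule ex1I)
qed

end

section \<open>Periods by analytic continuation over half planes\<close>

lemma eq_at_closure:
  fixes f g :: "complex \<Rightarrow> complex"
  assumes z: "z \<in> closure D" "z \<in> B" "open B"
    and cont: "continuous_on (closure D \<inter> B) f" "continuous_on (closure D \<inter> B) g"
    and eq: "\<And>y. y \<in> D \<inter> B \<Longrightarrow> f y = g y"
  shows "f z = g z"
proof (cases "z \<in> D")
  case False
  have "z \<in> closure (D \<inter> B)"
    using z open_Int_closure_subset[OF z(3), of D] by (auto simp: Int_commute)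
  then have lp: "at z within D \<inter> B \<noteq> bot"
    using False closure_def[of "D \<inter> B"] by (simp add: trivial_limit_within)
  have lim: "(k \<longlongrightarrow> k z) (at z within D \<inter> B)" if "continuous_on (closure D \<inter> B) k" for k :: "complex \<Rightarrow> complex"
    using that z closure_subset[of D] unfolding continuous_on_def by (meson IntI Int_mono order_refl tendsto_within_subset)
  have "eventually (\<lambda>y. y \<in> D \<inter> B) (at z within D \<inter> B)" by (simp add: eventually_at_filter)
  then have "eventually (\<lambda>y. f y = g y) (at z within D \<inter> B)" by eventually_elim (rule eq)
  with lim[OF cont(1)] have "(g \<longlongrightarrow> f z) (at z within D \<inter> B)" by (rule Lim_transform_eventually)
  with lim[OF cont(2)] lp show ?thesis by (metis tendsto_unique)
qed (use z eq in auto)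

section \<open>Primitives over half planes and their boundary values\<close>

context connected_sextic
begin

abbreviation lift :: "(complex \<Rightarrow> complex) \<Rightarrow> complex \<Rightarrow> hpoint" where
  "lift s z \<equiv> Affine z (s z)"

text \<open>The other sheet is at distance 2|s|, so being nearer than |s| to the graph cuts out the
  lifted sheet as an open set. A graph over a domain is thus itself the domain of a z-chart.\<close>

lemma lift_chart:
  assumes D: "open D" and s: "continuous_on D s" "\<And>z. z \<in> D \<Longrightarrow> (s z)\<^sup>2 = poly P z" "\<And>z. z \<in> D \<Longrightarrow> s z \<noteq> 0"
  shows "(lift s ` D, zc) \<in> X" "inj_on zc (lift s ` D)" "\<And>z. z \<in> D \<Longrightarrow> inv_into (lift s ` D) zc z = lift s z"
proof -
  define G where "G = {q \<in> D \<times> UNIV. norm (snd q - s (fst q)) - norm (s (fst q)) < 0}"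
  have "open ((D \<times> UNIV) \<inter> (\<lambda>q. norm (snd q - s (fst q)) - norm (s (fst q))) -` {..<0})"
    by (rule continuous_open_preimage)
      (auto intro!: continuous_intros continuous_on_compose2[OF s(1)] open_Times D)
  also have "(D \<times> UNIV) \<inter> (\<lambda>q. norm (snd q - s (fst q)) - norm (s (fst q))) -` {..<0} = G"
    by (auto simp: G_def)
  finally have G: "open G" .
  have W: "lift s ` D = aff.cut G"
  proof (intro equalityI subsetI)
    fix p assume "p \<in> lift s ` D"
    then show "p \<in> aff.cut G" using s by (auto simp: aff.mk_in_cut G_def)
  next
    fix p assume p: "p \<in> aff.cut G"
    then have pa: "p \<in> affine_points P" and pG: "(zc p, wc p) \<in> G" by (auto simp: aff.cut_def)
    have zD: "zc p \<in> D" using pG by (simp add: G_def)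
    have "(wc p)\<^sup>2 = (s (zc p))\<^sup>2" using aff.y_square[OF pa] s(2)[OF zD] by simp
    moreover have "wc p \<noteq> - s (zc p)"
    proof
      assume "wc p = - s (zc p)"
      then have "norm (- s (zc p) - s (zc p)) < norm (s (zc p))" using pG by (simp add: G_def)
      moreover have "- s (zc p) - s (zc p) = - 2 * s (zc p)" by simp
      ultimately have "norm (- 2 * s (zc p)) < norm (s (zc p))" by metis
      then show False by (simp add: norm_mult)
    qed
    ultimately have "wc p = s (zc p)" by (auto simp: power2_eq_iff)
    then have "p = lift s (zc p)" using aff.mk_xy[OF pa] by simp
    then show "p \<in> lift s ` D" using zD by blast
  qed
  show inj: "inj_on zc (lift s ` D)" by (auto simp: inj_on_def)
  have "wc p \<noteq> 0" if "p \<in> lift s ` D" for p using that s(3) by auto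
  then show "(lift s ` D, zc) \<in> X"
    using z_chartI[OF G] inj unfolding W [symmetric] by blast
  show "inv_into (lift s ` D) zc z = lift s z" if "z \<in> D" for z
    using inv_into_f_f[OF inj, of "lift s z"] that by simp
qed

lemma lift_form:
  assumes f: "has_density 0 q f" and D: "open D" "0 \<notin> D"
    and s: "continuous_on D s" "\<And>z. z \<in> D \<Longrightarrow> (s z)\<^sup>2 = poly P z" "\<And>z. z \<in> D \<Longrightarrow> s z \<noteq> 0" and z: "z \<in> D"
  shows "form_of f zc (lift s ` D, zc) z = cubic q z / (z * s z)"
proof -
  let ?W = "lift s ` D"
  have W: "(?W, zc) \<in> X" and inv: "\<And>z. z \<in> D \<Longrightarrow> inv_into ?W zc z = lift s z"
    using lift_chart[OF D(1) s] by auto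
  obtain G where G: "open G" "?W = aff.cut G" "inj_on zc ?W" "\<forall>p\<in>?W. wc p \<noteq> 0" using z_chartE[OF W] by metis
  note zf = z_chart_facts[OF G]
  have im: "zc ` ?W = D" by force
  have "s holomorphic_on D"
    by (rule holomorphic_transform[OF zf(2)[unfolded im]]) (simp add: inv)
  then have "(\<lambda>r. cubic q r / (r * s r)) holomorphic_on D"
    using s(3) D(2) by (intro holomorphic_intros) auto
  then have an: "(\<lambda>r. cubic q r / (r * s r)) analytic_on {z}" using D(1) z unfolding analytic_at by blast
  have "eventually (\<lambda>r. r \<in> D) (at z)" using D(1) z by (rule eventually_at_in_open')
  then have "eventually (\<lambda>r. raw f (?W, zc) r = cubic q r / (r * s r)) (at z)"
  proof eventually_elim
    case (elim r)
    then have "r \<noteq> 0" using D(2) by auto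
    then show ?case using raw_z[OF f G, of r] im elim inv[OF elim] by (simp add: mult.commute)
  qed
  then show ?thesis using an by (rule form_value)
qed

text \<open>On the convex intersection of \<open>D\<close> with a small disc, \<open>F\<close> and
  the pulled-back \<open>h\<close> have the same derivative. The chart may be a w-chart at a branch
  point on the boundary of \<open>D\<close>: there the integrand in z is singular, yet
  \<open>h\<close> is continuous, and this controls \<open>F\<close>.\<close>

lemma sector_local:
  assumes f: "has_density 0 q f" and D: "open D" "convex D" "0 \<notin> D"
    and s: "continuous_on (closure D) s" "\<And>z. z \<in> closure D \<Longrightarrow> (s z)\<^sup>2 = poly P z" "\<And>z. z \<in> D \<Longrightarrow> s z \<noteq> 0"
    and F: "\<And>z. z \<in> D \<Longrightarrow> (F has_field_derivative cubic q z / (z * s z)) (at z)"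
    and c: "(U, \<phi>) \<in> X" "\<phi> \<noteq> uc" and z0: "z0 \<in> closure D" "lift s z0 \<in> U"
    and V: "open V" "\<phi> (lift s z0) \<in> V" and h: "\<And>t. t \<in> V \<Longrightarrow> (h has_field_derivative form_of f zc (U, \<phi>) t) (at t)"
  obtains \<delta> K where "\<delta> > 0" "\<And>z. z \<in> closure D \<inter> ball z0 \<delta> \<Longrightarrow> lift s z \<in> U \<and> \<phi> (lift s z) \<in> V"
    "\<And>z. z \<in> D \<inter> ball z0 \<delta> \<Longrightarrow> F z = h (\<phi> (lift s z)) + K"
    "continuous_on (closure D \<inter> ball z0 \<delta>) (\<lambda>z. h (\<phi> (lift s z)))"
proof -
  obtain G where G: "open G" "U = aff.cut G" and \<phi>: "\<phi> = zc \<or> \<phi> = wc"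
    using c(1) by (cases rule: X_cases) (use c(2) in auto)
  have cont: "continuous_on (closure D) (\<lambda>z. \<phi> (lift s z))"
    using \<phi> s(1) by (auto intro: continuous_intros)
  let ?m = "\<lambda>z. ((z, s z), \<phi> (lift s z))"
  have "continuous_on (closure D) ?m" by (intro continuous_intros s(1) cont)
  moreover have "open (G \<times> V)" using G V by (intro open_Times)
  moreover have "?m z0 \<in> G \<times> V" using z0(2) V(2) G(2) by (simp add: aff.mk_in_cut)
  ultimately obtain B where B: "open B" "z0 \<in> B" "\<And>z. z \<in> closure D \<Longrightarrow> z \<in> B \<Longrightarrow> ?m z \<in> G \<times> V"
    using z0(1) unfolding continuous_on_topological by meson
  obtain \<delta> where \<delta>: "\<delta> > 0" "ball z0 \<delta> \<subseteq> B" using B(1,2) openE by blast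
  have in_UV: "lift s z \<in> U \<and> \<phi> (lift s z) \<in> V" if "z \<in> closure D \<inter> ball z0 \<delta>" for z
    using B(3)[of z] that \<delta>(2) s(2)[of z] by (auto simp: G(2) aff.mk_in_cut)
  have sD: "continuous_on D s" "\<And>z. z \<in> D \<Longrightarrow> (s z)\<^sup>2 = poly P z"
    using s(1,2) closure_subset[of D] by (auto intro: continuous_on_subset)
  let ?W = "lift s ` D" and ?\<tau> = "transition (lift s ` D, zc) (U, \<phi>)"
  have W: "(?W, zc) \<in> X" by (rule lift_chart(1)[OF D(1) sD s(3)])
  have comp: "compatible_form X (form_of f zc)" using form_meromorphic[OF f] by (simp add: meromorphic_form_def)
  let ?N = "D \<inter> ball z0 \<delta>"
  have N: "open ?N" "convex ?N" using D by (auto intro: convex_Int)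
  have \<tau>: "?\<tau> z = \<phi> (lift s z)" if "z \<in> D" for z
    using transition_eq[OF W, of "lift s z" "(U, \<phi>)"] that by simp
  have "((\<lambda>z. F z - h (\<phi> (lift s z))) has_field_derivative 0) (at z within ?N)" if z: "z \<in> ?N" for z
  proof -
    have zc: "z \<in> closure D \<inter> ball z0 \<delta>" using z closure_subset by auto
    have zO: "z \<in> snd (?W, zc) ` (fst (?W, zc) \<inter> fst (U, \<phi>))"
      using z in_UV[OF zc] by (intro image_eqI[of _ _ "lift s z"]) auto
    have "(?\<tau> has_field_derivative deriv ?\<tau> z) (at z)" by (rule transition_has_derivative[OF W c(1) zO])
    moreover have "(h has_field_derivative form_of f zc (U, \<phi>) (?\<tau> z)) (at (?\<tau> z))"
      using h in_UV[OF zc] \<tau> z by auto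
    ultimately have "(h \<circ> ?\<tau> has_field_derivative form_of f zc (U, \<phi>) (?\<tau> z) * deriv ?\<tau> z) (at z)"
      by (rule DERIV_chain[rotated])
    moreover have "form_of f zc (U, \<phi>) (?\<tau> z) * deriv ?\<tau> z = form_of f zc (?W, zc) z"
      using comp W c(1) zO unfolding compatible_form_def by metis
    ultimately have "(h \<circ> ?\<tau> has_field_derivative cubic q z / (z * s z)) (at z)"
      using lift_form[OF f D(1,3) sD s(3), of z] z by simp
    then have "((\<lambda>z. h (\<phi> (lift s z))) has_field_derivative cubic q z / (z * s z)) (at z)"
      by (rule has_field_derivative_transform_within_open[OF _ N(1) z]) (simp add: \<tau>)
    then have "((\<lambda>z. F z - h (\<phi> (lift s z))) has_field_derivative cubic q z / (z * s z) - cubic q z / (z * s z)) (at z)"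
      by (intro DERIV_diff F) (use z in auto)
    then show ?thesis by (simp add: has_field_derivative_at_within)
  qed
  then have "\<exists>K. \<forall>z\<in>?N. F z - h (\<phi> (lift s z)) = K"
    by (rule has_field_derivative_zero_constant[OF N(2)])
  then obtain K where K: "\<And>z. z \<in> ?N \<Longrightarrow> F z - h (\<phi> (lift s z)) = K" by blast
  show thesis
  proof (rule that[of \<delta> K])
    show "continuous_on (closure D \<inter> ball z0 \<delta>) (\<lambda>z. h (\<phi> (lift s z)))"
    proof (rule continuous_on_compose2[of V h])
      show "continuous_on V h"
        using h by (intro continuous_at_imp_continuous_on ballI DERIV_isCont) blast
      show "continuous_on (closure D \<inter> ball z0 \<delta>) (\<lambda>z. \<phi> (lift s z))" using cont by (rule continuous_on_subset) blast
    qed (use in_UV in auto)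
    show "F z = h (\<phi> (lift s z)) + K" if "z \<in> ?N" for z using K[OF that] by (simp add: algebra_simps)
  qed (use \<delta> in_UV in auto)
qed

lemma affine_chart_at:
  assumes "p \<in> affine_points P"
  obtains U \<phi> where "(U, \<phi>) \<in> X" "p \<in> U" "\<phi> \<noteq> uc"
  using z_chart_at[OF assms] w_chart_at[OF assms] zc_ne_uc wc_ne_uc by metis

lemma local_primitive:
  assumes f: "has_density \<alpha> q f" and c: "(U, \<phi>) \<in> X" and p: "p \<in> U" "p \<notin> E"
  obtains V h where "open V" "V \<subseteq> \<phi> ` U" "\<phi> p \<in> V" "\<And>t. t \<in> V \<Longrightarrow> (h has_field_derivative form_of f zc (U, \<phi>) t) (at t)"
proof -
  have "form_of f zc (U, \<phi>) analytic_on {\<phi> p}" using form_analytic[OF f c] p by simp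
  then obtain e where e: "e > 0" "form_of f zc (U, \<phi>) holomorphic_on ball (\<phi> p) e"
    unfolding analytic_on_def by blast
  obtain e' where e': "e' > 0" "ball (\<phi> p) e' \<subseteq> \<phi> ` U"
    using chart_open_image[OF c] p(1) openE by blast
  define V where "V = ball (\<phi> p) (min e e')"
  have "form_of f zc (U, \<phi>) holomorphic_on V" using e(2) by (rule holomorphic_on_subset) (auto simp: V_def)
  then obtain h where "\<And>t. t \<in> V \<Longrightarrow> (h has_field_derivative form_of f zc (U, \<phi>) t) (at t within V)"
    using holomorphic_convex_primitive'[of V "form_of f zc (U, \<phi>)"] by (auto simp: V_def)
  then have "\<And>t. t \<in> V \<Longrightarrow> (h has_field_derivative form_of f zc (U, \<phi>) t) (at t)"
    using at_within_open[of _ V] by (simp add: V_def)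
  moreover have "open V" "V \<subseteq> \<phi> ` U" "\<phi> p \<in> V" using e e' by (auto simp: V_def)
  ultimately show thesis using that[of V h] by blast
qed

text \<open>By \<open>sector_local\<close> the primitive is, near each boundary point other than 0,
  a constant plus a function continuous up to the boundary. So boundary values exist even at branch
  points, where the integrand is unbounded.\<close>

lemma sector_primitive_extends:
  assumes f: "has_density 0 q f" and D: "open D" "convex D" "0 \<notin> D"
    and s: "continuous_on (closure D) s" "\<And>z. z \<in> closure D \<Longrightarrow> (s z)\<^sup>2 = poly P z" "\<And>z. z \<in> D \<Longrightarrow> s z \<noteq> 0"
  obtains F where "\<And>z. z \<in> D \<Longrightarrow> (F has_field_derivative cubic q z / (z * s z)) (at z)"
    "continuous_on (closure D - {0}) F"
proof -
  have sD: "continuous_on D s" "\<And>z. z \<in> D \<Longrightarrow> (s z)\<^sup>2 = poly P z"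
    using s(1,2) closure_subset[of D] by (auto intro: continuous_on_subset)
  let ?W = "lift s ` D"
  have W: "(?W, zc) \<in> X" and im: "zc ` ?W = D" and inv: "\<And>z. z \<in> D \<Longrightarrow> inv_into ?W zc z = lift s z"
    using lift_chart[OF D(1) sD s(3)] by force+
  have "s holomorphic_on D"
    by (rule holomorphic_transform[of "\<lambda>t. wc (inv_into ?W zc t)"])
      (use affine_chart_holomorphic(2)[OF W zc_ne_uc] im inv in auto)
  then have "(\<lambda>z. cubic q z / (z * s z)) holomorphic_on D"
    using s(3) D(3) by (intro holomorphic_intros) auto
  then obtain F0 where "\<And>z. z \<in> D \<Longrightarrow> (F0 has_field_derivative cubic q z / (z * s z)) (at z within D)"
    by (rule holomorphic_convex_primitive'[OF D(2,1)]) blast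
  then have F0: "(F0 has_field_derivative cubic q z / (z * s z)) (at z)" if "z \<in> D" for z
    using that at_within_open[OF that D(1)] by metis
  \<comment> \<open>The limit supplies the boundary values; at 0 and off the closure of
    \<open>D\<close> the value carries no meaning.\<close>
  define F where "F z = (if z \<in> D then F0 z else Lim (at z within D) F0)" for z
  have loc: "\<exists>\<delta> g. \<delta> > 0 \<and> continuous_on (closure D \<inter> ball z0 \<delta>) g \<and> (\<forall>z\<in>closure D \<inter> ball z0 \<delta>. F z = g z)"
    if z0: "z0 \<in> closure D - {0}" for z0
  proof -
    have pa: "lift s z0 \<in> affine_points P" using s(2) z0 by simp
    obtain U \<phi> where U: "(U, \<phi>) \<in> X" "lift s z0 \<in> U" "\<phi> \<noteq> uc" using affine_chart_at[OF pa] by metis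
    have "lift s z0 \<notin> E" using E_iff(1)[OF pa] z0 by simp
    then obtain V h where V: "open V" "\<phi> (lift s z0) \<in> V" "\<And>t. t \<in> V \<Longrightarrow> (h has_field_derivative form_of f zc (U, \<phi>) t) (at t)"
      using local_primitive[OF f U(1,2)] by metis
    obtain \<delta> K where \<delta>: "\<delta> > 0" "\<And>z. z \<in> D \<inter> ball z0 \<delta> \<Longrightarrow> F0 z = h (\<phi> (lift s z)) + K"
      "continuous_on (closure D \<inter> ball z0 \<delta>) (\<lambda>z. h (\<phi> (lift s z)))"
      by (rule sector_local[OF f D s F0 U(1,3) _ U(2) V]) (use z0 in auto)
    define g where "g z = h (\<phi> (lift s z)) + K" for z
    have g: "continuous_on (closure D \<inter> ball z0 \<delta>) g" unfolding g_def by (intro continuous_intros \<delta>)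
    have "F z = g z" if z: "z \<in> closure D \<inter> ball z0 \<delta>" for z
    proof (cases "z \<in> D")
      case True
      then show ?thesis using z \<delta>(2) by (simp add: F_def g_def)
    next
      case False
      have lp: "at z within D \<noteq> bot"
        using z False closure_def[of D] by (simp add: trivial_limit_within)
      have "(g \<longlongrightarrow> g z) (at z within closure D \<inter> ball z0 \<delta>)" using g z by (simp add: continuous_on_def)
      then have g': "(g \<longlongrightarrow> g z) (at z within D \<inter> ball z0 \<delta>)"
        by (rule tendsto_within_subset) (use closure_subset in auto)
      have e: "at z within D \<inter> ball z0 \<delta> = at z within D"
        by (rule at_within_nhd[of _ "ball z0 \<delta>"]) (use z in auto)
      have "eventually (\<lambda>y. y \<in> D \<inter> ball z0 \<delta>) (at z within D \<inter> ball z0 \<delta>)" by (simp add: eventually_at_filter)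
      then have "eventually (\<lambda>y. g y = F0 y) (at z within D \<inter> ball z0 \<delta>)"
        by eventually_elim (simp add: \<delta>(2) g_def)
      with g' have "(F0 \<longlongrightarrow> g z) (at z within D \<inter> ball z0 \<delta>)" by (rule Lim_transform_eventually)
      then have "Lim (at z within D) F0 = g z" unfolding e by (rule tendsto_Lim[OF lp])
      then show ?thesis using False by (simp add: F_def)
    qed
    with g \<delta>(1) show ?thesis by blast
  qed
  show thesis
  proof (rule that[of F])
    show "(F has_field_derivative cubic q z / (z * s z)) (at z)" if "z \<in> D" for z
      by (rule has_field_derivative_transform_within_open[OF F0[OF that] D(1) that]) (simp add: F_def)
    show "continuous_on (closure D - {0}) F"
      unfolding continuous_on_eq_continuous_within
    proof
      fix z0 assume z0: "z0 \<in> closure D - {0}"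
      obtain \<delta> g where g: "\<delta> > 0" "continuous_on (closure D \<inter> ball z0 \<delta>) g" "\<And>z. z\<in>closure D \<inter> ball z0 \<delta> \<Longrightarrow> F z = g z"
        using loc[OF z0] by blast
      have "continuous_on (closure D \<inter> ball z0 \<delta>) F" using g(2) by (rule continuous_on_eq) (simp add: g(3))
      then have "continuous (at z0 within closure D \<inter> ball z0 \<delta>) F"
        using z0 g(1) by (simp add: continuous_on_eq_continuous_within)
      moreover have "at z0 within closure D \<inter> ball z0 \<delta> = at z0 within closure D"
        by (rule at_within_nhd[of _ "ball z0 \<delta>"]) (use g(1) in auto)
      ultimately have "continuous (at z0 within closure D) F" by simp
      then show "continuous (at z0 within closure D - {0}) F" by (rule continuous_within_subset) blast
    qed
  qed
qed

text \<open>Both sides of the relation in \<open>sector_local\<close> are continuous up to the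
  boundary, so it persists there. The disc is shrunk to avoid 0, where \<open>F\<close> may have a
  logarithmic singularity.\<close>

lemma sector_closure:
  assumes f: "has_density 0 q f" and D: "open D" "convex D" "0 \<notin> D"
    and s: "continuous_on (closure D) s" "\<And>z. z \<in> closure D \<Longrightarrow> (s z)\<^sup>2 = poly P z" "\<And>z. z \<in> D \<Longrightarrow> s z \<noteq> 0"
    and F: "\<And>z. z \<in> D \<Longrightarrow> (F has_field_derivative cubic q z / (z * s z)) (at z)" "continuous_on (closure D - {0}) F"
    and c: "(U, \<phi>) \<in> X" "\<phi> \<noteq> uc" and z0: "z0 \<in> closure D" "lift s z0 \<in> U" "z0 \<noteq> 0"
    and V: "open V" "\<phi> (lift s z0) \<in> V" and h: "\<And>t. t \<in> V \<Longrightarrow> (h has_field_derivative form_of f zc (U, \<phi>) t) (at t)"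
  obtains \<delta> K where "\<delta> > 0" "\<And>z. z \<in> closure D \<inter> ball z0 \<delta> \<Longrightarrow> z \<noteq> 0 \<and> lift s z \<in> U \<and> \<phi> (lift s z) \<in> V \<and> F z = h (\<phi> (lift s z)) + K"
proof -
  obtain \<delta> K where \<delta>: "\<delta> > 0" "\<And>z. z \<in> closure D \<inter> ball z0 \<delta> \<Longrightarrow> lift s z \<in> U \<and> \<phi> (lift s z) \<in> V"
    "\<And>z. z \<in> D \<inter> ball z0 \<delta> \<Longrightarrow> F z = h (\<phi> (lift s z)) + K"
    "continuous_on (closure D \<inter> ball z0 \<delta>) (\<lambda>z. h (\<phi> (lift s z)))"
    by (rule sector_local[OF f D s F(1) c z0(1,2) V h]) blast+
  define d where "d = min \<delta> (norm z0)"
  have nz: "z \<noteq> 0" if "z \<in> ball z0 d" for z using that by (auto simp: d_def)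
  have sub: "closure D \<inter> ball z0 d \<subseteq> closure D - {0}" "closure D \<inter> ball z0 d \<subseteq> closure D \<inter> ball z0 \<delta>"
    using nz by (auto simp: d_def)
  have "F z = h (\<phi> (lift s z)) + K" if z: "z \<in> closure D \<inter> ball z0 d" for z
  proof (rule eq_at_closure[of z D "ball z0 d" F "\<lambda>z. h (\<phi> (lift s z)) + K"])
    show "continuous_on (closure D \<inter> ball z0 d) F" using F(2) sub(1) by (rule continuous_on_subset)
    show "continuous_on (closure D \<inter> ball z0 d) (\<lambda>z. h (\<phi> (lift s z)) + K)"
      by (intro continuous_intros continuous_on_subset[OF \<delta>(4) sub(2)])
    show "F y = h (\<phi> (lift s y)) + K" if "y \<in> D \<inter> ball z0 d" for y using \<delta>(3)[of y] that by (auto simp: d_def)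
  qed (use z in auto)
  moreover have "d > 0" using \<delta>(1) z0(3) by (simp add: d_def)
  ultimately show thesis using that[of d K] \<delta>(2) sub nz by blast
qed

lemma topspace_minus_E: "p \<in> topspace T - E \<longleftrightarrow> p \<in> affine_points P \<and> zc p \<noteq> 0"
  by (cases p) (auto simp: topspace_X points_over_zero_def points_over_infinity_def affine_points_def)

text \<open>Consistency makes exp(i Re F) a well-defined function on the punctured surface,
  whichever sector a point is assigned to. Near a point, each sector that contains it has the same
  local primitive up to a constant, and finitely many sectors admit a common radius.\<close>

lemma cis_period_of_sectors:
  fixes D :: "'i \<Rightarrow> complex set" and s F :: "'i \<Rightarrow> complex \<Rightarrow> complex"
  assumes f: "has_density 0 q f" and fin: "finite I"
    and D: "\<And>i. i \<in> I \<Longrightarrow> open (D i)" "\<And>i. i \<in> I \<Longrightarrow> convex (D i)" "\<And>i. i \<in> I \<Longrightarrow> 0 \<notin> D i"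
    and s: "\<And>i. i \<in> I \<Longrightarrow> continuous_on (closure (D i)) (s i)"
      "\<And>i z. i \<in> I \<Longrightarrow> z \<in> closure (D i) \<Longrightarrow> (s i z)\<^sup>2 = poly P z" "\<And>i z. i \<in> I \<Longrightarrow> z \<in> D i \<Longrightarrow> s i z \<noteq> 0"
    and F: "\<And>i z. i \<in> I \<Longrightarrow> z \<in> D i \<Longrightarrow> (F i has_field_derivative cubic q z / (z * s i z)) (at z)"
      "\<And>i. i \<in> I \<Longrightarrow> continuous_on (closure (D i) - {0}) (F i)"
    and cover: "\<And>z w. w\<^sup>2 = poly P z \<Longrightarrow> \<exists>i\<in>I. z \<in> closure (D i) \<and> s i z = w"
    and cons: "\<And>i j z. i \<in> I \<Longrightarrow> j \<in> I \<Longrightarrow> z \<in> closure (D i) \<Longrightarrow> z \<in> closure (D j) \<Longrightarrow> z \<noteq> 0 \<Longrightarrow>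
      s i z = s j z \<Longrightarrow> cis (Re (F i z)) = cis (Re (F j z))"
    and \<gamma>: "\<gamma> ` {0..1} \<subseteq> topspace T - E" "\<gamma> 0 = \<gamma> 1" "has_form_integral X (form_of f zc) \<gamma> J"
  shows "cis (Re J) = 1"
proof -
  define pick where "pick p = (SOME i. i \<in> I \<and> zc p \<in> closure (D i) \<and> s i (zc p) = wc p)" for p
  define \<Phi> where "\<Phi> p = cis (Re (F (pick p) (zc p)))" for p
  have \<Phi>: "\<Phi> (lift (s i) z) = cis (Re (F i z))" if i: "i \<in> I" and z: "z \<in> closure (D i)" "z \<noteq> 0" for i z
  proof -
    have "pick (lift (s i) z) \<in> I \<and> z \<in> closure (D (pick (lift (s i) z))) \<and> s (pick (lift (s i) z)) z = s i z"
      unfolding pick_def zc.simps wc.simps by (rule someI[of _ i]) (use i z in simp)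
    then show ?thesis unfolding \<Phi>_def using cons[of "pick (lift (s i) z)" i z] i z by simp
  qed
  have comp: "compatible_form X (form_of f zc)" using form_meromorphic[OF f] by (simp add: meromorphic_form_def)
  have loc: "\<exists>c\<in>X. p \<in> fst c \<and> exp_primitive_at (form_of f zc) \<i> \<Phi> c p" if p: "p \<in> topspace T - E" for p
  proof -
    have pa: "p \<in> affine_points P" "zc p \<noteq> 0" "p \<notin> E" using p topspace_minus_E by auto
    obtain U \<phi> where U: "(U, \<phi>) \<in> X" "p \<in> U" "\<phi> \<noteq> uc" using affine_chart_at[OF pa(1)] by metis
    obtain V h where V: "open V" "V \<subseteq> \<phi> ` U" "\<phi> p \<in> V"
      and h: "\<And>t. t \<in> V \<Longrightarrow> (h has_field_derivative form_of f zc (U, \<phi>) t) (at t)"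
      using local_primitive[OF f U(1,2) pa(3)] by metis
    \<comment> \<open>The constant is fixed by the value at \<open>p\<close> alone, so all sectors
      that meet at \<open>p\<close> receive the same one.\<close>
    define K where "K = \<Phi> p * cis (- Re (h (\<phi> p)))"
    have "\<exists>\<delta>>0. \<forall>z\<in>closure (D i) \<inter> ball (zc p) \<delta>. s i z \<in> ball (wc p) \<delta> \<longrightarrow>
        \<Phi> (lift (s i) z) = K * cis (Re (h (\<phi> (lift (s i) z))))" if i: "i \<in> I" for i
    proof (cases "zc p \<in> closure (D i) \<and> s i (zc p) = wc p")
      case True
      then have pe: "lift (s i) (zc p) = p" using aff.mk_xy[OF pa(1)] by simp
      have pU: "lift (s i) (zc p) \<in> U" "\<phi> (lift (s i) (zc p)) \<in> V" using U(2) V(3) pe by simp_all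
      obtain \<delta> C where \<delta>: "\<delta> > 0" "\<And>z. z \<in> closure (D i) \<inter> ball (zc p) \<delta> \<Longrightarrow> z \<noteq> 0 \<and>
          lift (s i) z \<in> U \<and> \<phi> (lift (s i) z) \<in> V \<and> F i z = h (\<phi> (lift (s i) z)) + C"
        using sector_closure[OF f D[OF i] s[OF i] F[OF i] U(1,3) _ pU(1) pa(2) V(1) pU(2) h] True by metis
      have "\<Phi> (lift (s i) z) = K * cis (Re (h (\<phi> (lift (s i) z))))" if z: "z \<in> closure (D i) \<inter> ball (zc p) \<delta>" for z
      proof -
        have "F i (zc p) = h (\<phi> p) + C" using \<delta>(2)[of "zc p"] \<delta>(1) True pe by auto
        then have "\<Phi> p = cis (Re (h (\<phi> p)) + Re C)" using \<Phi>[OF i, of "zc p"] True pe pa(2) by simp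
        then have "K = cis (Re C)" unfolding K_def by (simp add: cis_mult)
        moreover have "\<Phi> (lift (s i) z) = cis (Re (h (\<phi> (lift (s i) z))) + Re C)"
          using \<Phi>[OF i, of z] \<delta>(2)[OF z] z by simp
        ultimately show ?thesis by (simp add: cis_mult add.commute)
      qed
      with \<delta>(1) show ?thesis by blast
    next
      case False
      show ?thesis
      proof (cases "zc p \<in> closure (D i)")
        case True
        \<comment> \<open>Here the closed sector passes over the point but on the other sheet. By
          continuity it stays away from \<open>wc p\<close>, and the implication is void for a small
          radius.\<close>
        with False have ne: "s i (zc p) \<noteq> wc p" by blast
        define e where "e = dist (s i (zc p)) (wc p) / 2"
        have e: "e > 0" using ne by (simp add: e_def)
        obtain d where d: "d > 0" "\<And>z. z \<in> closure (D i) \<Longrightarrow> dist z (zc p) < d \<Longrightarrow> dist (s i z) (s i (zc p)) < e"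
          using s(1)[OF i] True e unfolding continuous_on_iff by blast
        have "s i z \<notin> ball (wc p) (min d e)" if z: "z \<in> closure (D i) \<inter> ball (zc p) (min d e)" for z
        proof
          assume "s i z \<in> ball (wc p) (min d e)"
          then have "dist (wc p) (s i z) < e" by simp
          moreover have "dist (s i z) (s i (zc p)) < e" using d(2)[of z] z by (simp add: dist_commute)
          ultimately have "dist (s i (zc p)) (wc p) < e + e"
            using dist_triangle[of "s i (zc p)" "wc p" "s i z"] by (simp add: dist_commute)
          then show False by (simp add: e_def)
        qed
        then show ?thesis using d(1) e by (intro exI[of _ "min d e"]) auto
      next
        case nin: False
        have "open (- closure (D i))" by (intro open_Compl closed_closure)
        then obtain d where "d > 0" "ball (zc p) d \<subseteq> - closure (D i)" using nin openE by blast
        then show ?thesis by (intro exI[of _ d]) auto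
      qed
    qed
    then obtain \<delta> where \<delta>: "\<And>i. i \<in> I \<Longrightarrow> \<delta> i > 0" "\<And>i z. i \<in> I \<Longrightarrow> z \<in> closure (D i) \<inter> ball (zc p) (\<delta> i) \<Longrightarrow>
        s i z \<in> ball (wc p) (\<delta> i) \<Longrightarrow> \<Phi> (lift (s i) z) = K * cis (Re (h (\<phi> (lift (s i) z))))"
      by metis
    define d where "d = Min (insert 1 (\<delta> ` I))"
    have d: "d > 0" "\<And>i. i \<in> I \<Longrightarrow> d \<le> \<delta> i" using \<delta>(1) fin by (auto simp: d_def)
    let ?i = "inv_into U \<phi>"
    let ?V = "(\<phi> ` U \<inter> (\<lambda>t. (zc (?i t), wc (?i t))) -` (ball (zc p) d \<times> ball (wc p) d)) \<inter> V"
    have inv: "?i (\<phi> r) = r" if "r \<in> U" for r using chart_inj_on[OF U(1)] that by simp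
    have "open (\<phi> ` U \<inter> (\<lambda>t. (zc (?i t), wc (?i t))) -` (ball (zc p) d \<times> ball (wc p) d))"
      by (intro continuous_open_preimage continuous_on_Pair holomorphic_on_imp_continuous_on
          affine_chart_holomorphic[OF U(1,3)] chart_open_image[OF U(1)] open_Times open_ball)
    then have oV: "open ?V" using V(1) by blast
    have "exp_primitive_at (form_of f zc) \<i> \<Phi> (U, \<phi>) p"
      unfolding exp_primitive_at_def
    proof (rule exI[of _ ?V], rule exI[of _ h], rule exI[of _ K], intro conjI ballI impI)
      show "open ?V" by (rule oV)
      show "snd (U, \<phi>) p \<in> ?V" using U(2) V(3) d(1) inv by auto
      show "?V \<subseteq> snd (U, \<phi>) ` fst (U, \<phi>)" by auto
      show "(h has_field_derivative form_of f zc (U, \<phi>) t) (at t)" if "t \<in> ?V" for t using h that by blast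
      fix r assume r: "r \<in> fst (U, \<phi>)" "snd (U, \<phi>) r \<in> ?V"
      then have rU: "r \<in> U" "zc r \<in> ball (zc p) d" "wc r \<in> ball (wc p) d" using inv by auto
      have ra: "r \<in> affine_points P" using rU(1) affine_chart_holomorphic(3)[OF U(1,3)] by blast
      obtain i where i: "i \<in> I" "zc r \<in> closure (D i)" "s i (zc r) = wc r"
        using cover[OF aff.y_square[OF ra]] by blast
      have "lift (s i) (zc r) = r" using i(3) aff.mk_xy[OF ra] by simp
      then have "\<Phi> r = K * cis (Re (h (\<phi> r)))"
        using \<delta>(2)[OF i(1), of "zc r"] i rU d(2)[OF i(1)] by auto
      then show "\<Phi> r = K * exp (\<i> * of_real (Re (h (snd (U, \<phi>) r))))" by (simp add: cis_conv_exp)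
    qed
    then show ?thesis using U by (intro bexI[OF _ U(1)]) simp
  qed
  have "\<Phi> (\<gamma> 1) = \<Phi> (\<gamma> 0) * exp (\<i> * of_real (Re J))"
    by (rule exp_primitive_along_curve[OF comp loc \<gamma>(1,3)])
  moreover have "\<Phi> (\<gamma> 0) \<noteq> 0" by (simp add: \<Phi>_def)
  ultimately show ?thesis using \<gamma>(2) by (simp add: cis_conv_exp)
qed

text \<open>|z| is single-valued and its logarithm has the differential Re (dz/z). Composing
  \<open>Ln\<close> with z gives the local primitive in z- and w-charts alike.\<close>

lemma norm_period:
  assumes f: "has_density 1 (\<lambda>_. 0) (\<lambda>p. 1 / zc p)"
    and \<gamma>: "\<gamma> ` {0..1} \<subseteq> topspace T - E" "\<gamma> 0 = \<gamma> 1" "has_form_integral X (form_of (\<lambda>p. 1 / zc p) zc) \<gamma> J"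
  shows "Re J = 0"
proof -
  let ?f = "\<lambda>p. 1 / zc p" and ?\<Phi> = "\<lambda>p. complex_of_real (norm (zc p))"
  have comp: "compatible_form X (form_of ?f zc)" using form_meromorphic[OF f] by (simp add: meromorphic_form_def)
  have loc: "\<exists>c\<in>X. p \<in> fst c \<and> exp_primitive_at (form_of ?f zc) 1 ?\<Phi> c p" if p: "p \<in> topspace T - E" for p
  proof -
    have pa: "p \<in> affine_points P" "zc p \<noteq> 0" using p topspace_minus_E by auto
    obtain U \<phi> where U: "(U, \<phi>) \<in> X" "p \<in> U" "\<phi> \<noteq> uc" using affine_chart_at[OF pa(1)] by metis
    let ?z = "\<lambda>t. zc (inv_into U \<phi> t)"
    have inv: "inv_into U \<phi> (\<phi> r) = r" if "r \<in> U" for r using chart_inj_on[OF U(1)] that by simp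
    have op: "open (\<phi> ` U)" by (rule chart_open_image[OF U(1)])
    have zh: "?z holomorphic_on \<phi> ` U" by (rule affine_chart_holomorphic(1)[OF U(1,3)])
    let ?V = "\<phi> ` U \<inter> ?z -` ball (zc p) (norm (zc p))"
    have V: "open ?V" by (intro continuous_open_preimage holomorphic_on_imp_continuous_on zh op open_ball)
    have near: "?z t \<noteq> 0 \<and> ?z t / zc p \<notin> \<real>\<^sub>\<le>\<^sub>0" if t: "t \<in> ?V" for t
    proof -
      have "dist 1 (?z t / zc p) = norm (zc p - ?z t) / norm (zc p)"
        using pa(2) by (simp add: dist_norm diff_divide_distrib flip: norm_divide)
      also have "\<dots> < 1" using t pa(2) by (simp add: dist_norm)
      finally have "Re (?z t / zc p) > 0" using abs_Re_le_cmod[of "1 - ?z t / zc p"] by (simp add: dist_norm)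
      then show ?thesis by (auto simp: complex_nonpos_Reals_iff)
    qed
    have val: "form_of ?f zc (U, \<phi>) t = 1 / ?z t * deriv ?z t" if t: "t \<in> ?V" for t
    proof (rule form_value)
      show "eventually (\<lambda>s. raw ?f (U, \<phi>) s = 1 / ?z s * deriv ?z s) (at t)"
        by (simp add: raw_def o_def)
      have "(\<lambda>s. 1 / ?z s * deriv ?z s) holomorphic_on ?V"
        using near zh op V by (intro holomorphic_intros holomorphic_on_subset[OF zh] holomorphic_on_subset[OF holomorphic_deriv[OF zh op]]) auto
      then show "(\<lambda>s. 1 / ?z s * deriv ?z s) analytic_on {t}" using V t unfolding analytic_at by blast
    qed
    have "exp_primitive_at (form_of ?f zc) 1 ?\<Phi> (U, \<phi>) p"
      unfolding exp_primitive_at_def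
    proof (rule exI[of _ ?V], rule exI[of _ "\<lambda>t. Ln (?z t / zc p)"], rule exI[of _ "of_real (norm (zc p))"], intro conjI ballI impI)
      show "open ?V" by (rule V)
      show "snd (U, \<phi>) p \<in> ?V" using U(2) inv pa(2) by simp
      show "?V \<subseteq> snd (U, \<phi>) ` fst (U, \<phi>)" by auto
      show "((\<lambda>t. Ln (?z t / zc p)) has_field_derivative form_of ?f zc (U, \<phi>) t) (at t)" if t: "t \<in> ?V" for t
      proof -
        have "(?z has_field_derivative deriv ?z t) (at t)" using holomorphic_derivI[OF zh op] t by blast
        then have "((\<lambda>t. Ln (?z t / zc p)) has_field_derivative inverse (?z t / zc p) * (deriv ?z t / zc p)) (at t)"
          using near[OF t] by (intro DERIV_chain2[OF has_field_derivative_Ln] DERIV_cdivide) auto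
        moreover have "inverse (?z t / zc p) * (deriv ?z t / zc p) = 1 / ?z t * deriv ?z t"
          using pa(2) near[OF t] by (simp add: field_simps)
        ultimately show ?thesis using val[OF t] by simp
      qed
      fix r assume r: "r \<in> fst (U, \<phi>)" "snd (U, \<phi>) r \<in> ?V"
      then have zr: "zc r \<noteq> 0" using near[of "\<phi> r"] inv[of r] by auto
      have "exp (Re (Ln (zc r / zc p))) = norm (zc r) / norm (zc p)" using zr pa(2) by (simp add: norm_divide)
      then have "exp (1 * complex_of_real (Re (Ln (zc r / zc p)))) = of_real (norm (zc r) / norm (zc p))"
        by (simp only: exp_of_real mult_1)
      then show "?\<Phi> r = of_real (norm (zc p)) * exp (1 * of_real (Re (Ln (?z (snd (U, \<phi>) r) / zc p))))"
        using r inv[of r] pa(2) by simp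
    qed
    then show ?thesis using U by (intro bexI[OF _ U(1)]) simp
  qed
  have e: "?\<Phi> (\<gamma> 1) = ?\<Phi> (\<gamma> 0) * exp (1 * of_real (Re J))"
    by (rule exp_primitive_along_curve[OF comp loc \<gamma>(1,3)])
  have "\<gamma> 0 \<in> topspace T - E" using \<gamma>(1) by (metis atLeastAtMost_iff image_subset_iff order_refl zero_le_one)
  then have "zc (\<gamma> 0) \<noteq> 0" using topspace_minus_E by blast
  with e \<gamma>(2) have "exp (complex_of_real (Re J)) = 1" by simp
  then have "exp (Re J) = 1" by (metis exp_of_real of_real_eq_1_iff)
  then show ?thesis by simp
qed

end

section \<open>The curve with six real branch points\<close>

text \<open>The jump of \<open>csqrt\<close> across the negative real axis is visible only from
  below; the right-hand side makes continuity from above evident.\<close>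

lemma csqrt_upper_half_plane:
  "0 \<le> Im z \<Longrightarrow> csqrt z = Complex (sqrt ((norm z + Re z) / 2)) (sqrt ((norm z - Re z) / 2))"
  by (auto simp: complex_eq_iff sgn_if)

lemma continuous_on_csqrt_upper: "continuous_on {z. 0 \<le> Im z} csqrt"
proof (rule continuous_on_eq)
  show "continuous_on {z. 0 \<le> Im z} (\<lambda>z. Complex (sqrt ((norm z + Re z) / 2)) (sqrt ((norm z - Re z) / 2)))"
    unfolding Complex_eq by (intro continuous_intros) auto
qed (simp only: mem_Collect_eq csqrt_upper_half_plane)

definition upper :: "complex set" where "upper = {z. 0 < Im z}"
definition lower :: "complex set" where "lower = {z. Im z < 0}"

lemma upper_props: "open upper" "convex upper" "closure upper = {z. 0 \<le> Im z}" "0 \<notin> upper"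
proof -
  have e: "upper = {z. \<i> \<bullet> z > 0}" "{z. 0 \<le> Im z} = {z. \<i> \<bullet> z \<ge> 0}" by (auto simp: upper_def inner_complex_def)
  show "open upper" unfolding e by (rule open_halfspace_gt)
  show "convex upper" unfolding e by (rule convex_halfspace_gt)
  show "closure upper = {z. 0 \<le> Im z}" unfolding e by (rule closure_halfspace_gt) simp
qed (simp add: upper_def)

lemma lower_props: "open lower" "convex lower" "closure lower = {z. Im z \<le> 0}" "0 \<notin> lower"
proof -
  have e: "lower = {z. \<i> \<bullet> z < 0}" "{z. Im z \<le> 0} = {z. \<i> \<bullet> z \<le> 0}" by (auto simp: lower_def inner_complex_def)
  show "open lower" unfolding e by (rule open_halfspace_lt)
  show "convex lower" unfolding e by (rule convex_halfspace_lt)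
  show "closure lower = {z. Im z \<le> 0}" unfolding e by (rule closure_halfspace_lt) simp
qed (simp add: lower_def)

text \<open>Schwarz reflection, which carries primitives from the upper to the lower half
  plane.\<close>

lemma has_field_derivative_reflect:
  assumes "(f has_field_derivative d) (at (cnj z))"
  shows "((\<lambda>z. cnj (f (cnj z))) has_field_derivative cnj d) (at z)"
proof -
  have "(cnj \<circ> f \<circ> cnj has_field_derivative cnj d) (at (cnj (cnj z)))"
    using assms by (subst has_field_derivative_cnj_cnj) simp_all
  then show ?thesis by (simp add: o_def)
qed

section \<open>The curve with real branch points and its four half planes\<close>

locale branch_data =
  fixes a :: "nat \<Rightarrow> real" and b1 :: real
  assumes a: "0 < a 1" "a 1 < a 2" "a 2 < a 3" "a 3 < a 4" "a 4 < a 5"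
    and b1: "b1 = - (a 1 * a 3 * a 5) / (a 2 * a 4)"
begin

abbreviation "P \<equiv> branch_poly a b1"
abbreviation "wb \<equiv> w_branch a b1"

lemma b1_neg: "b1 < 0"
  unfolding b1 using a by (auto intro!: divide_neg_pos mult_pos_pos)

lemma prod5: "(\<Prod>k = 1..5. f k) = f 1 * f 2 * f 3 * f 4 * f 5" for f :: "nat \<Rightarrow> 'b :: comm_monoid_mult"
proof -
  have "{1..5::nat} = {1, 2, 3, 4, 5}" by auto
  then show ?thesis by (simp add: mult_ac)
qed

lemma poly_P: "poly P z = (z - of_real b1) * ((z - of_real (a 1)) * (z - of_real (a 2)) * (z - of_real (a 3)) * (z - of_real (a 4)) * (z - of_real (a 5)))"
  by (simp only: poly_branch_poly prod5)

definition roots :: "real set" where "roots = {b1, a 1, a 2, a 3, a 4, a 5}"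

lemma poly_P_0: "poly P z = 0 \<longleftrightarrow> z \<in> of_real ` roots"
  by (auto simp: poly_P roots_def)

lemma card_roots: "card {z. poly P z = 0} = 6"
proof -
  have "{z. poly P z = 0} = of_real ` roots" by (auto simp: poly_P_0)
  moreover have "card (of_real ` roots :: complex set) = card roots" by (rule card_image) (simp add: inj_on_def)
  moreover have "card roots = 6" using a b1_neg unfolding roots_def by simp
  ultimately show ?thesis by simp
qed

lemma P_expand: "P = [:- of_real b1, 1:] * ([:- of_real (a 1), 1:] * [:- of_real (a 2), 1:] * [:- of_real (a 3), 1:] * [:- of_real (a 4), 1:] * [:- of_real (a 5), 1:])"
  by (simp only: branch_poly_def prod5)

lemma degree_P: "degree P = 6" and lead_P: "lead_coeff P = 1"
proof -
  show "lead_coeff P = 1" unfolding P_expand by (simp only: lead_coeff_mult) simp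
  have "degree P = 1 + (1 + 1 + 1 + 1 + 1)" unfolding P_expand by (subst degree_mult_eq; simp)+
  then show "degree P = 6" by simp
qed

text \<open>The condition on \<open>b1\<close> turns the constant term of P into minus a square.
  Over z = 0 this gives w = +-i a1 a3 a5, whence the residues +-i.\<close>

lemma m_square: "(poly P 0 :: complex) = - (of_real (a 1 * a 3 * a 5))\<^sup>2"
proof -
  have "b1 * (a 2 * a 4) = - (a 1 * a 3 * a 5)" using a by (simp add: b1)
  then have "b1 * (a 1 * a 2 * a 3 * a 4 * a 5) = - (a 1 * a 3 * a 5)\<^sup>2" by (simp add: power2_eq_square) algebra
  then have "complex_of_real (b1 * (a 1 * a 2 * a 3 * a 4 * a 5)) = of_real (- (a 1 * a 3 * a 5)\<^sup>2)" by (rule arg_cong)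
  then show ?thesis by (simp add: poly_P)
qed

lemma poly_P_cnj: "poly P (cnj z) = cnj (poly P z)"
  by (simp add: poly_P)

lemma simple_P: assumes "poly P z = 0" shows "poly (pderiv P) z \<noteq> 0"
proof -
  have "z \<in> of_real ` roots" using assms poly_P_0 by blast
  then consider "z = of_real b1" | "z = of_real (a 1)" | "z = of_real (a 2)" | "z = of_real (a 3)" | "z = of_real (a 4)" | "z = of_real (a 5)"
    by (auto simp: roots_def)
  then show ?thesis
    by cases (use a b1_neg in \<open>simp_all add: P_expand pderiv_mult pderiv_pCons del: mult_pCons_left mult_pCons_right\<close>)
qed

lemma wb_square: "(wb z)\<^sup>2 = poly P z"
  using w_branch_on_curve[of z a b1] by (simp add: affine_points_def)

lemma wb_0: "wb z = 0 \<longleftrightarrow> poly P z = 0"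
  using wb_square[of z] by (metis zero_eq_power2)

lemma wb_continuous: "continuous_on (closure upper) wb"
  unfolding w_branch_def upper_props(3)
  by (intro continuous_intros continuous_on_compose2[OF continuous_on_csqrt_upper]) auto

lemma wb_nonzero: "z \<in> upper \<Longrightarrow> wb z \<noteq> 0"
  by (auto simp: wb_0 poly_P_0 upper_def)

text \<open>The index consists of the half plane (\<open>True\<close> for the upper one) and of the
  sign that selects the sheet.\<close>

definition sector_dom :: "bool \<times> complex \<Rightarrow> complex set" where
  "sector_dom i = (if fst i then upper else lower)"

text \<open>Over the lower half plane the branch is the reflection of \<open>wb\<close>, again a
  square root of P since P has real coefficients. On the real axis it agrees with \<open>wb\<close>
  where \<open>wb\<close> is real and with \<open>- wb\<close> where \<open>wb\<close> is imaginary,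
  up to the sign of the sheet.\<close>

definition sector_w :: "bool \<times> complex \<Rightarrow> complex \<Rightarrow> complex" where
  "sector_w i z = snd i * (if fst i then wb z else cnj (wb (cnj z)))"

abbreviation sectors :: "(bool \<times> complex) set" where "sectors \<equiv> UNIV \<times> {1, - 1}"

lemma sector_dom_props: "open (sector_dom i)" "convex (sector_dom i)" "0 \<notin> sector_dom i"
  by (auto simp: sector_dom_def upper_props lower_props)

lemma sector_w_continuous: "continuous_on (closure (sector_dom i)) (sector_w i)"
proof (cases "fst i")
  case True
  then show ?thesis unfolding sector_dom_def sector_w_def by (auto intro!: continuous_intros wb_continuous)
next
  case False
  have "continuous_on (closure lower) (\<lambda>z. wb (cnj z))"
    by (rule continuous_on_compose2[OF wb_continuous]) (auto intro: continuous_intros simp: lower_props upper_props)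
  then show ?thesis unfolding sector_dom_def sector_w_def using False by (auto intro!: continuous_intros)
qed

lemma sector_w_square: "i \<in> sectors \<Longrightarrow> (sector_w i z)\<^sup>2 = poly P z"
  using wb_square[of z] wb_square[of "cnj z"]
  by (auto simp: sector_w_def power_mult_distrib poly_P_cnj simp flip: complex_cnj_power)

lemma sector_w_nonzero: "i \<in> sectors \<Longrightarrow> z \<in> sector_dom i \<Longrightarrow> sector_w i z \<noteq> 0"
  using wb_nonzero[of z] wb_nonzero[of "cnj z"]
  by (auto simp: sector_w_def sector_dom_def upper_def lower_def split: if_splits)

lemma sectors_cover:
  assumes "w\<^sup>2 = poly P z"
  shows "\<exists>i\<in>sectors. z \<in> closure (sector_dom i) \<and> sector_w i z = w"
proof -
  let ?u = "0 \<le> Im z"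
  have "w\<^sup>2 = (sector_w (?u, 1) z)\<^sup>2" using assms sector_w_square[of "(?u, 1)" z] by simp
  then have "w = sector_w (?u, 1) z \<or> w = sector_w (?u, - 1) z" by (auto simp: power2_eq_iff sector_w_def)
  moreover have "z \<in> closure (sector_dom (?u, c))" for c
    by (cases ?u) (simp_all add: sector_dom_def upper_props lower_props)
  ultimately show ?thesis by (metis UNIV_I insertCI mem_Sigma_iff)
qed

text \<open>The four closed half planes are connected and share the branch point over
  \<open>a 1\<close>.\<close>

lemma connected_curve: "connected {q :: complex \<times> complex. (snd q)\<^sup>2 = poly P (fst q)}" (is "connected ?C")
proof -
  let ?g = "\<lambda>i z. (z, sector_w i z)"
  have "?C = (\<Union>i\<in>sectors. ?g i ` closure (sector_dom i))"
  proof (intro equalityI subsetI)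
    fix q assume "q \<in> ?C"
    then obtain i where "i \<in> sectors" "fst q \<in> closure (sector_dom i)" "sector_w i (fst q) = snd q"
      using sectors_cover by force
    then have "q \<in> ?g i ` closure (sector_dom i)" by (intro image_eqI[of _ _ "fst q"]) auto
    with \<open>i \<in> sectors\<close> show "q \<in> (\<Union>i\<in>sectors. ?g i ` closure (sector_dom i))" by blast
  qed (use sector_w_square in auto)
  moreover have "connected (\<Union>i\<in>sectors. ?g i ` closure (sector_dom i))"
  proof (rule connected_Union)
    have "connected (?g i ` closure (sector_dom i))" for i
      by (intro connected_continuous_image continuous_intros sector_w_continuous convex_connected
          convex_closure sector_dom_props)
    then show "connected t" if "t \<in> (\<lambda>i. ?g i ` closure (sector_dom i)) ` sectors" for t
      using that by blast
    have "(of_real (a 1), 0) \<in> ?g i ` closure (sector_dom i)" for i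
    proof (rule image_eqI)
      have "wb (of_real (a 1)) = 0" by (simp add: wb_0 poly_P_0 roots_def)
      then show "(of_real (a 1), 0) = ?g i (of_real (a 1))" by (simp add: sector_w_def)
      show "of_real (a 1) \<in> closure (sector_dom i)" by (auto simp: sector_dom_def upper_props lower_props)
    qed
    then show "\<Inter> ((\<lambda>i. ?g i ` closure (sector_dom i)) ` sectors) \<noteq> {}" by blast
  qed
  ultimately show ?thesis by simp
qed

sublocale connected_sextic P
  by unfold_locales (use degree_P simple_P m_square a connected_curve card_roots in auto)

text \<open>The right-hand side does not contain \<open>\<sigma>\<close>: at multiples of pi a
  change of sign does not affect \<open>cis\<close>, and so the gluing tolerates it.\<close>

lemma cis_pi_int: "\<sigma> = 1 \<or> \<sigma> = -1 \<Longrightarrow> x = pi * of_int n \<Longrightarrow> cis (\<sigma> * x) = (- 1) powi n" for \<sigma> x :: real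
proof -
  have "cis (pi * of_int n) = (- 1) powi n" by (metis cis_power_int cis_pi mult.commute)
  moreover have "cis (- (pi * of_int n)) = inverse (cis (pi * of_int n))" by (simp flip: cis_inverse)
  moreover have "inverse ((- 1) powi n) = ((- 1) powi n :: complex)"
    by (metis inverse_minus_eq inverse_1 power_int_inverse)
  ultimately show "\<sigma> = 1 \<or> \<sigma> = -1 \<Longrightarrow> x = pi * of_int n \<Longrightarrow> cis (\<sigma> * x) = (- 1) powi n" by auto
qed

text \<open>The two sheets over the two half planes are glued along the real axis. On the intervals where
  this interchanges the sheets in such a way that the form changes its sign, the real part of the
  primitive has to be a multiple of \<open>\<pi>\<close>.\<close>

lemma cis_period:
  assumes f: "has_density 0 q f" and \<kappa>: "\<kappa> = 1 \<or> \<kappa> = - 1" and q: "\<And>i. cnj (q i) = of_real \<kappa> * q i"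
    and F: "\<And>z. z \<in> upper \<Longrightarrow> (F has_field_derivative cubic q z / (z * wb z)) (at z)" "continuous_on (closure upper - {0}) F"
    and per: "\<And>x. x \<noteq> 0 \<Longrightarrow> wb (of_real x) = - of_real \<kappa> * cnj (wb (of_real x)) \<Longrightarrow> \<exists>n::int. Re (F (of_real x)) = pi * of_int n"
    and \<gamma>: "\<gamma> ` {0..1} \<subseteq> topspace T - E" "\<gamma> 0 = \<gamma> 1" "has_form_integral X (form_of f zc) \<gamma> J"
  shows "cis (Re J) = 1"
proof -
  \<comment> \<open>The reflected primitive belongs to the conjugate cubic, which is
    \<open>\<kappa>\<close> times the given one; the factor \<open>\<kappa>\<close> corrects
    this.\<close>
  define Fs where "Fs i z = snd i * (if fst i then F z else of_real \<kappa> * cnj (F (cnj z)))" for i :: "bool \<times> complex" and z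
  have qc: "cnj (cubic q (cnj z)) = of_real \<kappa> * cubic q z" for z
    unfolding cubic_def by (simp add: q sum_distrib_left mult_ac)
  show ?thesis
  proof (rule cis_period_of_sectors[where I = sectors and D = sector_dom and s = sector_w and F = Fs, OF f _ _ _ _ sector_w_continuous sector_w_square sector_w_nonzero _ _ sectors_cover _ \<gamma>])
    show "finite sectors" by simp
    show "open (sector_dom i)" "convex (sector_dom i)" "0 \<notin> sector_dom i" for i by (rule sector_dom_props)+
    show "(Fs i has_field_derivative cubic q z / (z * sector_w i z)) (at z)" if i: "i \<in> sectors" and z: "z \<in> sector_dom i" for i z
    proof (cases "fst i")
      case True
      have "((\<lambda>z. snd i * F z) has_field_derivative snd i * (cubic q z / (z * wb z))) (at z)"
        by (intro DERIV_cmult F) (use z True in \<open>simp add: sector_dom_def\<close>)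
      moreover have "snd i * (cubic q z / (z * wb z)) = cubic q z / (z * sector_w i z)"
        using i True by (auto simp: sector_w_def)
      moreover have "Fs i = (\<lambda>z. snd i * F z)" using True by (auto simp: Fs_def)
      ultimately show ?thesis by simp
    next
      case False
      then have "cnj z \<in> upper" using z by (simp add: sector_dom_def upper_def lower_def)
      from has_field_derivative_reflect[OF F(1)[OF this]]
      have "((\<lambda>z. snd i * (of_real \<kappa> * cnj (F (cnj z)))) has_field_derivative
          snd i * (of_real \<kappa> * cnj (cubic q (cnj z) / (cnj z * wb (cnj z))))) (at z)"
        by (intro DERIV_cmult)
      moreover have "snd i * (of_real \<kappa> * cnj (cubic q (cnj z) / (cnj z * wb (cnj z)))) = cubic q z / (z * sector_w i z)"
        using i False \<kappa> by (auto simp: sector_w_def qc)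
      moreover have "Fs i = (\<lambda>z. snd i * (of_real \<kappa> * cnj (F (cnj z))))" using False by (auto simp: Fs_def)
      ultimately show ?thesis by simp
    qed
    show "continuous_on (closure (sector_dom i) - {0}) (Fs i)" for i
    proof (cases "fst i")
      case True
      then show ?thesis unfolding Fs_def sector_dom_def by (auto intro!: continuous_intros F(2))
    next
      case False
      have "continuous_on (closure lower - {0}) (\<lambda>z. F (cnj z))"
        by (rule continuous_on_compose2[OF F(2)]) (auto intro: continuous_intros simp: lower_props upper_props)
      then show ?thesis using False unfolding Fs_def sector_dom_def by (auto intro!: continuous_intros)
    qed
    fix i j z
    assume ij: "i \<in> sectors" "j \<in> sectors" and z: "z \<in> closure (sector_dom i)" "z \<in> closure (sector_dom j)" "z \<noteq> 0"
      and eq: "sector_w i z = sector_w j z"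
    have i1: "snd i = 1 \<or> snd i = - 1" "snd j = 1 \<or> snd j = - 1" using ij by auto
    show "cis (Re (Fs i z)) = cis (Re (Fs j z))"
    proof (cases "fst i = fst j \<and> sector_w i z \<noteq> 0")
      case True
      then have "i = j" using eq i1 by (auto simp: sector_w_def prod_eq_iff split: if_splits)
      then show ?thesis by simp
    next
      case False
      have "z \<in> \<real>"
      proof (cases "fst i = fst j")
        case True
        with False have "poly P z = 0" using sector_w_square[OF ij(1), of z] by simp
        then show ?thesis by (auto simp: poly_P_0)
      next
        case False
        then have "Im z = 0" using z by (auto simp: sector_dom_def upper_props lower_props split: if_splits)
        then show ?thesis by (simp add: complex_is_Real_iff)
      qed
      then obtain x where x: "z = of_real x" "x \<noteq> 0" using z(3) by (auto elim!: Reals_cases)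
      \<comment> \<open>The sign with which Re F enters a sector on the real axis. Equal signs give
        equal values at once; opposite signs call for a multiple of pi.\<close>
      define \<sigma> where "\<sigma> i = Re (snd i) * (if fst i then 1 else \<kappa>)" for i :: "bool \<times> complex"
      have ReF: "Re (Fs k z) = \<sigma> k * Re (F z)" if "k \<in> sectors" for k
        using that \<kappa> x(1) by (auto simp: Fs_def \<sigma>_def)
      have \<sigma>1: "\<sigma> k = 1 \<or> \<sigma> k = - 1" if "k \<in> sectors" for k using that \<kappa> by (auto simp: \<sigma>_def)
      show ?thesis
      proof (cases "\<sigma> i = \<sigma> j")
        case True
        then show ?thesis using ReF ij by simp
      next
        case ne: False
        \<comment> \<open>Opposite signs together with equal values of w force the gluing condition
          of \<open>per\<close>; at a branch point it holds because \<open>wb z\<close> is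
          0.\<close>
        have "wb z = - of_real \<kappa> * cnj (wb z)"
        proof (cases "fst i = fst j")
          case True
          with False have "poly P z = 0" using sector_w_square[OF ij(1), of z] by simp
          then have "wb z = 0" using wb_0 by blast
          then show ?thesis by simp
        next
          case False
          have zz: "cnj z = z" using x by simp
          from False consider "fst i" "\<not> fst j" | "\<not> fst i" "fst j" by blast
          then show ?thesis
          proof cases
            case 1
            then have "snd i * wb z = snd j * cnj (wb z)" using eq by (simp add: sector_w_def zz)
            moreover have "Re (snd i) \<noteq> Re (snd j) * \<kappa>" using ne 1 by (simp add: \<sigma>_def)
            ultimately show ?thesis using i1 \<kappa> by (auto simp: minus_equation_iff[of "wb z" "cnj (wb z)"])
          next
            case 2
            then have "snd j * wb z = snd i * cnj (wb z)" using eq by (simp add: sector_w_def zz)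
            moreover have "Re (snd j) \<noteq> Re (snd i) * \<kappa>" using ne 2 by (simp add: \<sigma>_def)
            ultimately show ?thesis using i1 \<kappa> by (auto simp: minus_equation_iff[of "wb z" "cnj (wb z)"])
          qed
        qed
        then obtain n :: int where n: "Re (F z) = pi * of_int n" using per[OF x(2)] x(1) by blast
        show ?thesis
          using ReF[OF ij(1)] ReF[OF ij(2)] cis_pi_int[OF \<sigma>1[OF ij(1)] n] cis_pi_int[OF \<sigma>1[OF ij(2)] n] by simp
      qed
    qed
  qed
qed

end

text \<open>\<open>\<Phi>\<close> is N(0) log t plus a holomorphic function, and log t grows by i pi
  on the way from the positive to the negative axis through the upper half plane. As the real parts
  are constant on either side, letting t tend to 0 removes the holomorphic contribution.\<close>

lemma log_jump:
  assumes \<delta>: "\<delta> > 0" and N: "N holomorphic_on ball 0 \<delta>"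
    and \<Phi>: "continuous_on (closure upper \<inter> (ball 0 \<delta> - {0})) \<Phi>"
      "\<And>t. t \<in> upper \<inter> ball 0 \<delta> \<Longrightarrow> (\<Phi> has_field_derivative N t / t) (at t)"
    and c: "\<And>x. 0 < x \<Longrightarrow> x < \<delta> \<Longrightarrow> Re (\<Phi> (of_real x)) = c1" "\<And>x. 0 < x \<Longrightarrow> x < \<delta> \<Longrightarrow> Re (\<Phi> (- of_real x)) = c2"
  shows "c2 - c1 = Re (N 0 * \<i> * of_real pi)"
proof -
  define g where "g t = (if t = 0 then deriv N 0 else (N t - N 0) / (t - 0))" for t
  have "g holomorphic_on ball 0 \<delta>" unfolding g_def by (rule pole_lemma[OF N]) (use \<delta> in simp)
  then obtain G where "\<And>t. t \<in> ball 0 \<delta> \<Longrightarrow> (G has_field_derivative g t) (at t within ball 0 \<delta>)"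
    by (rule holomorphic_convex_primitive'[OF convex_ball open_ball]) blast
  then have G: "(G has_field_derivative g t) (at t)" if "t \<in> ball 0 \<delta>" for t
    using that at_within_open[OF that open_ball] by metis
  \<comment> \<open>\<open>Ln (- \<i> * t) + \<i> * of_real pi / 2\<close> is the logarithm of t
    with its cut turned to the negative imaginary axis, hence continuous on the closed upper half
    plane without 0.\<close>
  define \<Psi> where "\<Psi> t = N 0 * (Ln (- \<i> * t) + \<i> * of_real pi / 2) + G t" for t
  have nonpos: "- \<i> * t \<notin> \<real>\<^sub>\<le>\<^sub>0" if "t \<in> closure upper" "t \<noteq> 0" for t
    using that by (auto simp: upper_props complex_nonpos_Reals_iff complex_eq_iff)
  have Gc: "continuous_on (ball 0 \<delta>) G"
    using G by (intro continuous_at_imp_continuous_on ballI DERIV_isCont) blast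
  have \<Psi>c: "continuous_on (closure upper \<inter> (ball 0 \<delta> - {0})) \<Psi>"
    unfolding \<Psi>_def by (intro continuous_intros continuous_on_subset[OF Gc]) (use nonpos in auto)
  let ?O = "upper \<inter> ball 0 \<delta>"
  have "((\<lambda>t. \<Phi> t - \<Psi> t) has_field_derivative 0) (at t within ?O)" if t: "t \<in> ?O" for t
  proof -
    have t0: "t \<noteq> 0" using t upper_props(4) by auto
    have "t \<in> closure upper" using t closure_subset by auto
    then have np: "- \<i> * t \<notin> \<real>\<^sub>\<le>\<^sub>0" using t0 nonpos by blast
    have Gt: "(G has_field_derivative (N t - N 0) / t) (at t)" using G[of t] t t0 by (simp add: g_def)
    have "(\<Psi> has_field_derivative N 0 * (inverse (- \<i> * t) * (- \<i> * 1)) + (N t - N 0) / t) (at t)"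
      unfolding \<Psi>_def
      by (rule derivative_eq_intros Gt np refl | simp)+
    moreover have "N 0 * (inverse (- \<i> * t) * (- \<i> * 1)) + (N t - N 0) / t = N t / t"
      using t0 by (simp add: field_simps)
    ultimately have "(\<Psi> has_field_derivative N t / t) (at t)" by simp
    from DERIV_diff[OF \<Phi>(2)[OF t] this] show ?thesis by (simp add: has_field_derivative_at_within)
  qed
  then have "\<exists>K. \<forall>t\<in>?O. \<Phi> t - \<Psi> t = K"
    by (rule has_field_derivative_zero_constant[OF convex_Int[OF upper_props(2) convex_ball]])
  then obtain K where K: "\<And>t. t \<in> ?O \<Longrightarrow> \<Phi> t = \<Psi> t + K" by (metis add.commute diff_eq_eq)
  have eq: "\<Phi> t = \<Psi> t + K" if t: "t \<in> closure upper" "t \<in> ball 0 \<delta>" "t \<noteq> 0" for t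
    by (rule eq_at_closure[where f = \<Phi> and g = "\<lambda>t. \<Psi> t + K" and B = "ball 0 \<delta> - {0}", OF t(1) _ _ \<Phi>(1)])
      (use t \<Psi>c K in \<open>auto intro: continuous_intros\<close>)
  have step: "Re (G (- of_real x) - G (of_real x)) = c2 - c1 - Re (N 0 * \<i> * of_real pi)" if x: "0 < x" "x < \<delta>" for x
  proof -
    have "Ln (- \<i> * of_real x) = of_real (ln x) + Ln (- \<i>)" "Ln (\<i> * of_real x) = of_real (ln x) + Ln \<i>"
      using Ln_times_of_real[of x "- \<i>"] Ln_times_of_real[of x "\<i>"] Ln_of_real[of x] x(1) by (simp_all add: mult.commute)
    then have L: "Ln (- (\<i> * of_real x)) = of_real (ln x) - \<i> * of_real pi / 2" "Ln (\<i> * of_real x) = of_real (ln x) + \<i> * of_real pi / 2"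
      by simp_all
    have "\<Phi> (- of_real x) - \<Phi> (of_real x) = \<Psi> (- of_real x) - \<Psi> (of_real x)"
      using eq[of "of_real x"] eq[of "- of_real x"] x by (simp add: upper_props)
    also have "\<dots> = N 0 * \<i> * of_real pi + (G (- of_real x) - G (of_real x))"
      by (simp add: \<Psi>_def L algebra_simps)
    finally have "Re (\<Phi> (- of_real x) - \<Phi> (of_real x)) = Re (N 0 * \<i> * of_real pi) + Re (G (- of_real x) - G (of_real x))"
      by (simp only: plus_complex.sel)
    then show ?thesis using c[OF x] by (simp only: minus_complex.sel)
  qed
  have "isCont G 0" using G[of 0] \<delta> DERIV_isCont by auto
  then have G0: "(G \<longlongrightarrow> G 0) (nhds 0)" by (simp add: continuous_at_imp_continuous_within isCont_def tendsto_nhds_iff)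
  have "((\<lambda>x::real. of_real x) \<longlongrightarrow> complex_of_real 0) (at_right 0)" "((\<lambda>x::real. - of_real x) \<longlongrightarrow> - complex_of_real 0) (at_right 0)"
    by (intro tendsto_intros)+
  then have "((\<lambda>x. G (of_real x)) \<longlongrightarrow> G 0) (at_right 0)" "((\<lambda>x. G (- of_real x)) \<longlongrightarrow> G 0) (at_right 0)"
    by (auto intro!: filterlim_compose[OF G0])
  then have "((\<lambda>x. Re (G (- of_real x) - G (of_real x))) \<longlongrightarrow> Re (G 0 - G 0)) (at_right 0)"
    by (intro tendsto_intros)
  moreover have "eventually (\<lambda>x. Re (G (- of_real x) - G (of_real x)) = c2 - c1 - Re (N 0 * \<i> * of_real pi)) (at_right 0)"
    using eventually_at_right_real[OF \<delta>] by eventually_elim (rule step, auto)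
  ultimately have "((\<lambda>x::real. c2 - c1 - Re (N 0 * \<i> * of_real pi)) \<longlongrightarrow> Re (G 0 - G 0)) (at_right 0)"
    by (rule Lim_transform_eventually)
  then have "c2 - c1 - Re (N 0 * \<i> * of_real pi) = Re (G 0 - G 0)"
    using tendsto_unique[OF trivial_limit_at_right_real tendsto_const] by metis
  then show ?thesis by simp
qed

context branch_data
begin

text \<open>The part of the real axis where P is nonpositive. Including the endpoints is harmless,
  since \<open>wb\<close> vanishes there.\<close>

definition imaginary :: "real set" where
  "imaginary = {b1..a 1} \<union> {a 2..a 3} \<union> {a 4..a 5}"

lemma wb_real: "wb (of_real x) = of_real (\<Prod>r\<leftarrow>[a 1, a 2, a 3, a 4, a 5, b1]. sqrt \<bar>x - r\<bar>) * (\<Prod>r\<leftarrow>[a 1, a 2, a 3, a 4, a 5, b1]. if x \<ge> r then 1 else \<i>)"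
  unfolding w_branch_def of_real_diff [symmetric] csqrt_of_real' by (simp add: mult_ac)

lemma wb_real_0: "wb (of_real x) = 0 \<longleftrightarrow> x \<in> roots"
  by (auto simp: wb_0 poly_P_0)

text \<open>The number of factors \<open>\<i>\<close> in \<open>wb_real\<close> is the number of
  roots to the right of x; \<open>wb\<close> is imaginary where this number is odd.\<close>

lemma cnj_wb: "cnj (wb (of_real x)) = (if x \<in> imaginary then - wb (of_real x) else wb (of_real x))"
proof (cases "x \<in> roots")
  case True
  then show ?thesis using wb_real_0[of x] by simp
next
  case False
  then consider "x < b1" | "b1 < x" "x < a 1" | "a 1 < x" "x < a 2" | "a 2 < x" "x < a 3" | "a 3 < x" "x < a 4"
    | "a 4 < x" "x < a 5" | "a 5 < x"
    unfolding roots_def by (metis insertCI linorder_neqE_linordered_idom)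
  then show ?thesis
    unfolding wb_real by cases (use a b1_neg in \<open>simp_all add: imaginary_def\<close>)
qed

lemma neg_kappa_iff:
  assumes "\<kappa> = 1 \<or> \<kappa> = - 1" "x \<notin> roots"
  shows "wb (of_real x) = - of_real \<kappa> * cnj (wb (of_real x)) \<longleftrightarrow> (x \<in> imaginary \<longleftrightarrow> \<kappa> = 1)"
  using assms wb_real_0[of x] by (auto simp: cnj_wb)

end

section \<open>The primitive on the real axis and its jumps at the poles\<close>

locale upper_primitive = branch_data +
  fixes q :: "nat \<Rightarrow> complex" and f :: "hpoint \<Rightarrow> complex" and F :: "complex \<Rightarrow> complex" and \<kappa> :: real
  assumes f: "has_density 0 q f" and \<kappa>: "\<kappa> = 1 \<or> \<kappa> = - 1" and q: "\<And>i. cnj (q i) = of_real \<kappa> * q i"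
    and F: "\<And>z. z \<in> upper \<Longrightarrow> (F has_field_derivative cubic q z / (z * wb z)) (at z)" "continuous_on (closure upper - {0}) F"
begin

definition dens :: "real \<Rightarrow> complex" where "dens x = cubic q (of_real x) / (of_real x * wb (of_real x))"

lemma z_chart_value:
  assumes U: "(U, zc) \<in> X" "p \<in> U" "zc p \<noteq> 0"
  shows "form_of f zc (U, zc) (zc p) = cubic q (zc p) / (zc p * wc p)"
proof -
  obtain G where G: "open G" "U = aff.cut G" "inj_on zc U" "\<forall>p\<in>U. wc p \<noteq> 0" using z_chartE[OF U(1)] by metis
  note zf = z_chart_facts[OF G]
  have inv: "inv_into U zc (zc p) = p" using G(3) U(2) by simp
  let ?g = "\<lambda>t. (0 + cubic q t / wc (inv_into U zc t)) / t"
  have nz: "wc (inv_into U zc s) \<noteq> 0" if "s \<in> zc ` U" for s using that G(4) inv_into_into by metis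
  have O: "open (zc ` U - {0})" "zc p \<in> zc ` U - {0}" using zf(1) U by auto
  have "?g holomorphic_on zc ` U - {0}"
    by (intro holomorphic_intros holomorphic_on_subset[OF zf(2)]) (use nz in auto)
  then have "?g analytic_on {zc p}" using O unfolding analytic_at by blast
  moreover have "eventually (\<lambda>t. raw f (U, zc) t = ?g t) (at (zc p))"
    using eventually_at_in_open'[OF O] by eventually_elim (rule raw_z[OF f G], auto)
  ultimately have "form_of f zc (U, zc) (zc p) = ?g (zc p)" by (rule form_value[rotated])
  then show ?thesis by (simp add: inv)
qed

text \<open>\<open>F\<close> is a primitive only over the open half plane. At a real point that is
  neither 0 nor a branch point it differs by a constant from a primitive in a z-chart, which is
  holomorphic on a full neighbourhood and can be differentiated along the axis.\<close>

lemma F_vector_derivative: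
  assumes x: "x \<noteq> 0" "x \<notin> roots"
  shows "((\<lambda>x. F (of_real x)) has_vector_derivative dens x) (at x)"
proof -
  let ?z = "complex_of_real x" and ?p = "lift wb (of_real x)"
  have p: "?p \<in> affine_points P" "wc ?p \<noteq> 0" using x wb_real_0 wb_square by auto
  then obtain G where G: "?p \<in> aff.cut G" "(aff.cut G, zc) \<in> X" using z_chart_at by metis
  have "?p \<notin> E" using E_iff(1)[OF p(1)] x by simp
  then obtain V h where V: "open V" "?z \<in> V" "\<And>t. t \<in> V \<Longrightarrow> (h has_field_derivative form_of f zc (aff.cut G, zc) t) (at t)"
    using local_primitive[OF f G(2,1)] unfolding zc.simps by metis
  have z0: "?z \<in> closure upper" by (simp add: upper_props)
  obtain \<delta> K where \<delta>: "\<delta> > 0" "\<And>z. z \<in> closure upper \<inter> ball ?z \<delta> \<Longrightarrow> F z = h z + K"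
    using sector_closure[OF f upper_props(1,2,4) wb_continuous wb_square wb_nonzero F G(2) zc_ne_uc z0 G(1) _ V(1) _ V(3)] V(2) x
    by (smt (verit) of_real_eq_0_iff zc.simps(1))
  have "(h has_field_derivative dens x) (at ?z)"
    using V(3)[OF V(2)] z_chart_value[OF G(2,1)] x by (simp add: dens_def)
  then have "((\<lambda>x. h (of_real x) + K) has_vector_derivative dens x) (at x)"
    by (simp add: has_vector_derivative_add_const has_vector_derivative_real_field)
  moreover have "x \<in> ball x \<delta>" using \<delta>(1) by simp
  moreover have "h (of_real y) + K = F (of_real y)" if "y \<in> ball x \<delta>" for y
    using \<delta>(2)[of "of_real y"] that by (simp add: upper_props dist_of_real)
  ultimately show ?thesis
    by (rule has_vector_derivative_transform_within_open[OF _ open_ball])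
qed

lemma F_real_continuous: "0 \<notin> S \<Longrightarrow> continuous_on S (\<lambda>x. F (of_real x))"
  by (rule continuous_on_compose2[OF F(2)]) (auto intro: continuous_intros simp: upper_props)

text \<open>Differentiability is used only inside the interval. At the endpoints, possibly branch
  points with unbounded integrand, continuity of \<open>F\<close> suffices.\<close>

lemma F_integral:
  assumes "\<alpha> \<le> \<beta>" "0 \<notin> {\<alpha>..\<beta>}" "{\<alpha><..<\<beta>} \<inter> roots = {}"
  shows "(dens has_integral F (of_real \<beta>) - F (of_real \<alpha>)) {\<alpha>..\<beta>}"
proof (rule fundamental_theorem_of_calculus_interior[OF assms(1) F_real_continuous[OF assms(2)]])
  show "((\<lambda>x. F (of_real x)) has_vector_derivative dens x) (at x)" if "x \<in> {\<alpha><..<\<beta>}" for x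
    by (rule F_vector_derivative) (use that assms in auto)
qed

text \<open>Conjugation multiplies the numerator by \<open>\<kappa>\<close> and \<open>wb\<close> by
  \<open>- \<kappa>\<close>, so the integrand is imaginary and Re F has derivative 0.\<close>

lemma Re_F_const:
  assumes "\<alpha> \<le> \<beta>" "0 \<notin> {\<alpha>..\<beta>}" "{\<alpha><..<\<beta>} \<inter> roots = {}" "\<And>x. x \<in> {\<alpha><..<\<beta>} \<Longrightarrow> x \<in> imaginary \<longleftrightarrow> \<kappa> = 1"
  shows "Re (F (of_real \<beta>)) = Re (F (of_real \<alpha>))"
proof (cases "\<alpha> < \<beta>")
  case True
  have "((\<lambda>x. Re (F (of_real x))) has_real_derivative 0) (at x)" if x: "x \<in> {\<alpha><..<\<beta>}" for x
  proof -
    have xr: "x \<notin> roots" "x \<noteq> 0" using x assms by auto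
    have qc: "cnj (cubic q (of_real x)) = of_real \<kappa> * cubic q (of_real x)"
      unfolding cubic_def by (simp add: q sum_distrib_left mult_ac)
    have "cnj (wb (of_real x)) = - of_real \<kappa> * wb (of_real x)"
      using cnj_wb[of x] assms(4)[OF x] \<kappa> by auto
    then have "cnj (dens x) = - dens x" using \<kappa> by (auto simp: dens_def qc)
    then have "Re (dens x) = 0" by (simp add: complex_eq_iff)
    moreover have "((\<lambda>x. Re (F (of_real x))) has_vector_derivative Re (dens x)) (at x)"
      by (rule bounded_linear.has_vector_derivative[OF bounded_linear_Re F_vector_derivative[OF xr(2,1)]])
    ultimately show ?thesis by (simp add: has_real_derivative_iff_has_vector_derivative)
  qed
  then show ?thesis
    using F_real_continuous[OF assms(2)] True
    by (intro DERIV_isconst_end[of \<alpha> \<beta> "\<lambda>x. Re (F (of_real x))"]) (auto intro: continuous_intros)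
qed (use assms in auto)

text \<open>The pole 0 lies between the neighbouring roots \<open>b1\<close> and \<open>a 1\<close>,
  and Re F is constant on both parts. By \<open>log_jump\<close> the jump is Re (i pi r) with the
  residue r = q 0 / w(0), and \<open>m_square\<close> gives r = +-i. The sign depends on the branch
  and is left open.\<close>

lemma jump_at_0:
  assumes \<kappa>1: "\<kappa> = 1" and q0: "q 0 = of_real (a 1 * a 3 * a 5)"
  shows "Re (F (of_real (b1))) - Re (F (of_real (a 1))) \<in> {pi, - pi}"
proof -
  let ?p = "lift wb 0"
  have p: "?p \<in> affine_points P" "wc ?p \<noteq> 0" using wb_square P0 wb_0[of 0] by auto
  then have "?p \<in> aff.cut UNIV" by (simp add: aff.cut_def)
  then obtain \<delta> s where s: "\<delta> > 0" "s holomorphic_on ball 0 \<delta>" "s 0 = wb 0"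
    "\<And>t. t \<in> ball 0 \<delta> \<Longrightarrow> s t \<noteq> 0"
    "\<And>r. r \<in> affine_points P \<Longrightarrow> zc r \<in> ball 0 \<delta> \<Longrightarrow> wc r \<in> ball (wb 0) (norm (wb 0)) \<Longrightarrow> wc r = s (zc r)"
    using aff.section_in_cut[OF open_UNIV _ p(2)] unfolding zc.simps wc.simps by metis
  have "0 < norm (wb 0)" using p(2) by simp
  moreover have "0 \<in> closure upper" by (simp add: upper_props)
  ultimately obtain d where d: "d > 0" "\<And>z. z \<in> closure upper \<Longrightarrow> dist z 0 < d \<Longrightarrow> dist (wb z) (wb 0) < norm (wb 0)"
    using wb_continuous unfolding continuous_on_iff by blast
  define e where "e = min (min \<delta> d) (min (- b1) (a 1))"
  have e: "e > 0" using s(1) d(1) a b1_neg by (simp add: e_def)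
  have wbs: "wb z = s z" if "z \<in> closure upper" "z \<in> ball 0 e" for z
    using s(5)[of "lift wb z"] d(2)[OF that(1)] that(2) wb_square by (simp add: e_def dist_commute)
  have "Re (F (of_real b1)) - Re (F (of_real (a 1))) = Re ((cubic q 0 / s 0) * \<i> * of_real pi)"
  proof (rule log_jump[OF e, of "\<lambda>t. cubic q t / s t" F])
    show "(\<lambda>t. cubic q t / s t) holomorphic_on ball 0 e"
      by (intro holomorphic_intros holomorphic_on_subset[OF s(2)]) (use s(4) in \<open>auto simp: e_def\<close>)
    show "continuous_on (closure upper \<inter> (ball 0 e - {0})) F" by (rule continuous_on_subset[OF F(2)]) auto
    show "(F has_field_derivative cubic q t / s t / t) (at t)" if t: "t \<in> upper \<inter> ball 0 e" for t
    proof -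
      have "t \<in> closure upper" using t closure_subset by auto
      then show ?thesis using F(1)[of t] wbs[of t] t by (simp add: mult.commute)
    qed
    fix x assume x: "0 < x" "x < e"
    show "Re (F (of_real x)) = Re (F (of_real (a 1)))"
      by (rule Re_F_const [symmetric]) (use x a b1_neg \<kappa>1 in \<open>auto simp: e_def roots_def imaginary_def\<close>)
    have "Re (F (of_real (- x))) = Re (F (of_real b1))"
      by (rule Re_F_const) (use x a b1_neg \<kappa>1 in \<open>auto simp: e_def roots_def imaginary_def\<close>)
    then show "Re (F (- of_real x)) = Re (F (of_real b1))" by simp
  qed
  moreover have "cubic q 0 / s 0 = \<i> \<or> cubic q 0 / s 0 = - \<i>"
  proof -
    have "(cubic q 0 / s 0)\<^sup>2 = - 1"
      using wb_square[of 0] m_square p(2) a by (simp add: s(3) cubic_def q0 power_divide field_simps sum.atMost_Suc_shift)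
    then have "(cubic q 0 / s 0)\<^sup>2 = \<i>\<^sup>2" by simp
    then show ?thesis by (simp only: power2_eq_iff)
  qed
  then have "Re ((cubic q 0 / s 0) * \<i> * of_real pi) \<in> {pi, - pi}" by (elim disjE) (simp_all only: , simp_all)
  ultimately show ?thesis by simp
qed

text \<open>The map t to -1/t preserves the upper half plane and exchanges 0 and infinity, so
  \<open>log_jump\<close> applies to F(-1/t). Small positive t correspond to z below
  \<open>b1\<close>, small negative t to z above \<open>a 5\<close>.\<close>

lemma jump_at_infinity:
  assumes \<kappa>1: "\<kappa> = - 1" and q3: "q 3 = \<i>"
  shows "Re (F (of_real (b1))) - Re (F (of_real (a 5))) \<in> {pi, - pi}"
proof -
  let ?p = "upoint 0 1"
  have p: "?p \<in> infpts" "vc 3 ?p \<noteq> 0" using lead_P by (auto simp: upoint_def)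
  then have "?p \<in> inf.cut UNIV" by (simp add: inf.cut_def)
  then obtain \<delta> s where s: "\<delta> > 0" "s holomorphic_on ball 0 \<delta>" "s 0 = 1"
    "\<And>t. t \<in> ball 0 \<delta> \<Longrightarrow> upoint t (s t) \<in> inf.cut UNIV \<and> s t \<noteq> 0"
    using inf.section_in_cut[OF open_UNIV _ p(2)] unfolding uc_upoint vc_upoint by metis
  define e where "e = min \<delta> (min (- 1 / b1) (1 / a 5))"
  have e: "e > 0" using s(1) a b1_neg by (auto simp: e_def)
  have inv_upper: "- 1 / t \<in> upper" if "t \<in> upper" for t
    using that by (auto simp: upper_def Im_divide divide_simps sum_power2_gt_zero_iff)
  have inv_closure: "- 1 / t \<in> closure upper - {0}" if "t \<in> closure upper" "t \<noteq> 0" for t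
    using that by (auto simp: upper_props Im_divide intro!: divide_nonneg_nonneg)
  let ?O = "upper \<inter> ball 0 e"
  \<comment> \<open>The coordinate v = w u^3 of the branch \<open>wb\<close> at u = -t, divided by
    the holomorphic section \<open>s\<close> through v = 1. Its square is 1, so by connectedness it
    is a constant sign.\<close>
  define k where "k t = - (t ^ 3) * wb (- 1 / t) / s (- t)" for t
  have k2: "(k t)\<^sup>2 = 1" if t: "t \<in> ?O" for t
  proof -
    have t0: "t \<noteq> 0" using t upper_props(4) by auto
    have st: "(s (- t))\<^sup>2 = poly R (- t)" "s (- t) \<noteq> 0" using s(4)[of "- t"] t by (auto simp: e_def inf.mk_in_cut)
    have "poly R (- t) = (- t) ^ 6 * poly P (1 / - t)" by (rule poly_R) (use t0 in simp)
    also have "\<dots> = (- (t ^ 3) * wb (- 1 / t))\<^sup>2" by (simp add: wb_square power_mult_distrib flip: power_mult)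
    finally have "(k t)\<^sup>2 = (s (- t))\<^sup>2 / (s (- t))\<^sup>2" using st(1) by (simp add: k_def power_divide)
    then show ?thesis using st(2) by simp
  qed
  have kc: "continuous_on ?O k"
    unfolding k_def
  proof (intro continuous_intros)
    show "continuous_on ?O (\<lambda>t. wb (- 1 / t))"
      by (rule continuous_on_compose2[OF wb_continuous])
        (use inv_upper upper_props(4) closure_subset[of upper] in \<open>auto intro!: continuous_intros\<close>)
    show "continuous_on ?O (\<lambda>t. s (- t))"
      by (rule continuous_on_compose2[OF holomorphic_on_imp_continuous_on[OF s(2)]]) (auto intro: continuous_intros simp: e_def)
    show "\<forall>t\<in>?O. s (- t) \<noteq> 0" using s(4) by (auto simp: e_def)
  qed
  have "connected ?O" by (intro convex_connected convex_Int upper_props convex_ball)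
  then obtain \<sigma> where \<sigma>: "\<And>t. t \<in> ?O \<Longrightarrow> k t = \<sigma>" "\<sigma> = 1 \<or> \<sigma> = - 1"
  proof -
    have fin: "finite (k ` ?O)" by (rule finite_subset[of _ "{1, - 1}"]) (use k2 power2_eq_1_iff in blast, simp)
    have "k constant_on ?O"
      using continuous_finite_range_constant[OF \<open>connected ?O\<close> kc fin] .
    then obtain \<sigma> where \<sigma>: "\<And>t. t \<in> ?O \<Longrightarrow> k t = \<sigma>" by (auto simp: constant_on_def)
    have "\<i> * of_real (e / 2) \<in> ?O" using e by (auto simp: upper_def norm_mult)
    then have "\<sigma>\<^sup>2 = 1" using k2 \<sigma> by metis
    then show ?thesis using that[of \<sigma>] \<sigma> by (auto simp: power2_eq_1_iff)
  qed
  define \<Phi> where "\<Phi> t = F (- 1 / t)" for t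
  have "Re (F (of_real (a 5))) - Re (F (of_real b1)) = Re ((- \<sigma> * cubic_rev q (- 0) / s (- 0)) * \<i> * of_real pi)"
  proof (rule log_jump[OF e, of "\<lambda>t. - \<sigma> * cubic_rev q (- t) / s (- t)" \<Phi>])
    have "(\<lambda>t. s (- t)) holomorphic_on ball 0 e"
      by (rule holomorphic_on_compose_gen[OF _ s(2), unfolded o_def]) (auto intro: holomorphic_intros simp: e_def)
    then show "(\<lambda>t. - \<sigma> * cubic_rev q (- t) / s (- t)) holomorphic_on ball 0 e"
      by (intro holomorphic_intros) (use s(4) in \<open>auto simp: e_def\<close>)
    show "continuous_on (closure upper \<inter> (ball 0 e - {0})) \<Phi>"
      unfolding \<Phi>_def
      by (rule continuous_on_compose2[OF F(2)]) (use inv_closure in \<open>auto intro!: continuous_intros\<close>)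
    show "(\<Phi> has_field_derivative - \<sigma> * cubic_rev q (- t) / s (- t) / t) (at t)" if t: "t \<in> ?O" for t
    proof -
      have t0: "t \<noteq> 0" using t upper_props(4) by auto
      have st: "s (- t) \<noteq> 0" using s(4)[of "- t"] t by (auto simp: e_def)
      let ?z = "- 1 / t"
      have z: "?z \<in> upper" using inv_upper t by blast
      have wz: "wb ?z \<noteq> 0" by (rule wb_nonzero[OF z])
      have "((\<lambda>t. - 1 / t) has_field_derivative 1 / t\<^sup>2) (at t)"
        using t0 by (auto intro!: derivative_eq_intros simp: power2_eq_square)
      then have "(\<Phi> has_field_derivative cubic q ?z / (?z * wb ?z) * (1 / t\<^sup>2)) (at t)"
        unfolding \<Phi>_def by (rule DERIV_chain2[where f = F and g = "\<lambda>t. - 1 / t" and x = t, OF F(1)[OF z]])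
      moreover have "cubic q ?z / (?z * wb ?z) * (1 / t\<^sup>2) = - \<sigma> * cubic_rev q (- t) / s (- t) / t"
      proof -
        have "(- t) ^ 3 * cubic q (1 / - t) = cubic_rev q (- t)" by (rule cubic_inverse) (use t0 in simp)
        then have cr: "cubic_rev q (- t) = - (t ^ 3) * cubic q ?z" by simp
        have "\<sigma> * s (- t) = - (t ^ 3) * wb ?z" using \<sigma>(1)[OF t] st by (simp add: k_def field_simps)
        then have ss: "s (- t) = - \<sigma> * t ^ 3 * wb ?z" using \<sigma>(2) by (auto simp: algebra_simps)
        have "\<sigma> * \<sigma> = 1" using \<sigma>(2) by auto
        then show ?thesis using \<sigma>(2) t0 wz unfolding cr ss by (auto simp: field_simps power2_eq_square)
      qed
      ultimately show ?thesis by simp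
    qed
    fix x assume x: "0 < x" "x < e"
    have xb: "- 1 / x < b1" and xa: "1 / x > a 5" using x a b1_neg by (auto simp: e_def field_simps)
    have "Re (F (of_real b1)) = Re (F (of_real (- 1 / x)))"
      by (rule Re_F_const) (use x xb a b1_neg \<kappa>1 in \<open>auto simp: roots_def imaginary_def\<close>)
    then show "Re (\<Phi> (of_real x)) = Re (F (of_real b1))" by (simp add: \<Phi>_def)
    have "Re (F (of_real (1 / x))) = Re (F (of_real (a 5)))"
      by (rule Re_F_const) (use x xa a b1_neg \<kappa>1 in \<open>auto simp: roots_def imaginary_def\<close>)
    then show "Re (\<Phi> (- of_real x)) = Re (F (of_real (a 5)))" by (simp add: \<Phi>_def)
  qed
  moreover have "{..3::nat} = {0, 1, 2, 3}" by auto
  then have "cubic_rev q 0 = \<i>" by (simp add: cubic_rev_def q3)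
  ultimately show ?thesis using \<sigma>(2) s(3) by auto
qed

end

section \<open>The real integrals and the choice of the parameters\<close>

text \<open>A primitive is the arcsine of the affine rescaling of the interval to [-1, 1], and the
  integrand is nonnegative.\<close>

lemma inverse_sqrt_absolutely_integrable:
  fixes \<alpha> \<beta> :: real
  assumes "\<alpha> < \<beta>"
  shows "(\<lambda>x. 1 / sqrt ((x - \<alpha>) * (\<beta> - x))) absolutely_integrable_on {\<alpha>..\<beta>}"
proof -
  let ?y = "\<lambda>x. (2 * x - \<alpha> - \<beta>) / (\<beta> - \<alpha>)"
  have y: "- 1 \<le> ?y x \<and> ?y x \<le> 1" if "x \<in> {\<alpha>..\<beta>}" for x
    using that assms by (auto simp: field_simps)
  have "((\<lambda>x. 1 / sqrt ((x - \<alpha>) * (\<beta> - x))) has_integral arcsin (?y \<beta>) - arcsin (?y \<alpha>)) {\<alpha>..\<beta>}"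
  proof (rule fundamental_theorem_of_calculus_interior[of \<alpha> \<beta> "\<lambda>x. arcsin (?y x)"])
    show "continuous_on {\<alpha>..\<beta>} (\<lambda>x. arcsin (?y x))"
      using y assms by (intro continuous_intros) auto
    fix x assume x: "x \<in> {\<alpha><..<\<beta>}"
    have yx: "- 1 < ?y x" "?y x < 1" using x assms by (auto simp: field_simps)
    have "1 - (?y x)\<^sup>2 = ((\<beta> - \<alpha>)\<^sup>2 - (2 * x - \<alpha> - \<beta>)\<^sup>2) / (\<beta> - \<alpha>)\<^sup>2"
      using assms unfolding power_divide diff_divide_distrib[of "(\<beta> - \<alpha>)\<^sup>2" "(2 * x - \<alpha> - \<beta>)\<^sup>2" "(\<beta> - \<alpha>)\<^sup>2"] by simp
    also have "(\<beta> - \<alpha>)\<^sup>2 - (2 * x - \<alpha> - \<beta>)\<^sup>2 = 2\<^sup>2 * ((x - \<alpha>) * (\<beta> - x))"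
      by (simp add: power2_eq_square algebra_simps)
    finally have "sqrt (1 - (?y x)\<^sup>2) = 2 * sqrt ((x - \<alpha>) * (\<beta> - x)) / (\<beta> - \<alpha>)"
      using assms by (simp add: real_sqrt_divide real_sqrt_mult)
    moreover have "((\<lambda>x. arcsin (?y x)) has_real_derivative inverse (sqrt (1 - (?y x)\<^sup>2)) * (2 / (\<beta> - \<alpha>))) (at x)"
      by (rule DERIV_chain2[where f = arcsin and g = ?y, OF DERIV_arcsin[OF yx]]) (intro DERIV_cdivide, auto intro!: derivative_eq_intros)
    ultimately have "((\<lambda>x. arcsin (?y x)) has_real_derivative 1 / sqrt ((x - \<alpha>) * (\<beta> - x))) (at x)"
      using assms by (simp add: field_simps)
    then show "((\<lambda>x. arcsin (?y x)) has_vector_derivative 1 / sqrt ((x - \<alpha>) * (\<beta> - x))) (at x)"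
      by (simp add: has_real_derivative_iff_has_vector_derivative)
  qed (use assms in simp)
  then show ?thesis
    by (intro nonnegative_absolutely_integrable_1) auto
qed

text \<open>Cramer's rule: the means M1/M0 \<le> \<beta> and N1/N0 \<ge> \<gamma> are separated, so
  the determinant is positive.\<close>

lemma linear_moments_solvable:
  fixes M0 M1 N0 N1 c d \<beta> \<gamma> :: real
  assumes "M0 > 0" "N0 > 0" "M1 \<le> \<beta> * M0" "\<gamma> * N0 \<le> N1" "\<beta> < \<gamma>"
  shows "\<exists>s t. c + s * M0 + t * M1 = 0 \<and> d + s * N0 + t * N1 = 0"
proof -
  have "M1 * N0 \<le> \<beta> * M0 * N0" "\<gamma> * N0 * M0 \<le> N1 * M0" "\<beta> * (M0 * N0) < \<gamma> * (M0 * N0)"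
    using assms by (auto intro: mult_right_mono mult_strict_right_mono)
  then have D: "M0 * N1 - M1 * N0 > 0" by (simp add: mult_ac)
  define D where "D = M0 * N1 - M1 * N0"
  have "c + ((d * M1 - c * N1) / D) * M0 + ((c * N0 - d * M0) / D) * M1 = (c * D + (d * M1 - c * N1) * M0 + (c * N0 - d * M0) * M1) / D"
    "d + ((d * M1 - c * N1) / D) * N0 + ((c * N0 - d * M0) / D) * N1 = (d * D + (d * M1 - c * N1) * N0 + (c * N0 - d * M0) * N1) / D"
    using D by (simp_all add: D_def [symmetric] add_divide_distrib)
  moreover have "c * D + (d * M1 - c * N1) * M0 + (c * N0 - d * M0) * M1 = 0" "d * D + (d * M1 - c * N1) * N0 + (c * N0 - d * M0) * N1 = 0"
    by (simp_all add: D_def algebra_simps)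
  ultimately show ?thesis by (metis div_0)
qed

section \<open>Weighted moments on the intervals between branch points\<close>

context branch_data
begin

text \<open>The modulus of \<open>wb\<close> on the real axis. The remaining factor,
  \<open>unit_at\<close>, is a power of \<open>\<i>\<close> and constant between neighbouring
  roots.\<close>

definition W :: "real \<Rightarrow> real" where "W x = (\<Prod>r\<in>roots. sqrt \<bar>x - r\<bar>)"
definition unit_at :: "real \<Rightarrow> complex" where "unit_at x = (\<Prod>r\<in>roots. if r \<le> x then 1 else \<i>)"

lemma finite_roots: "finite roots" by (simp add: roots_def)

lemma wb_W: "wb (of_real x) = of_real (W x) * unit_at x"
  unfolding wb_real W_def unit_at_def roots_def using a b1_neg by (simp add: mult_ac)

definition consecutive :: "real \<Rightarrow> real \<Rightarrow> bool" where
  "consecutive \<alpha> \<beta> \<longleftrightarrow> 0 < \<alpha> \<and> \<alpha> < \<beta> \<and> \<alpha> \<in> roots \<and> \<beta> \<in> roots \<and> {\<alpha><..<\<beta>} \<inter> roots = {}"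

lemma consecutive_a: "k \<in> {1, 2, 3, 4} \<Longrightarrow> consecutive (a k) (a (k + 1))"
proof -
  have "consecutive (a 1) (a 2)" "consecutive (a 2) (a 3)" "consecutive (a 3) (a 4)" "consecutive (a 4) (a 5)"
    using a b1_neg unfolding consecutive_def roots_def by auto
  then show "k \<in> {1, 2, 3, 4} \<Longrightarrow> consecutive (a k) (a (k + 1))" by (auto simp: eval_nat_numeral)
qed

lemma unit_at_const: "consecutive \<alpha> \<beta> \<Longrightarrow> x \<in> {\<alpha><..<\<beta>} \<Longrightarrow> unit_at x = unit_at \<alpha>"
  unfolding unit_at_def
proof (intro prod.cong refl)
  fix r assume "consecutive \<alpha> \<beta>" "x \<in> {\<alpha><..<\<beta>}" "r \<in> roots"
  then have "\<not> (\<alpha> < r \<and> r < \<beta>)" "\<alpha> < x" "x < \<beta>" unfolding consecutive_def by (auto simp: disjoint_iff)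
  then have "r \<le> x \<longleftrightarrow> r \<le> \<alpha>" by linarith
  then show "(if r \<le> x then 1 else \<i>) = (if r \<le> \<alpha> then 1 else \<i>)" by simp
qed

lemma W_pos: "consecutive \<alpha> \<beta> \<Longrightarrow> x \<in> {\<alpha><..<\<beta>} \<Longrightarrow> 0 < W x"
  unfolding W_def consecutive_def by (intro prod_pos) (auto simp: disjoint_iff)

lemma W_split:
  assumes c: "consecutive \<alpha> \<beta>" and x: "x \<in> {\<alpha>..\<beta>}"
  shows "W x = sqrt ((x - \<alpha>) * (\<beta> - x)) * (\<Prod>r\<in>roots - {\<alpha>, \<beta>}. sqrt \<bar>x - r\<bar>)"
proof -
  have "W x = sqrt \<bar>x - \<alpha>\<bar> * (\<Prod>r\<in>roots - {\<alpha>}. sqrt \<bar>x - r\<bar>)"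
    unfolding W_def using c finite_roots by (intro prod.remove) (auto simp: consecutive_def)
  also have "(\<Prod>r\<in>roots - {\<alpha>}. sqrt \<bar>x - r\<bar>) = sqrt \<bar>x - \<beta>\<bar> * (\<Prod>r\<in>roots - {\<alpha>} - {\<beta>}. sqrt \<bar>x - r\<bar>)"
    using c finite_roots by (intro prod.remove) (auto simp: consecutive_def)
  also have "roots - {\<alpha>} - {\<beta>} = roots - {\<alpha>, \<beta>}" by blast
  finally show ?thesis using x by (simp add: real_sqrt_mult)
qed

text \<open>With the two endpoint factors split off, the rest of \<open>W\<close> is continuous and
  nonzero up to the endpoints; what remains is a bounded factor times an integrable inverse square
  root.\<close>

lemma absolutely_integrable_over_W:
  fixes v :: "real \<Rightarrow> real"
  assumes c: "consecutive \<alpha> \<beta>" and v: "continuous_on {\<alpha>..\<beta>} v"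
  shows "(\<lambda>x. v x / W x) absolutely_integrable_on {\<alpha>..\<beta>}"
proof -
  let ?S = "\<lambda>x. \<Prod>r\<in>roots - {\<alpha>, \<beta>}. sqrt \<bar>x - r\<bar>"
  have "?S x \<noteq> 0" if x: "x \<in> {\<alpha>..\<beta>}" for x
  proof -
    have "x \<notin> roots - {\<alpha>, \<beta>}"
    proof
      assume "x \<in> roots - {\<alpha>, \<beta>}"
      then have "x \<in> {\<alpha><..<\<beta>} \<inter> roots" using x by auto
      then show False using c unfolding consecutive_def by blast
    qed
    then show ?thesis using finite_roots by auto
  qed
  then have cont: "continuous_on {\<alpha>..\<beta>} (\<lambda>x. v x / ?S x)"
    by (intro continuous_intros v) auto
  have ab: "\<alpha> < \<beta>" using c by (simp add: consecutive_def)
  have "(\<lambda>x. v x / ?S x * (1 / sqrt ((x - \<alpha>) * (\<beta> - x)))) absolutely_integrable_on {\<alpha>..\<beta>}"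
  proof (rule absolutely_integrable_bounded_measurable_product_real)
    show "(\<lambda>x. v x / ?S x) \<in> borel_measurable (lebesgue_on {\<alpha>..\<beta>})"
      by (rule continuous_imp_measurable_on_sets_lebesgue[OF cont]) simp
    show "bounded ((\<lambda>x. v x / ?S x) ` {\<alpha>..\<beta>})"
      by (intro compact_imp_bounded compact_continuous_image cont) simp
  qed (use inverse_sqrt_absolutely_integrable[OF ab] in auto)
  then show ?thesis
    by (rule absolutely_integrable_spike[where S = "{}"]) (simp_all add: W_split[OF c])
qed

definition moment :: "real \<Rightarrow> real \<Rightarrow> (real \<Rightarrow> real) \<Rightarrow> real" where
  "moment \<alpha> \<beta> v = integral {\<alpha>..\<beta>} (\<lambda>x. v x / W x)"

lemma moment_has_integral:
  "consecutive \<alpha> \<beta> \<Longrightarrow> continuous_on {\<alpha>..\<beta>} v \<Longrightarrow> ((\<lambda>x. v x / W x) has_integral moment \<alpha> \<beta> v) {\<alpha>..\<beta>}"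
  unfolding moment_def using absolutely_integrable_over_W set_lebesgue_integral_eq_integral(1) integrable_integral by blast

lemma moment_mono:
  assumes c: "consecutive \<alpha> \<beta>" and uv: "continuous_on {\<alpha>..\<beta>} u" "continuous_on {\<alpha>..\<beta>} v" "\<And>x. x \<in> {\<alpha>..\<beta>} \<Longrightarrow> u x \<le> v x"
  shows "moment \<alpha> \<beta> u \<le> moment \<alpha> \<beta> v"
proof (rule has_integral_le[OF moment_has_integral[OF c uv(1)] moment_has_integral[OF c uv(2)]])
  show "u x / W x \<le> v x / W x" if "x \<in> {\<alpha>..\<beta>}" for x
    by (intro divide_right_mono uv(3) that) (simp add: W_def prod_nonneg)
qed

lemma moment_1_pos:
  assumes c: "consecutive \<alpha> \<beta>"
  shows "moment \<alpha> \<beta> (\<lambda>x. 1) > 0"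
proof -
  have ab: "\<alpha> < \<beta>" using c by (simp add: consecutive_def)
  have "continuous_on {\<alpha>..\<beta>} W" unfolding W_def by (intro continuous_intros)
  then have "bounded (W ` {\<alpha>..\<beta>})" by (intro compact_imp_bounded compact_continuous_image) auto
  then obtain B where B: "B > 0" "\<And>x. x \<in> {\<alpha>..\<beta>} \<Longrightarrow> \<bar>W x\<bar> \<le> B" unfolding bounded_pos by auto
  have "((\<lambda>x. 1 / B) has_integral (\<beta> - \<alpha>) / B) {\<alpha>..\<beta>}"
    using has_integral_const_real[of "1 / B" \<alpha> \<beta>] ab by simp
  \<comment> \<open>At the endpoints \<open>W\<close> is 0 and so is \<open>1 / W\<close> in HOL;
    the lower bound 1/B is replaced by 0 there.\<close>
  then have "((\<lambda>x. if x \<in> {\<alpha><..<\<beta>} then 1 / B else 0) has_integral (\<beta> - \<alpha>) / B) {\<alpha>..\<beta>}"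
    by (rule has_integral_spike_finite[of "{\<alpha>, \<beta>}", rotated 2]) auto
  moreover have "(if x \<in> {\<alpha><..<\<beta>} then 1 / B else 0) \<le> 1 / W x" if "x \<in> {\<alpha>..\<beta>}" for x
    using W_pos[OF c, of x] B(2)[OF that] by (auto simp: W_def intro!: divide_left_mono prod_nonneg)
  ultimately have "(\<beta> - \<alpha>) / B \<le> moment \<alpha> \<beta> (\<lambda>x. 1)"
    using has_integral_le[OF _ moment_has_integral[OF c, of "\<lambda>x. 1"]] by (simp add: continuous_on_const)
  moreover have "(\<beta> - \<alpha>) / B > 0" using ab B(1) by simp
  ultimately show ?thesis by linarith
qed

lemma moment_linear:
  assumes c: "consecutive \<alpha> \<beta>" and v: "continuous_on {\<alpha>..\<beta>} v"
  shows "moment \<alpha> \<beta> (\<lambda>x. v x + s + t * x) = moment \<alpha> \<beta> v + s * moment \<alpha> \<beta> (\<lambda>x. 1) + t * moment \<alpha> \<beta> (\<lambda>x. x)"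
proof (rule has_integral_unique)
  show "((\<lambda>x. (v x + s + t * x) / W x) has_integral moment \<alpha> \<beta> (\<lambda>x. v x + s + t * x)) {\<alpha>..\<beta>}"
    by (intro moment_has_integral c continuous_intros v)
  have "((\<lambda>x. v x / W x + s * (1 / W x) + t * (x / W x)) has_integral
      moment \<alpha> \<beta> v + s * moment \<alpha> \<beta> (\<lambda>x. 1) + t * moment \<alpha> \<beta> (\<lambda>x. x)) {\<alpha>..\<beta>}"
    by (intro has_integral_add has_integral_mult_right moment_has_integral c continuous_intros v)
  then show "((\<lambda>x. (v x + s + t * x) / W x) has_integral
      moment \<alpha> \<beta> v + s * moment \<alpha> \<beta> (\<lambda>x. 1) + t * moment \<alpha> \<beta> (\<lambda>x. x)) {\<alpha>..\<beta>}"
    by (simp add: add_divide_distrib)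
qed

text \<open>The weighted mean of x is at most \<open>\<beta>\<close> on the first interval and at
  least \<open>\<gamma>\<close> on the second, and \<open>s\<close>, \<open>t\<close> enter the
  moments linearly; so \<open>linear_moments_solvable\<close> applies.\<close>

lemma parameters_exist:
  assumes c: "consecutive \<alpha> \<beta>" "consecutive \<gamma> \<delta>" and "\<beta> < \<gamma>" and v: "continuous_on {0<..} v"
  shows "\<exists>s t. moment \<alpha> \<beta> (\<lambda>x. v x + s + t * x) = 0 \<and> moment \<gamma> \<delta> (\<lambda>x. v x + s + t * x) = 0"
proof -
  have vc: "continuous_on {\<alpha>..\<beta>} v" "continuous_on {\<gamma>..\<delta>} v"
    by (rule continuous_on_subset[OF v]; use c in \<open>auto simp: consecutive_def\<close>)+
  have scale: "moment \<alpha>' \<beta>' (\<lambda>x. k) = k * moment \<alpha>' \<beta>' (\<lambda>x. 1)" if "consecutive \<alpha>' \<beta>'" for \<alpha>' \<beta>' k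
    using moment_linear[OF that, of "\<lambda>x. 0" k 0] by (simp add: moment_def)
  have "moment \<alpha> \<beta> (\<lambda>x. x) \<le> moment \<alpha> \<beta> (\<lambda>x. \<beta>)" "moment \<gamma> \<delta> (\<lambda>x. \<gamma>) \<le> moment \<gamma> \<delta> (\<lambda>x. x)"
    by (intro moment_mono c continuous_intros; simp)+
  then have le: "moment \<alpha> \<beta> (\<lambda>x. x) \<le> \<beta> * moment \<alpha> \<beta> (\<lambda>x. 1)" "\<gamma> * moment \<gamma> \<delta> (\<lambda>x. 1) \<le> moment \<gamma> \<delta> (\<lambda>x. x)"
    using scale[OF c(1), of \<beta>] scale[OF c(2), of \<gamma>] by simp_all
  show ?thesis
    using linear_moments_solvable[OF moment_1_pos[OF c(1)] moment_1_pos[OF c(2)] le assms(3), of "moment \<alpha> \<beta> v" "moment \<gamma> \<delta> v"]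
    by (simp add: moment_linear c vc)
qed

end

context upper_primitive
begin

text \<open>Between neighbouring branch points the integrand is the real function v/W times a fixed
  complex number, so one real moment decides the complex integral.\<close>

lemma dens_integral:
  assumes c: "consecutive \<alpha> \<beta>" and v: "continuous_on {0<..} v" "\<And>x. 0 < x \<Longrightarrow> cubic q (of_real x) = k * of_real (x * v x)"
  shows "dens absolutely_integrable_on {\<alpha>..\<beta>}"
    and "integral {\<alpha>..\<beta>} dens = F (of_real \<beta>) - F (of_real \<alpha>)"
    and "moment \<alpha> \<beta> v = 0 \<Longrightarrow> F (of_real \<beta>) = F (of_real \<alpha>)"
proof -
  have vc: "continuous_on {\<alpha>..\<beta>} v" by (rule continuous_on_subset[OF v(1)]) (use c in \<open>auto simp: consecutive_def\<close>)
  have eq: "dens x = of_real (v x / W x) * (k / unit_at \<alpha>)" if "x \<in> {\<alpha>..\<beta>} - {\<alpha>, \<beta>}" for x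
    using that v(2)[of x] unit_at_const[OF c, of x] c by (simp add: dens_def wb_W consecutive_def)
  have bl: "bounded_linear complex_of_real" by (rule bounded_linear_of_real)
  have "(\<lambda>x. complex_of_real (v x / W x)) absolutely_integrable_on {\<alpha>..\<beta>}"
    using absolutely_integrable_linear[OF absolutely_integrable_over_W[OF c vc] bl] by (simp only: o_def)
  then have "(\<lambda>x. of_real (v x / W x) * (k / unit_at \<alpha>)) absolutely_integrable_on {\<alpha>..\<beta>}"
    using absolutely_integrable_linear[OF _ bounded_linear_mult_left, of _ _ "k / unit_at \<alpha>"] by (simp only: o_def)
  then show "dens absolutely_integrable_on {\<alpha>..\<beta>}"
    by (rule absolutely_integrable_spike[of _ _ "{\<alpha>, \<beta>}"]) (use eq in auto)
  have FI: "(dens has_integral F (of_real \<beta>) - F (of_real \<alpha>)) {\<alpha>..\<beta>}"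
    by (rule F_integral) (use c in \<open>auto simp: consecutive_def\<close>)
  then show "integral {\<alpha>..\<beta>} dens = F (of_real \<beta>) - F (of_real \<alpha>)" by (rule integral_unique)
  have "((\<lambda>x. complex_of_real (v x / W x)) has_integral of_real (moment \<alpha> \<beta> v)) {\<alpha>..\<beta>}"
    using has_integral_linear[OF moment_has_integral[OF c vc] bl] by (simp only: o_def)
  then have "((\<lambda>x. of_real (v x / W x) * (k / unit_at \<alpha>)) has_integral of_real (moment \<alpha> \<beta> v) * (k / unit_at \<alpha>)) {\<alpha>..\<beta>}"
    by (rule has_integral_mult_left)
  then have "(dens has_integral of_real (moment \<alpha> \<beta> v) * (k / unit_at \<alpha>)) {\<alpha>..\<beta>}"
    by (rule has_integral_spike_finite[of "{\<alpha>, \<beta>}", rotated 2]) (use eq in auto)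
  with FI have "F (of_real \<beta>) - F (of_real \<alpha>) = of_real (moment \<alpha> \<beta> v) * (k / unit_at \<alpha>)"
    by (rule has_integral_unique)
  then show "moment \<alpha> \<beta> v = 0 \<Longrightarrow> F (of_real \<beta>) = F (of_real \<alpha>)" by simp
qed

text \<open>On each interval one of two reasons applies: the moment vanishes by the choice of the
  parameters, or the integrand is imaginary. The two values of \<open>\<kappa>\<close> exchange the
  roles of the intervals.\<close>

lemma Re_F_consecutive:
  assumes k: "k \<in> {1, 2, 3, 4}" and v: "continuous_on {0<..} v" "\<And>x. 0 < x \<Longrightarrow> cubic q (of_real x) = c * of_real (x * v x)"
    and m: "\<kappa> = 1 \<Longrightarrow> moment (a 1) (a 2) v = 0 \<and> moment (a 3) (a 4) v = 0"
      "\<kappa> = - 1 \<Longrightarrow> moment (a 2) (a 3) v = 0 \<and> moment (a 4) (a 5) v = 0"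
  shows "Re (F (of_real (a (k + 1)))) = Re (F (of_real (a k)))"
proof (cases "moment (a k) (a (k + 1)) v = 0")
  case True
  then show ?thesis using dens_integral(3)[OF consecutive_a[OF k] v] by simp
next
  case False
  have cons: "consecutive (a k) (a (k + 1))" by (rule consecutive_a[OF k])
  show ?thesis
  proof (rule Re_F_const)
    have im: "{a 1<..<a 2} \<inter> imaginary = {}" "{a 2<..<a 3} \<subseteq> imaginary" "{a 3<..<a 4} \<inter> imaginary = {}"
      "{a 4<..<a 5} \<subseteq> imaginary"
      using a b1_neg by (auto simp: imaginary_def)
    have kk: "k = 1 \<and> \<kappa> = - 1 \<or> k = 2 \<and> \<kappa> = 1 \<or> k = 3 \<and> \<kappa> = - 1 \<or> k = 4 \<and> \<kappa> = 1"
      using k False \<kappa> m by (auto simp: eval_nat_numeral)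
    then show "x \<in> imaginary \<longleftrightarrow> \<kappa> = 1" if "x \<in> {a k<..<a (k + 1)}" for x
      using that im by (elim disjE conjE) (auto simp: eval_nat_numeral)
  qed (use cons in \<open>auto simp: consecutive_def\<close>)
qed

text \<open>Re F is 0 at all \<open>a k\<close> and +-pi at \<open>b1\<close>, by the jump at 0 or
  at infinity. Constancy carries these values over every interval on which the gluing condition
  holds.\<close>

lemma Re_F_multiple_pi:
  assumes eq: "\<And>k. k \<in> {1, 2, 3, 4} \<Longrightarrow> Re (F (of_real (a (k + 1)))) = Re (F (of_real (a k)))"
    and F0: "F (of_real (a 1)) = 0"
    and q\<kappa>: "\<kappa> = 1 \<Longrightarrow> q 0 = of_real (a 1 * a 3 * a 5)" "\<kappa> = - 1 \<Longrightarrow> q 3 = \<i>"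
    and x: "x \<noteq> 0" "wb (of_real x) = - of_real \<kappa> * cnj (wb (of_real x))"
  shows "\<exists>n::int. Re (F (of_real x)) = pi * of_int n"
proof -
  have Fa: "Re (F (of_real (a 1))) = 0" "Re (F (of_real (a 2))) = 0" "Re (F (of_real (a 3))) = 0"
    "Re (F (of_real (a 4))) = 0" "Re (F (of_real (a 5))) = 0"
    using eq[of 1] eq[of 2] eq[of 3] eq[of 4] F0 by (simp_all add: eval_nat_numeral)
  have Fb: "Re (F (of_real b1)) = pi \<or> Re (F (of_real b1)) = - pi"
    using jump_at_0 jump_at_infinity q\<kappa> \<kappa> Fa by fastforce
  have pi_multiple: "\<exists>n::int. y = pi * of_int n" if "y = 0 \<or> y = pi \<or> y = - pi" for y
    using that by (metis mult_zero_right of_int_0 mult.right_neutral of_int_1 mult_minus_right of_int_minus)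
  have "Re (F (of_real x)) = 0 \<or> Re (F (of_real x)) = pi \<or> Re (F (of_real x)) = - pi"
  proof (cases "x \<in> roots")
    case True
    then show ?thesis using Fa Fb by (auto simp: roots_def)
  next
    case False
    then have im: "x \<in> imaginary \<longleftrightarrow> \<kappa> = 1" using neg_kappa_iff[OF \<kappa>] x(2) by blast
    show ?thesis
    proof (cases "\<kappa> = 1")
      case True
      then have "x \<in> imaginary" using im by simp
      then consider "b1 < x" "x < 0" | "0 < x" "x < a 1" | "a 2 < x" "x < a 3" | "a 4 < x" "x < a 5"
        using False x(1) unfolding imaginary_def roots_def by fastforce
      then show ?thesis
      proof cases
        case 1
        have "Re (F (of_real x)) = Re (F (of_real b1))"
          by (rule Re_F_const) (use 1 a b1_neg True in \<open>auto simp: roots_def imaginary_def\<close>)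
        then show ?thesis using Fb by simp
      next
        case 2
        have "Re (F (of_real (a 1))) = Re (F (of_real x))"
          by (rule Re_F_const) (use 2 a b1_neg True in \<open>auto simp: roots_def imaginary_def\<close>)
        then show ?thesis using Fa by simp
      next
        case 3
        have "Re (F (of_real (a 3))) = Re (F (of_real x))"
          by (rule Re_F_const) (use 3 a b1_neg True in \<open>auto simp: roots_def imaginary_def\<close>)
        then show ?thesis using Fa by simp
      next
        case 4
        have "Re (F (of_real (a 5))) = Re (F (of_real x))"
          by (rule Re_F_const) (use 4 a b1_neg True in \<open>auto simp: roots_def imaginary_def\<close>)
        then show ?thesis using Fa by simp
      qed
    next
      case \<kappa>': False
      then have "x \<notin> imaginary" using im by simp
      then consider "x < b1" | "a 1 < x" "x < a 2" | "a 3 < x" "x < a 4" | "a 5 < x"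
        unfolding imaginary_def by fastforce
      then show ?thesis
      proof cases
        case 1
        have "Re (F (of_real b1)) = Re (F (of_real x))"
          by (rule Re_F_const) (use 1 a b1_neg \<kappa>' in \<open>auto simp: roots_def imaginary_def\<close>)
        then show ?thesis using Fb by simp
      next
        case 2
        have "Re (F (of_real (a 2))) = Re (F (of_real x))"
          by (rule Re_F_const) (use 2 a b1_neg \<kappa>' in \<open>auto simp: roots_def imaginary_def\<close>)
        then show ?thesis using Fa by simp
      next
        case 3
        have "Re (F (of_real (a 4))) = Re (F (of_real x))"
          by (rule Re_F_const) (use 3 a b1_neg \<kappa>' in \<open>auto simp: roots_def imaginary_def\<close>)
        then show ?thesis using Fa by simp
      next
        case 4
        have "Re (F (of_real x)) = Re (F (of_real (a 5)))"
          by (rule Re_F_const) (use 4 a b1_neg \<kappa>' in \<open>auto simp: roots_def imaginary_def\<close>)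
        then show ?thesis using Fa by simp
      qed
    qed
  qed
  then show ?thesis by (rule pi_multiple)
qed

end

section \<open>Periods of the individual forms and residues at the four ends\<close>

context branch_data
begin

lemma upper_primitive_exists:
  assumes f: "has_density 0 q f" and \<kappa>: "\<kappa> = 1 \<or> \<kappa> = - 1" and q: "\<And>i. cnj (q i) = of_real \<kappa> * q i"
  obtains F where "upper_primitive a b1 q f F \<kappa>" "F (of_real (a 1)) = 0"
proof -
  obtain F where F: "\<And>z. z \<in> upper \<Longrightarrow> (F has_field_derivative cubic q z / (z * wb z)) (at z)"
    "continuous_on (closure upper - {0}) F"
    using sector_primitive_extends[OF f upper_props(1,2,4) wb_continuous wb_square wb_nonzero] by metis
  have "upper_primitive a b1 q f (\<lambda>z. F z - F (of_real (a 1))) \<kappa>"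
  proof unfold_locales
    show "((\<lambda>z. F z - F (of_real (a 1))) has_field_derivative cubic q z / (z * wb z)) (at z)" if "z \<in> upper" for z
      using DERIV_diff[OF F(1)[OF that] DERIV_const[of "F (of_real (a 1))"]] by simp
  qed (use f \<kappa> q F(2) in \<open>auto intro: continuous_intros\<close>)
  then show thesis using that by simp
qed

text \<open>The prescribed coefficient, \<open>q 0\<close> for \<open>\<kappa> = 1\<close> and
  \<open>q 3\<close> for \<open>\<kappa> = - 1\<close>, fixes the residue at the pole and thereby
  the jump +-pi on which the gluing rests; the moments settle the remaining real parts.\<close>

lemma periods_and_integrals:
  assumes f: "has_density 0 q f" and \<kappa>: "\<kappa> = 1 \<or> \<kappa> = - 1" and q: "\<And>i. cnj (q i) = of_real \<kappa> * q i"
    and q\<kappa>: "\<kappa> = 1 \<Longrightarrow> q 0 = of_real (a 1 * a 3 * a 5)" "\<kappa> = - 1 \<Longrightarrow> q 3 = \<i>"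
    and v: "continuous_on {0<..} v" "\<And>x. 0 < x \<Longrightarrow> cubic q (of_real x) = c * of_real (x * v x)"
    and m: "\<kappa> = 1 \<Longrightarrow> moment (a 1) (a 2) v = 0 \<and> moment (a 3) (a 4) v = 0"
      "\<kappa> = - 1 \<Longrightarrow> moment (a 2) (a 3) v = 0 \<and> moment (a 4) (a 5) v = 0"
  shows "\<And>\<gamma> J. \<gamma> ` {0..1} \<subseteq> topspace T - E \<Longrightarrow> \<gamma> 0 = \<gamma> 1 \<Longrightarrow> has_form_integral X (form_of f zc) \<gamma> J \<Longrightarrow>
      \<exists>n::int. Re J = 2 * pi * of_int n"
    and "\<And>k h. k \<in> {1, 2, 3, 4} \<Longrightarrow> (\<And>x. x \<in> {a k<..<a (k + 1)} \<Longrightarrow> h x = f (Affine (of_real x) (wb (of_real x)))) \<Longrightarrow>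
      h absolutely_integrable_on {a k..a (k + 1)} \<and> Re (integral {a k..a (k + 1)} h) = 0"
proof -
  obtain F where F: "upper_primitive a b1 q f F \<kappa>" and F1: "F (of_real (a 1)) = 0"
    using upper_primitive_exists[OF f \<kappa> q] by metis
  interpret upper_primitive a b1 q f F \<kappa> by (rule F)
  have eq: "Re (F (of_real (a (k + 1)))) = Re (F (of_real (a k)))" if "k \<in> {1, 2, 3, 4}" for k
    by (rule Re_F_consecutive[OF that v m])
  show "\<exists>n::int. Re J = 2 * pi * of_int n"
    if \<gamma>: "\<gamma> ` {0..1} \<subseteq> topspace T - E" "\<gamma> 0 = \<gamma> 1" "has_form_integral X (form_of f zc) \<gamma> J" for \<gamma> J
  proof -
    have "cis (Re J) = 1"
      by (rule cis_period[OF f \<kappa> q F(1,2) Re_F_multiple_pi[OF eq F1 q\<kappa>] \<gamma>]) auto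
    then have "cos (Re J) = 1" by (metis cis.sel(1) one_complex.sel(1))
    then show ?thesis by (auto simp: cos_one_2pi_int)
  qed
  show "h absolutely_integrable_on {a k..a (k + 1)} \<and> Re (integral {a k..a (k + 1)} h) = 0"
    if k: "k \<in> {1, 2, 3, 4}" and h: "\<And>x. x \<in> {a k<..<a (k + 1)} \<Longrightarrow> h x = f (Affine (of_real x) (wb (of_real x)))" for k h
  proof -
    have cons: "consecutive (a k) (a (k + 1))" by (rule consecutive_a[OF k])
    have hd: "h x = dens x" if "x \<in> {a k..a (k + 1)} - {a k, a (k + 1)}" for x
    proof -
      have x: "x \<in> {a k<..<a (k + 1)}" "x \<noteq> 0" using that cons by (auto simp: consecutive_def)
      then have "x \<notin> roots" using cons unfolding consecutive_def by blast
      then have "wb (of_real x) \<noteq> 0" using wb_real_0 by blast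
      then show ?thesis using f h[OF x(1)] x(2) wb_square[of "of_real x"] by (simp add: has_density_def dens_def)
    qed
    have "h absolutely_integrable_on {a k..a (k + 1)}"
      by (rule absolutely_integrable_spike[OF dens_integral(1)[OF cons v], of "{a k, a (k + 1)}"]) (use hd in auto)
    moreover have "integral {a k..a (k + 1)} h = integral {a k..a (k + 1)} dens"
      by (rule integral_spike[of "{a k, a (k + 1)}"]) (use hd in auto)
    ultimately show ?thesis using dens_integral(2)[OF cons v] eq[OF k] by simp
  qed
qed

text \<open>In a z-chart at \<open>p\<close> all coefficients are quotients N/z, so residues are
  values of N at 0. The residue 1 of dz/z sends the third coordinate to minus infinity.\<close>

lemma bottom_end:
  assumes p: "p \<in> points_over_zero P"
    and f: "\<And>j::3. has_density (\<alpha> j) (q j) (f j)" and \<alpha>: "\<alpha> 3 = 1" "q 3 = (\<lambda>_. 0)"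
    and ik: "i = 1 \<and> k = 2 \<or> i = 2 \<and> k = 1" "Im (\<alpha> i + q i 0 / wc p) \<noteq> 0" "\<alpha> k + q k 0 / wc p = 0"
  shows "scherk_end X (\<lambda>j. form_of (f j) zc) (- 1) (\<chi> j. Re (2 * of_real pi * \<i> * (\<alpha> j + q j 0 / wc p))) p"
proof -
  have pa: "p \<in> affine_points P" "zc p = 0" using p by (auto simp: points_over_zero_def)
  have "wc p \<noteq> 0" using aff.y_square[OF pa(1)] pa(2) P0 by auto
  then obtain G where G: "p \<in> aff.cut G" "(aff.cut G, zc) \<in> X" using z_chart_at[OF pa(1)] by metis
  let ?U = "aff.cut G"
  obtain H where H: "open H" "?U = aff.cut H" "inj_on zc ?U" "\<forall>p\<in>?U. wc p \<noteq> 0" using z_chartE[OF G(2)] by metis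
  note zf = z_chart_facts[OF H]
  have nz: "wc (inv_into ?U zc t) \<noteq> 0" if "t \<in> zc ` ?U" for t using that H(4) inv_into_into by metis
  define N where "N j t = \<alpha> j + cubic (q j) t / wc (inv_into ?U zc t)" for j t
  have N: "N j holomorphic_on zc ` ?U" for j unfolding N_def using nz by (intro holomorphic_intros zf) auto
  have "inv_into ?U zc 0 = p" using H(3) G(1) pa(2) by (metis inv_into_f_f)
  then have N0: "N j 0 = \<alpha> j + q j 0 / wc p" for j by (simp add: N_def cubic_4)
  have form: "form_of (f j) zc (?U, zc) t = N j t / t" if t: "t \<in> zc ` ?U - {0}" for j t
  proof (rule form_value)
    have O: "open (zc ` ?U - {0})" using zf(1) by auto
    show "eventually (\<lambda>s. raw (f j) (?U, zc) s = N j s / s) (at t)"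
      using eventually_at_in_open'[OF O t] by eventually_elim (simp add: raw_z[OF f H] N_def)
    have "(\<lambda>s. N j s / s) holomorphic_on zc ` ?U - {0}"
      by (intro holomorphic_intros holomorphic_on_subset[OF N]) auto
    then show "(\<lambda>s. N j s / s) analytic_on {t}" using O t unfolding analytic_at by blast
  qed
  have sub: "?U - {p} \<subseteq> topspace T - E"
  proof
    fix r assume r: "r \<in> ?U - {p}"
    then have "zc r \<noteq> 0" using H(3) G(1) pa(2) by (auto simp: inj_on_def)
    then show "r \<in> topspace T - E" using r aff_cut_subset topspace_minus_E by auto
  qed
  have "scherk_end X (\<lambda>j. form_of (f j) zc) (- 1) (\<chi> j. Re (2 * of_real pi * \<i> * N j 0)) p"
  proof (rule scherk_end_of_quotients[OF G(2,1) pa(2) sub _ form_holomorphic_on[OF f] form N _ _ ik(1)])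
    show "compatible_form X (form_of (f j) zc)" for j using form_meromorphic[OF f] by (simp add: meromorphic_form_def)
    show "N 3 t = - of_real (- 1)" for t by (simp add: N_def \<alpha> cubic_def)
    show "Im (N i 0) \<noteq> 0" "N k 0 = 0" using ik(2,3) unfolding N0 by simp_all
  qed simp_all
  then show ?thesis by (simp only: N0)
qed

text \<open>The minus sign from \<open>raw_u\<close> makes the third residue -1, so the third
  coordinate tends to infinity; the horizontal residues come from the leading coefficients of the
  cubics.\<close>

lemma top_end:
  assumes p: "p \<in> points_over_infinity P"
    and f: "\<And>j::3. has_density (\<alpha> j) (q j) (f j)" and \<alpha>: "\<alpha> 3 = 1" "q 3 = (\<lambda>_. 0)"
    and ik: "i = 1 \<and> k = 2 \<or> i = 2 \<and> k = 1" "Im (\<alpha> i + q i 3 / vc 3 p) \<noteq> 0" "\<alpha> k + q k 3 / vc 3 p = 0"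
  shows "scherk_end X (\<lambda>j. form_of (f j) zc) 1 (\<chi> j. Re (2 * of_real pi * \<i> * - (\<alpha> j + q j 3 / vc 3 p))) p"
proof -
  have pa: "p \<in> infpts" "uc p = 0" using p by (auto simp: points_over_infinity_def)
  have "vc 3 p \<noteq> 0" using inf.y_square[OF pa(1)] pa(2) R0 by auto
  then obtain G where G: "p \<in> inf.cut G" "(inf.cut G, uc) \<in> X" using u_chart_at[OF pa(1)] by metis
  let ?U = "inf.cut G"
  obtain H where H: "open H" "?U = inf.cut H" "inj_on uc ?U" "\<forall>p\<in>?U. vc 3 p \<noteq> 0" using u_chartE[OF G(2)] by metis
  note uf = u_chart_facts[OF H]
  have nz: "vc 3 (inv_into ?U uc t) \<noteq> 0" if "t \<in> uc ` ?U" for t using that H(4) inv_into_into by metis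
  define N where "N j t = - (\<alpha> j + cubic_rev (q j) t / vc 3 (inv_into ?U uc t))" for j t
  have N: "N j holomorphic_on uc ` ?U" for j unfolding N_def using nz by (intro holomorphic_intros uf) auto
  have "inv_into ?U uc 0 = p" using H(3) G(1) pa(2) by (metis inv_into_f_f)
  then have N0: "N j 0 = - (\<alpha> j + q j 3 / vc 3 p)" for j by (simp add: N_def cubic_rev_4)
  have form: "form_of (f j) zc (?U, uc) t = N j t / t" if t: "t \<in> uc ` ?U - {0}" for j t
  proof (rule form_value)
    have O: "open (uc ` ?U - {0})" using uf(1) by auto
    show "eventually (\<lambda>s. raw (f j) (?U, uc) s = N j s / s) (at t)"
      using eventually_at_in_open'[OF O t] by eventually_elim (simp add: raw_u[OF f H] N_def)
    have "(\<lambda>s. N j s / s) holomorphic_on uc ` ?U - {0}"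
      by (intro holomorphic_intros holomorphic_on_subset[OF N]) auto
    then show "(\<lambda>s. N j s / s) analytic_on {t}" using O t unfolding analytic_at by blast
  qed
  have sub: "?U - {p} \<subseteq> topspace T - E"
  proof
    fix r assume r: "r \<in> ?U - {p}"
    then have "uc r \<noteq> 0" "r \<in> infpts" using H(3) G(1) pa(2) inf_cut_subset by (auto simp: inj_on_def)
    then show "r \<in> topspace T - E" using E_iff(2) by (simp add: topspace_X)
  qed
  have "scherk_end X (\<lambda>j. form_of (f j) zc) (1) (\<chi> j. Re (2 * of_real pi * \<i> * N j 0)) p"
  proof (rule scherk_end_of_quotients[OF G(2,1) pa(2) sub _ form_holomorphic_on[OF f] form N _ _ ik(1)])
    show "compatible_form X (form_of (f j) zc)" for j using form_meromorphic[OF f] by (simp add: meromorphic_form_def)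
    show "N 3 t = - of_real (1)" for t by (simp add: N_def \<alpha> cubic_rev_def)
    show "Im (N i 0) \<noteq> 0" "N k 0 = 0" using ik(2,3) unfolding N0 by simp_all
  qed simp_all
  then show ?thesis by (simp only: N0)
qed

definition A0 :: "complex \<Rightarrow> complex" where
  "A0 z = (z - of_real (a 1)) * (z - of_real (a 3)) * (z - of_real (a 5))"

definition B0 :: "complex \<Rightarrow> complex" where
  "B0 z = (z - of_real (a 2)) * (z - of_real (a 4)) * (z - of_real b1)"

lemma P_A_B: "poly P z = A0 z * B0 z"
  by (simp add: poly_P A0_def B0_def mult_ac)

lemma g_on_curve_A: "g_on_curve a (Affine z w) = A0 z / w"
  by (simp add: g_on_curve_def A0_def)

lemma one_over_g: "w\<^sup>2 = poly P z \<Longrightarrow> w \<noteq> 0 \<Longrightarrow> 1 / g_on_curve a (Affine z w) = B0 z / w"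
  by (auto simp: g_on_curve_A P_A_B field_simps power2_eq_square)

text \<open>The coefficients of (B0 - A0)/2 by Vieta's formulas: the leading terms cancel, and the
  constant term is simplified by \<open>b1_prod\<close>.\<close>

definition base_odd :: "nat \<Rightarrow> real" where
  "base_odd i = (if i = 0 then a 1 * a 3 * a 5
     else if i = 1 then (a 2 * a 4 + a 2 * b1 + a 4 * b1 - (a 1 * a 3 + a 1 * a 5 + a 3 * a 5)) / 2
     else if i = 2 then (a 1 + a 3 + a 5 - (a 2 + a 4 + b1)) / 2 else 0)"

text \<open>The coefficients of (B0 + A0)/2, where \<open>b1_prod\<close> cancels the constant
  term.\<close>

definition base_even :: "nat \<Rightarrow> real" where
  "base_even i = (if i = 1 then (a 2 * a 4 + a 2 * b1 + a 4 * b1 + (a 1 * a 3 + a 1 * a 5 + a 3 * a 5)) / 2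
     else if i = 2 then - (a 1 + a 3 + a 5 + (a 2 + a 4 + b1)) / 2 else if i = 3 then 1 else 0)"

lemma b1_prod: "a 2 * a 4 * b1 = - (a 1 * a 3 * a 5)"
  using a by (simp add: b1)

lemma cubic_base:
  "cubic (\<lambda>i. of_real (base_odd i)) z = (B0 z - A0 z) / 2" (is ?odd)
  "cubic (\<lambda>i. of_real (base_even i)) z = (B0 z + A0 z) / 2" (is ?even)
proof -
  define s1 where "s1 = a 1 + a 3 + a 5"
  define s2 where "s2 = a 1 * a 3 + a 1 * a 5 + a 3 * a 5"
  define s3 where "s3 = a 1 * a 3 * a 5"
  define t1 where "t1 = a 2 + a 4 + b1"
  define t2 where "t2 = a 2 * a 4 + a 2 * b1 + a 4 * b1"
  have e: "complex_of_real (a 2 * a 4 * b1) = - of_real s3" by (simp only: b1_prod s3_def of_real_minus)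
  have "B0 z = z ^ 3 - of_real t1 * z\<^sup>2 + of_real t2 * z - of_real (a 2 * a 4 * b1)"
    by (simp add: B0_def t1_def t2_def algebra_simps power2_eq_square power3_eq_cube)
  then have B: "B0 z = z ^ 3 - of_real t1 * z\<^sup>2 + of_real t2 * z + of_real s3" by (simp only: e diff_minus_eq_add)
  have A: "A0 z = z ^ 3 - of_real s1 * z\<^sup>2 + of_real s2 * z - of_real s3"
    by (simp add: A0_def s1_def s2_def s3_def algebra_simps power2_eq_square power3_eq_cube)
  have "base_odd 0 = s3" "base_odd 1 = (t2 - s2) / 2" "base_odd 2 = (s1 - t1) / 2" "base_odd 3 = 0"
    by (simp_all add: base_odd_def s1_def s2_def s3_def t1_def t2_def)
  then show ?odd by (simp only: cubic_4 A B) (simp add: field_simps)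
  have "base_even 0 = 0" "base_even 1 = (t2 + s2) / 2" "base_even 2 = - (s1 + t1) / 2" "base_even 3 = 1"
    by (simp_all add: base_even_def s1_def s2_def t1_def t2_def)
  then show ?even by (simp only: cubic_4 A B) (simp add: field_simps)
qed

end

lemma triple_simps [simp]: "triple x y z 1 = x" "triple x y z 2 = y" "triple x y z 3 = z"
  by (simp_all add: triple_def)

lemma rank_two_lattice_horizontal:
  assumes "c \<noteq> (0 :: real)"
  shows "rank_two_lattice {of_int m *\<^sub>R axis 1 c + of_int n *\<^sub>R axis 2 c | m n :: int. True}"
  unfolding rank_two_lattice_def
proof (intro exI conjI)
  have ne: "axis (1::3) c $ 1 \<noteq> axis (2::3) c $ 1" using assms by (simp add: axis_def)
  then show "axis (1::3) c \<noteq> axis 2 c" by metis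
  show "independent {axis (1::3) c, axis 2 c}"
  proof (rule pairwise_orthogonal_independent)
    show "pairwise orthogonal {axis (1::3) c, axis 2 c}"
      by (auto simp: pairwise_def orthogonal_def inner_axis_axis)
    show "0 \<notin> {axis (1::3) c, axis 2 c}" using assms by (simp add: axis_eq_0_iff)
  qed
qed (rule refl)

section \<open>Assembling the Weierstrass data\<close>

context branch_data
begin

text \<open>Over the denominator z w the added form (s + t z) dz / w becomes s z + t z^2. It changes
  only the coefficients 1 and 2 and preserves the residues, which depend on the coefficients 0 and
  3.\<close>

definition q_odd :: "real \<Rightarrow> real \<Rightarrow> nat \<Rightarrow> complex" where
  "q_odd s t i = of_real (base_odd i + (if i = 1 then s else if i = 2 then t else 0))"

text \<open>The overall factor \<open>\<i>\<close> comes from the second form and gives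
  \<open>\<kappa> = - 1\<close>; it is also why the last two parameters are \<open>\<i>\<close>
  times real numbers.\<close>

definition q_even :: "real \<Rightarrow> real \<Rightarrow> nat \<Rightarrow> complex" where
  "q_even s t i = \<i> * of_real (base_even i + (if i = 1 then s else if i = 2 then t else 0))"

lemma cubic_q_odd: "cubic (q_odd s t) z = (B0 z - A0 z) / 2 + of_real s * z + of_real t * z\<^sup>2"
  unfolding cubic_base [symmetric] by (simp add: cubic_4 q_odd_def algebra_simps)

lemma cubic_q_even: "cubic (q_even s t) z = \<i> * ((B0 z + A0 z) / 2 + of_real s * z + of_real t * z\<^sup>2)"
  unfolding cubic_base [symmetric] by (simp add: cubic_4 q_even_def algebra_simps)

text \<open>The real cubic divided by x: the integrand on the real axis is this function plus s + t
  x, over the modulus \<open>W\<close> and up to a constant factor.\<close>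

definition base_density :: "(nat \<Rightarrow> real) \<Rightarrow> real \<Rightarrow> real" where
  "base_density r x = r 0 / x + r 1 + r 2 * x + r 3 * x\<^sup>2"

lemma base_density_continuous: "continuous_on {0<..} (base_density r)"
  unfolding base_density_def by (intro continuous_intros) auto

lemma cubic_q_odd_real: "0 < x \<Longrightarrow> cubic (q_odd s t) (of_real x) = 1 * of_real (x * (base_density base_odd x + s + t * x))"
  by (simp add: cubic_4 q_odd_def base_density_def algebra_simps power2_eq_square power3_eq_cube)

lemma cubic_q_even_real: "0 < x \<Longrightarrow> cubic (q_even s t) (of_real x) = \<i> * of_real (x * (base_density base_even x + s + t * x))"
  by (simp add: cubic_4 q_even_def base_density_def algebra_simps power2_eq_square power3_eq_cube)

lemma has_density_odd:
  "has_density 0 (q_odd s t) (\<lambda>p. 1 / 2 * (1 / g_on_curve a p - g_on_curve a p) * (1 / zc p) + (of_real s + of_real t * zc p) / wc p)"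
  unfolding has_density_def
proof (intro allI impI)
  fix z w :: complex assume zw: "z \<noteq> 0" "w \<noteq> 0" "w\<^sup>2 = poly P z"
  have "1 / 2 * (B0 z / w - A0 z / w) * (1 / z) + (of_real s + of_real t * z) / w = 0 / z + cubic (q_odd s t) z / (z * w)"
    using zw(1,2) unfolding cubic_q_odd by (simp add: field_simps power2_eq_square)
  then show "1 / 2 * (1 / g_on_curve a (Affine z w) - g_on_curve a (Affine z w)) * (1 / zc (Affine z w)) +
      (of_real s + of_real t * zc (Affine z w)) / wc (Affine z w) = 0 / z + cubic (q_odd s t) z / (z * w)"
    by (simp only: one_over_g[OF zw(3,2), unfolded g_on_curve_A] g_on_curve_A zc.simps wc.simps)
qed

lemma has_density_even:
  "has_density 0 (q_even s t) (\<lambda>p. \<i> / 2 * (1 / g_on_curve a p + g_on_curve a p) * (1 / zc p) + (\<i> * of_real s + \<i> * of_real t * zc p) / wc p)"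
  unfolding has_density_def
proof (intro allI impI)
  fix z w :: complex assume zw: "z \<noteq> 0" "w \<noteq> 0" "w\<^sup>2 = poly P z"
  have "\<i> / 2 * (B0 z / w + A0 z / w) * (1 / z) + (\<i> * of_real s + \<i> * of_real t * z) / w = 0 / z + cubic (q_even s t) z / (z * w)"
    using zw(1,2) unfolding cubic_q_even by (simp add: field_simps power2_eq_square)
  then show "\<i> / 2 * (1 / g_on_curve a (Affine z w) + g_on_curve a (Affine z w)) * (1 / zc (Affine z w)) +
      (\<i> * of_real s + \<i> * of_real t * zc (Affine z w)) / wc (Affine z w) = 0 / z + cubic (q_even s t) z / (z * w)"
    by (simp only: one_over_g[OF zw(3,2), unfolded g_on_curve_A] g_on_curve_A zc.simps wc.simps)
qed

lemma has_density_dz_over_z: "has_density 1 (\<lambda>_. 0) (\<lambda>p. 1 / zc p)"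
  by (simp add: has_density_def cubic_def)

lemma period_values: "q_odd s t 0 = of_real (a 1 * a 3 * a 5)" "q_odd s t 3 = 0" "q_even s t 0 = 0" "q_even s t 3 = \<i>"
  by (simp_all add: q_odd_def q_even_def base_odd_def base_even_def)

lemma parameters:
  obtains s t s' t' where
    "moment (a 1) (a 2) (\<lambda>x. base_density base_odd x + s + t * x) = 0" "moment (a 3) (a 4) (\<lambda>x. base_density base_odd x + s + t * x) = 0"
    "moment (a 2) (a 3) (\<lambda>x. base_density base_even x + s' + t' * x) = 0" "moment (a 4) (a 5) (\<lambda>x. base_density base_even x + s' + t' * x) = 0"
proof -
  have c: "consecutive (a 1) (a 2)" "consecutive (a 2) (a 3)" "consecutive (a 3) (a 4)" "consecutive (a 4) (a 5)"
    using consecutive_a[of 1] consecutive_a[of 2] consecutive_a[of 3] consecutive_a[of 4] by (simp_all add: eval_nat_numeral)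
  show thesis
    using parameters_exist[OF c(1,3) a(3) base_density_continuous[of base_odd]]
      parameters_exist[OF c(2,4) a(4) base_density_continuous[of base_even]] that by blast
qed

lemma weierstrass_data:
  fixes s t s' t' :: real and f1 f2 :: "hpoint \<Rightarrow> complex"
  defines "f1 \<equiv> \<lambda>p. 1 / 2 * (1 / g_on_curve a p - g_on_curve a p) * (1 / zc p) + (of_real s + of_real t * zc p) / wc p"
    and "f2 \<equiv> \<lambda>p. \<i> / 2 * (1 / g_on_curve a p + g_on_curve a p) * (1 / zc p) + (\<i> * of_real s' + \<i> * of_real t' * zc p) / wc p"
  assumes m: "moment (a 1) (a 2) (\<lambda>x. base_density base_odd x + s + t * x) = 0" "moment (a 3) (a 4) (\<lambda>x. base_density base_odd x + s + t * x) = 0"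
    "moment (a 2) (a 3) (\<lambda>x. base_density base_even x + s' + t' * x) = 0" "moment (a 4) (a 5) (\<lambda>x. base_density base_even x + s' + t' * x) = 0"
  shows "weierstrass_doubly_periodic X E (triple (form_of f1 zc) (form_of f2 zc) (form_of (\<lambda>p. 1 / zc p) zc))"
    and "\<exists>T :: hpoint \<Rightarrow> real^3.
           (\<forall>p \<in> points_over_zero P. scherk_end X (triple (form_of f1 zc) (form_of f2 zc) (form_of (\<lambda>p. 1 / zc p) zc)) (- 1) (T p) p) \<and>
           (\<forall>p \<in> points_over_infinity P. scherk_end X (triple (form_of f1 zc) (form_of f2 zc) (form_of (\<lambda>p. 1 / zc p) zc)) 1 (T p) p) \<and>
           (\<forall>p \<in> points_over_zero P. \<forall>q \<in> points_over_infinity P. T p \<bullet> T q = 0)"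
    and "\<And>k h. k \<in> {1, 2, 3, 4} \<Longrightarrow> h = (\<lambda>x. f1 (Affine (of_real x) (wb (of_real x)))) \<or> h = (\<lambda>x. f2 (Affine (of_real x) (wb (of_real x)))) \<Longrightarrow>
      h absolutely_integrable_on {a k..a (k + 1)} \<and> Re (integral {a k..a (k + 1)} h) = 0"
proof -
  let ?f3 = "\<lambda>p. 1 / zc p"
  let ?f = "triple f1 f2 ?f3" and ?\<alpha> = "triple 0 0 (1 :: complex)" and ?q = "triple (q_odd s t) (q_even s' t') (\<lambda>_. 0)"
  let ?\<omega> = "triple (form_of f1 zc) (form_of f2 zc) (form_of ?f3 zc)"
  have d1: "has_density 0 (q_odd s t) f1" unfolding f1_def by (rule has_density_odd)
  have d2: "has_density 0 (q_even s' t') f2" unfolding f2_def by (rule has_density_even)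
  have v: "continuous_on {0<..} (\<lambda>x. base_density base_odd x + s + t * x)" "continuous_on {0<..} (\<lambda>x. base_density base_even x + s' + t' * x)"
    by (intro continuous_intros base_density_continuous)+
  have c1: "cnj (q_odd s t i) = of_real 1 * q_odd s t i" and c2: "cnj (q_even s' t' i) = of_real (- 1) * q_even s' t' i" for i
    by (simp_all add: q_odd_def q_even_def)
  have P1: "\<And>\<gamma> J. \<gamma> ` {0..1} \<subseteq> topspace T - E \<Longrightarrow> \<gamma> 0 = \<gamma> 1 \<Longrightarrow> has_form_integral X (form_of f1 zc) \<gamma> J \<Longrightarrow> \<exists>n::int. Re J = 2 * pi * of_int n"
    by (rule periods_and_integrals(1)[OF d1 _ c1 _ _ v(1) cubic_q_odd_real]) (use m period_values in auto)
  have P2: "\<And>\<gamma> J. \<gamma> ` {0..1} \<subseteq> topspace T - E \<Longrightarrow> \<gamma> 0 = \<gamma> 1 \<Longrightarrow> has_form_integral X (form_of f2 zc) \<gamma> J \<Longrightarrow> \<exists>n::int. Re J = 2 * pi * of_int n"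
    by (rule periods_and_integrals(1)[OF d2 _ c2 _ _ v(2) cubic_q_even_real]) (use m period_values in auto)
  have d: "has_density (?\<alpha> j) (?q j) (?f j)" for j
    using exhaust_3[of j] d1 d2 has_density_dz_over_z by auto
  have \<omega>: "?\<omega> = (\<lambda>j. form_of (?f j) zc)" by (simp add: fun_eq_iff triple_def)
  show "weierstrass_doubly_periodic X E ?\<omega>"
    unfolding weierstrass_doubly_periodic_def
  proof (intro conjI allI)
    show "compact_riemann_surface X" using surface compact_X by (simp add: compact_riemann_surface_def)
    show "finite E" by (rule finite_E)
    show "E \<subseteq> topspace T" by (auto simp: topspace_X infpts_def points_over_zero_def affine_points_def)
    show "meromorphic_form X (?\<omega> j)" "holomorphic_form_on X (?\<omega> j) (topspace T - E)" for j
      unfolding \<omega> by (rule form_meromorphic[OF d] form_holomorphic_on[OF d])+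
    show "\<exists>L. rank_two_lattice L \<and> (\<forall>\<gamma> x. \<gamma> ` {0..1} \<subseteq> topspace T - E \<longrightarrow> \<gamma> 0 = \<gamma> 1 \<longrightarrow> has_real_integral X ?\<omega> \<gamma> x \<longrightarrow> x \<in> L)"
    \<comment> \<open>The lattice consists of the horizontal vectors with coordinates in 2 pi Z:
      both horizontal components have such periods, and the third component has none.\<close>
    proof (rule exI, rule conjI, rule rank_two_lattice_horizontal[of "2 * pi"])
      show "\<forall>\<gamma> x. \<gamma> ` {0..1} \<subseteq> topspace T - E \<longrightarrow> \<gamma> 0 = \<gamma> 1 \<longrightarrow> has_real_integral X ?\<omega> \<gamma> x \<longrightarrow>
          x \<in> {of_int m *\<^sub>R axis 1 (2 * pi) + of_int n *\<^sub>R axis 2 (2 * pi) | m n :: int. True}"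
      proof (intro allI impI)
        fix \<gamma> x assume \<gamma>: "\<gamma> ` {0..1} \<subseteq> topspace T - E" "\<gamma> 0 = \<gamma> 1" and x: "has_real_integral X ?\<omega> \<gamma> x"
        obtain I where I: "\<And>j. has_form_integral X (?\<omega> j) \<gamma> (I j)" "x = (\<chi> j. Re (I j))"
          using x unfolding has_real_integral_def by blast
        have "has_form_integral X (form_of f1 zc) \<gamma> (I 1)" "has_form_integral X (form_of f2 zc) \<gamma> (I 2)"
          using I(1)[of 1] I(1)[of 2] by simp_all
        then obtain m n :: int where mn: "Re (I 1) = 2 * pi * of_int m" "Re (I 2) = 2 * pi * of_int n"
          using P1[OF \<gamma>] P2[OF \<gamma>] by meson
        have "Re (I 3) = 0" using norm_period[OF has_density_dz_over_z \<gamma>] I(1)[of 3] by simp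
        with mn have "x = of_int m *\<^sub>R axis 1 (2 * pi) + of_int n *\<^sub>R axis 2 (2 * pi)"
          by (simp add: I(2) vec_eq_iff forall_3 axis_def)
        then show "x \<in> {of_int m *\<^sub>R axis 1 (2 * pi) + of_int n *\<^sub>R axis 2 (2 * pi) | m n :: int. True}" by blast
      qed
    qed simp
  qed
  define T0 :: "hpoint \<Rightarrow> real^3" where "T0 p = (\<chi> j. Re (2 * of_real pi * \<i> * (?\<alpha> j + ?q j 0 / wc p)))" for p
  define T1 :: "hpoint \<Rightarrow> real^3" where "T1 p = (\<chi> j. Re (2 * of_real pi * \<i> * - (?\<alpha> j + ?q j 3 / vc 3 p)))" for p
  have bottom: "scherk_end X ?\<omega> (- 1) (T0 p) p" if p: "p \<in> points_over_zero P" for p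
    unfolding \<omega> T0_def
  proof (rule bottom_end[OF p d, where i = 1 and k = 2])
    have w2: "(wc p)\<^sup>2 = - (of_real (a 1 * a 3 * a 5))\<^sup>2" using p m_square by (auto simp: points_over_zero_def)
    have nz: "complex_of_real (a 1 * a 3 * a 5) \<noteq> 0" using a by simp
    then have "(of_real (a 1 * a 3 * a 5) / wc p)\<^sup>2 = - 1" using w2 by (simp add: power_divide)
    then have "(of_real (a 1 * a 3 * a 5) / wc p)\<^sup>2 = \<i>\<^sup>2" by simp
    then have "of_real (a 1 * a 3 * a 5) / wc p = \<i> \<or> of_real (a 1 * a 3 * a 5) / wc p = - \<i>" by (simp only: power2_eq_iff)
    then have "Im (of_real (a 1 * a 3 * a 5) / wc p) \<noteq> 0" by (elim disjE) (erule ssubst, simp)+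
    then show "Im (?\<alpha> 1 + ?q 1 0 / wc p) \<noteq> 0" by (simp only: triple_simps period_values add_0_left not_False_eq_True)
  qed (simp_all add: period_values)
  have top: "scherk_end X ?\<omega> 1 (T1 p) p" if p: "p \<in> points_over_infinity P" for p
    unfolding \<omega> T1_def
  proof (rule top_end[OF p d, where i = 2 and k = 1])
    have "(vc 3 p)\<^sup>2 = 1" using p lead_P by (auto simp: points_over_infinity_def)
    then have "vc 3 p = 1 \<or> vc 3 p = - 1" by (simp add: power2_eq_1_iff)
    then show "Im (?\<alpha> 2 + ?q 2 3 / vc 3 p) \<noteq> 0" by (auto simp: period_values)
  qed (simp_all add: period_values)
  \<comment> \<open>Over z = 0 the period has only a first component and over infinity only a second
    one, because \<open>q_even\<close> has no constant and \<open>q_odd\<close> no cubic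
    coefficient.\<close>
  have ortho: "T0 p \<bullet> T1 r = 0" for p r
    by (simp add: inner_vec_def sum_3 T0_def T1_def period_values)
  \<comment> \<open>The two kinds of ends are disjoint, so one function can carry both formulas for
    the periods.\<close>
  have disj: "p \<notin> points_over_zero P" if "p \<in> points_over_infinity P" for p
    using that by (auto simp: points_over_zero_def points_over_infinity_def)
  show "\<exists>T :: hpoint \<Rightarrow> real^3. (\<forall>p \<in> points_over_zero P. scherk_end X ?\<omega> (- 1) (T p) p) \<and>
      (\<forall>p \<in> points_over_infinity P. scherk_end X ?\<omega> 1 (T p) p) \<and>
      (\<forall>p \<in> points_over_zero P. \<forall>q \<in> points_over_infinity P. T p \<bullet> T q = 0)"
    by (rule exI[of _ "\<lambda>p. if p \<in> points_over_zero P then T0 p else T1 p"]) (use bottom top ortho disj in auto)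
  show "h absolutely_integrable_on {a k..a (k + 1)} \<and> Re (integral {a k..a (k + 1)} h) = 0"
    if k: "k \<in> {1, 2, 3, 4}"
      and h: "h = (\<lambda>x. f1 (Affine (of_real x) (wb (of_real x)))) \<or> h = (\<lambda>x. f2 (Affine (of_real x) (wb (of_real x))))" for k h
    using h
  proof
    assume "h = (\<lambda>x. f1 (Affine (of_real x) (wb (of_real x))))"
    then show ?thesis
      by (intro periods_and_integrals(2)[OF d1 _ c1 _ _ v(1) cubic_q_odd_real _ _ k]) (use m period_values in auto)
  next
    assume "h = (\<lambda>x. f2 (Affine (of_real x) (wb (of_real x))))"
    then show ?thesis
      by (intro periods_and_integrals(2)[OF d2 _ c2 _ _ v(2) cubic_q_even_real _ _ k]) (use m period_values in auto)
  qed
qed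

end

theorem theorem5p1:
  fixes a :: "nat \<Rightarrow> real" and b1 :: real
  assumes "0 < a 1" and "a 1 < a 2" and "a 2 < a 3" and "a 3 < a 4" and "a 4 < a 5"
    and "b1 = - (a 1 * a 3 * a 5) / (a 2 * a 4)"
  shows "\<exists>l1 l2 l3 l4 :: complex.
    (let P = branch_poly a b1;
         X = hyperelliptic P;
         h1 = (\<lambda>z w g. 1 / 2 * (1 / g - g) * (1 / z) + (l1 + l2 * z) / w);
         h2 = (\<lambda>z w g. \<i> / 2 * (1 / g + g) * (1 / z) + (l3 + l4 * z) / w);
         \<omega>1 = form_of (\<lambda>p. h1 (zc p) (wc p) (g_on_curve a p)) zc;
         \<omega>2 = form_of (\<lambda>p. h2 (zc p) (wc p) (g_on_curve a p)) zc;
         \<omega>3 = form_of (\<lambda>p. 1 / zc p) zc;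
         \<omega> = triple \<omega>1 \<omega>2 \<omega>3
     in weierstrass_doubly_periodic X (points_over_zero P \<union> points_over_infinity P) \<omega> \<and>
        has_genus X 2 \<and>
        (\<exists>T :: hpoint \<Rightarrow> real^3.
           (\<forall>p \<in> points_over_zero P. scherk_end X \<omega> (- 1) (T p) p) \<and>
           (\<forall>p \<in> points_over_infinity P. scherk_end X \<omega> 1 (T p) p) \<and>
           (\<forall>p \<in> points_over_zero P. \<forall>q \<in> points_over_infinity P. T p \<bullet> T q = 0)) \<and>
        (\<forall>h \<in> {h1, h2}. \<forall>k \<in> {1, 2, 3, 4}.
           (\<lambda>x. h (of_real x) (w_branch a b1 (of_real x)) (g_branch a b1 (of_real x)))
             absolutely_integrable_on {a k..a (k + 1)} \<and>
           Re (integral {a k..a (k + 1)}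
             (\<lambda>x. h (of_real x) (w_branch a b1 (of_real x)) (g_branch a b1 (of_real x)))) = 0))"
proof -
  interpret branch_data a b1 by unfold_locales (use assms in auto)
  obtain s t s' t' where m:
    "moment (a 1) (a 2) (\<lambda>x. base_density base_odd x + s + t * x) = 0" "moment (a 3) (a 4) (\<lambda>x. base_density base_odd x + s + t * x) = 0"
    "moment (a 2) (a 3) (\<lambda>x. base_density base_even x + s' + t' * x) = 0" "moment (a 4) (a 5) (\<lambda>x. base_density base_even x + s' + t' * x) = 0"
    by (rule parameters)
  note W = weierstrass_data[OF m]
  show ?thesis
  \<comment> \<open>Real values for the first two parameters and imaginary ones for the last two
    keep the numerator of the first form real and that of the second imaginary.\<close>
  proof (rule exI[of _ "of_real s"], rule exI[of _ "of_real t"], rule exI[of _ "\<i> * of_real s'"], rule exI[of _ "\<i> * of_real t'"],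
      unfold Let_def, intro conjI)
    show "\<forall>h\<in>{\<lambda>z w g. 1 / 2 * (1 / g - g) * (1 / z) + (complex_of_real s + complex_of_real t * z) / w,
            \<lambda>z w g. \<i> / 2 * (1 / g + g) * (1 / z) + (\<i> * complex_of_real s' + \<i> * complex_of_real t' * z) / w}.
          \<forall>k\<in>{1, 2, 3, 4}.
           (\<lambda>x. h (of_real x) (w_branch a b1 (of_real x)) (g_branch a b1 (of_real x)))
             absolutely_integrable_on {a k..a (k + 1)} \<and>
           Re (integral {a k..a (k + 1)}
             (\<lambda>x. h (of_real x) (w_branch a b1 (of_real x)) (g_branch a b1 (of_real x)))) = 0"
    proof (intro ballI)
      fix h :: "complex \<Rightarrow> complex \<Rightarrow> complex \<Rightarrow> complex" and k :: nat
      assume h: "h \<in> {\<lambda>z w g. 1 / 2 * (1 / g - g) * (1 / z) + (complex_of_real s + complex_of_real t * z) / w,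
            \<lambda>z w g. \<i> / 2 * (1 / g + g) * (1 / z) + (\<i> * complex_of_real s' + \<i> * complex_of_real t' * z) / w}"
        and k: "k \<in> {1, 2, 3, 4}"
      show "(\<lambda>x. h (of_real x) (w_branch a b1 (of_real x)) (g_branch a b1 (of_real x)))
             absolutely_integrable_on {a k..a (k + 1)} \<and>
           Re (integral {a k..a (k + 1)}
             (\<lambda>x. h (of_real x) (w_branch a b1 (of_real x)) (g_branch a b1 (of_real x)))) = 0"
        by (rule W(3)[OF k]) (use h in \<open>auto simp only: g_branch_eq zc.simps wc.simps insert_iff empty_iff\<close>)
    qed
  qed (rule W(1,2) has_genus_2)+
qed

end
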